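(* Let $q\geq 2$ be an integer, let $1\leq s\leq 3$, and let $\lambda_1<\cdots<\lambda_s$ and $\mu_1,\ldots,\mu_s$ be positive integers. If $$\sum_{i=1}^s \mu_i q^{-\lambda_i}\leq \frac34,$$ then there exists a $q$-ary fix-free code having exactly $\mu_i$ codewords of length $\lambda_i$ for every $1\le i\le s$ (and no other codewords). Moreover, such a code is given by a deterministic construction determined by the parameters $q,\lambda_i,\mu_i$ and the numerical (base-$q$) indices of the codewords.
   Context: A $q$-ary code is a finite set of words over the alphabet $\{0,1,\ldots,q-1\}$. It is fix-free (bifix) if no codeword is a proper prefix or a proper suffix of another codeword. *)

theory Defs
  imports Complex_Main "HOL-Library.Sublist"
begin

definition q_ary_code :: "nat \<Rightarrow> nat list set \<Rightarrow> bool" where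
  "q_ary_code q C \<longleftrightarrow> finite C \<and> C \<subseteq> lists {0..<q}"

definition fix_free :: "nat list set \<Rightarrow> bool" where
  "fix_free C \<longleftrightarrow> (\<forall>u\<in>C. \<forall>v\<in>C. \<not> strict_prefix u v \<and> \<not> strict_suffix u v)"

definition has_length_distribution ::
  "nat \<Rightarrow> (nat \<Rightarrow> nat) \<Rightarrow> (nat \<Rightarrow> nat) \<Rightarrow> nat list set \<Rightarrow> bool" where
  "has_length_distribution s lam mu C \<longleftrightarrow>
     (\<forall>i\<in>{1..s}. card {w \<in> C. length w = lam i} = mu i) \<and> length ` C \<subseteq> lam ` {1..s}"

definition admissible :: "nat \<Rightarrow> nat \<Rightarrow> (nat \<Rightarrow> nat) \<Rightarrow> (nat \<Rightarrow> nat) \<Rightarrow> bool" where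
  "admissible s q lam mu \<longleftrightarrow>
     2 \<le> q \<and> (\<forall>i\<in>{1..s}. 0 < lam i \<and> 0 < mu i) \<and> strict_mono_on {1..s} lam \<and>
     (\<Sum>i=1..s. real (mu i) / real q ^ lam i) \<le> 3 / 4"

(* The first letter of a word is the most significant base-q digit of its index;
   horner_sum evaluates with the least significant digit first, hence rev. *)
definition word_index :: "nat \<Rightarrow> nat list \<Rightarrow> nat" where
  "word_index q w = horner_sum id q (rev w)"

(* The total recursive functions of arity n, in Kleene's presentation with minimisation
   restricted to regular functions. Only the values on lists of length n are meaningful. *)
inductive total_recursive :: "nat \<Rightarrow> (nat list \<Rightarrow> nat) \<Rightarrow> bool" where
  zero: "total_recursive n (\<lambda>xs. 0)"
| succ: "total_recursive 1 (\<lambda>xs. Suc (xs ! 0))"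
| proj: "i < n \<Longrightarrow> total_recursive n (\<lambda>xs. xs ! i)"
| comp: "total_recursive (length gs) f \<Longrightarrow> \<forall>g\<in>set gs. total_recursive n g \<Longrightarrow>
    total_recursive n (\<lambda>xs. f (map (\<lambda>g. g xs) gs))"
| prec: "total_recursive n f \<Longrightarrow> total_recursive (n + 2) g \<Longrightarrow>
    total_recursive (n + 1) (\<lambda>xs. rec_nat (f (tl xs)) (\<lambda>k r. g (k # r # tl xs)) (hd xs))"
| minim: "total_recursive (n + 1) f \<Longrightarrow> \<forall>xs. length xs = n \<longrightarrow> (\<exists>k. f (k # xs) = 0) \<Longrightarrow>
    total_recursive n (\<lambda>xs. LEAST k. f (k # xs) = 0)"

(* The value F (q, lam_1, ..., lam_s, mu_1, ..., mu_s, i, j) is read as the index of the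
   j-th codeword of length lam_i, with j counted from 0. *)
definition code_of_indices ::
  "(nat list \<Rightarrow> nat) \<Rightarrow> nat \<Rightarrow> nat \<Rightarrow> (nat \<Rightarrow> nat) \<Rightarrow> (nat \<Rightarrow> nat) \<Rightarrow> nat list set" where
  "code_of_indices F s q lam mu =
     {w \<in> lists {0..<q}. \<exists>i\<in>{1..s}. \<exists>j<mu i. length w = lam i \<and>
        word_index q w = F (q # map lam [1..<s+1] @ map mu [1..<s+1] @ [i, j])}"

end

(* Write a < a+k < a+k+k' for the three lengths. Let B be the set of words of length a that are not
codewords, with density beta, and let A, of density delta, be the set of codewords of length a+k;
they must begin and end in B. The codewords of length a+k+k' have to begin and end in B and to avoid
A at both ends, and one needs words of this kind with density at least beta - delta - 1/4. As x -
1/4 <= x^2, a density of (beta - delta)^2 suffices.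

The number of these words is a quadratic function of A, so A may first be a fractional set: it is
convex along the exchange of weight between two words unless one of them overlaps the other, so that
one direction of the exchange does not decrease it, and at most three words overlap pairwise. Hence
rounding to a genuine set loses less than one word, which does not matter because the bound is
rounded to an integer as well.

It remains to choose B and a fractional A. If a <= k', a set B closed under decreasing letters and
Harris' inequality do it. If k' < a and beta <= floor(q/2)/q, let B consist of words whose first and
last letters have a sum modulo q less than floor(q/2); then both ends of a middle part of a word are
in B with conditional probability at most 1/2, and (1/2 - x)(1/2 - y) >= 0. For larger beta, let B
contain all words with first letter less than g, and let A first be a multiple of the set of words
with first letter less than g that end in B: for a random translate of B the two ends of a word
become independent, and this gives (beta - delta)^2 as long as delta <= beta g/q. For larger delta,
A contains all of these words and a multiple of the others that begin and end in B, and beta - delta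
- 1/4 is so small that a suitable explicit choice of the words of B with first letter at least g
suffices. If q is odd and beta is close to 1/2, the second stage is replaced by variants in which B
depends on the letters 0 and k or in which one averages over translates again.

The construction is made recursive by searching for the least number that codes a code with the
required parameters. *)

theory Submission
  imports Defs
begin

section \<open>Averages over words\<close>

text \<open>The Kraft bound gives \<open>\<delta> \<le> \<beta> - 1/4\<close> and asks for a
  remaining density of at most \<open>\<beta> - \<delta> - 1/4\<close>. If the two ends of a long
  word were independent, \<open>(\<beta> - \<delta>)^2\<close> would remain, and x - 1/4 <= x^2 is
  an equality at x = 1/2. So in general neither the correlation of overlapping ends nor the rounding
  may cost anything, which is what forces the case distinction. The products of B at one end with A
  at the other enter with a negative sign, so positive correlation helps only where their windows
  are disjoint, that is for a <= k'. Otherwise overlapping windows are made independent on average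
  by translating B by a random vector, and one translate that is at least as good as the average is
  kept. The first letter is exempt from the translation because A is defined through it: a first
  letter below g puts a word into B whatever follows, so that words of A begin in B automatically.
  Once A has exhausted these words, \<open>\<delta> > (g/q) * \<beta>\<close>, and the density still
  required is so small that cruder counts are enough.\<close>

text \<open>Words are functions that vanish from N on instead of lists, so that prefixes, shifts and
  changes of a letter are pointwise operations and words of all lengths share one type.\<close>

definition words :: "nat \<Rightarrow> nat \<Rightarrow> (nat \<Rightarrow> nat) set" where
  "words q N = {w. (\<forall>i<N. w i < q) \<and> (\<forall>i\<ge>N. w i = 0)}"

definition avg :: "nat \<Rightarrow> nat \<Rightarrow> ((nat \<Rightarrow> nat) \<Rightarrow> real) \<Rightarrow> real" where
  "avg q N f = (\<Sum>w\<in>words q N. f w) / real q ^ N"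

text \<open>Plays the part of measurability with respect to the letters in I. It is demanded on all
  functions, not only on words over the alphabet, so that it passes through shifts and
  updates.\<close>

definition dep :: "nat set \<Rightarrow> ((nat \<Rightarrow> nat) \<Rightarrow> 'a) \<Rightarrow> bool" where
  "dep I f \<longleftrightarrow> (\<forall>w w'. (\<forall>i\<in>I. w i = w' i) \<longrightarrow> f w = f w')"

definition shift :: "nat \<Rightarrow> (nat \<Rightarrow> nat) \<Rightarrow> nat \<Rightarrow> nat" where
  "shift n w = (\<lambda>i. w (n + i))"

definition restr :: "nat \<Rightarrow> (nat \<Rightarrow> nat) \<Rightarrow> nat \<Rightarrow> nat" where
  "restr a w = (\<lambda>i. if i < a then w i else 0)"

lemma depD: "dep I f \<Longrightarrow> (\<And>i. i \<in> I \<Longrightarrow> w i = w' i) \<Longrightarrow> f w = f w'"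
  unfolding dep_def by blast

lemma depI: "(\<And>w w'. (\<And>i. i \<in> I \<Longrightarrow> w i = w' i) \<Longrightarrow> f w = f w') \<Longrightarrow> dep I f"
  unfolding dep_def by blast

lemma dep_mono: "dep I f \<Longrightarrow> I \<subseteq> J \<Longrightarrow> dep J f"
  unfolding dep_def by blast

lemma dep_upd: "dep I f \<Longrightarrow> p \<notin> I \<Longrightarrow> f (w(p := x)) = f w"
  by (rule depD) auto

lemma dep_restr: "dep {..<a} f \<Longrightarrow> f (restr a w) = f w"
  by (rule depD) (auto simp: restr_def)

lemma dep_shift: "dep {..<a} f \<Longrightarrow> dep {n..<n + a} (\<lambda>w. f (shift n w))"
  by (rule depI, erule depD) (auto simp: shift_def)

lemma dep_const: "dep I (\<lambda>w. c)"
  by (simp add: dep_def)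

lemma dep_empty: "dep {} f \<Longrightarrow> \<exists>t. f = (\<lambda>_. t)"
  by (intro exI[of _ "f (\<lambda>_. 0)"] ext) (erule depD, simp)

lemma dep_letter: "p \<in> I \<Longrightarrow> dep I (\<lambda>w. \<phi> (w p))"
  unfolding dep_def by metis

lemma dep_mult: "dep I f \<Longrightarrow> dep I g \<Longrightarrow> dep I (\<lambda>w. f w * g w :: real)"
  unfolding dep_def by metis

lemma dep_diff: "dep I f \<Longrightarrow> dep I g \<Longrightarrow> dep I (\<lambda>w. f w - g w :: real)"
  unfolding dep_def by metis

lemma dep_add: "dep I f \<Longrightarrow> dep I g \<Longrightarrow> dep I (\<lambda>w. f w + g w :: real)"
  unfolding dep_def by metis

lemma shift_shift: "shift n (shift n' w) = shift (n' + n) w"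
  by (auto simp: shift_def add.assoc)

lemma shift_0 [simp]: "shift 0 w = w"
  by (simp add: shift_def)

lemma shift_upd: "shift n (w(p := x)) = (if p < n then shift n w else (shift n w)(p - n := x))"
  by (auto simp: shift_def fun_eq_iff)

lemma words_0: "words q 0 = {\<lambda>_. 0}"
  by (auto simp: words_def)

lemma words_Suc: "words q (Suc N) = (\<lambda>(w, x). w(N := x)) ` (words q N \<times> {..<q})"
proof (intro equalityI subsetI)
  fix w assume w: "w \<in> words q (Suc N)"
  then have "w = (\<lambda>(w, x). w(N := x)) (w(N := 0), w N)" "(w(N := 0), w N) \<in> words q N \<times> {..<q}"
    by (auto simp: words_def)
  then show "w \<in> (\<lambda>(w, x). w(N := x)) ` (words q N \<times> {..<q})" by blast
qed (auto simp: words_def less_Suc_eq)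

lemma inj_words_Suc: "inj_on (\<lambda>(w, x). w(N := x)) (words q N \<times> {..<q})"
proof (rule inj_onI, clarsimp)
  fix w x w' x' assume "w \<in> words q N" "w' \<in> words q N" and eq: "w(N := x) = w'(N := x')"
  then have "w N = w' N" by (simp add: words_def)
  moreover have "w i = w' i" if "i \<noteq> N" for i using fun_cong[OF eq, of i] that by simp
  ultimately show "w = w' \<and> x = x'" using fun_cong[OF eq, of N] by (metis ext fun_upd_same)
qed

lemma finite_words [simp]: "finite (words q N)"
  by (induction N) (simp_all add: words_0 words_Suc)

lemma card_words: "card (words q N) = q ^ N"
  by (induction N) (simp_all add: words_0 words_Suc card_image inj_words_Suc)

lemma restr_in_words: "(\<And>i. i < a \<Longrightarrow> w i < q) \<Longrightarrow> restr a w \<in> words q a"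
  by (simp add: words_def restr_def)

lemma restr_words [simp]: "w \<in> words q a \<Longrightarrow> restr a w = w"
  by (auto simp: words_def restr_def)

lemma avg_0 [simp]: "avg q 0 f = f (\<lambda>_. 0)"
  by (simp add: avg_def words_0)

lemma avg_Suc: "avg q (Suc N) f = (\<Sum>x<q. avg q N (\<lambda>w. f (w(N := x)))) / q"
proof -
  have "(\<Sum>w\<in>words q (Suc N). f w) = (\<Sum>(w, x)\<in>words q N \<times> {..<q}. f (w(N := x)))"
    unfolding words_Suc by (subst sum.reindex[OF inj_words_Suc]) (simp add: case_prod_unfold)
  also have "\<dots> = (\<Sum>x<q. \<Sum>w\<in>words q N. f (w(N := x)))"
    by (subst sum.swap) (simp add: sum.cartesian_product)
  finally show ?thesis
    by (simp add: avg_def sum_divide_distrib mult.commute)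
qed

lemma avg_cong: "(\<And>w. w \<in> words q N \<Longrightarrow> f w = g w) \<Longrightarrow> avg q N f = avg q N g"
  by (simp add: avg_def)

lemma avg_mono: "(\<And>w. w \<in> words q N \<Longrightarrow> f w \<le> g w) \<Longrightarrow> avg q N f \<le> avg q N g"
  by (simp add: avg_def divide_right_mono sum_mono)

lemma avg_add: "avg q N (\<lambda>w. f w + g w) = avg q N f + avg q N g"
  by (simp add: avg_def sum.distrib add_divide_distrib)

lemma avg_diff: "avg q N (\<lambda>w. f w - g w) = avg q N f - avg q N g"
  by (simp add: avg_def sum_subtractf diff_divide_distrib)

lemma avg_cmult: "avg q N (\<lambda>w. t * f w) = t * avg q N f"
  by (simp add: avg_def flip: sum_distrib_left)

lemma avg_multc: "avg q N (\<lambda>w. f w * t) = avg q N f * t"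
  by (simp add: avg_def flip: sum_distrib_right)

lemma avg_const: "0 < q \<Longrightarrow> avg q N (\<lambda>w. t) = t"
  by (simp add: avg_def card_words)

lemma avg_nonneg: "(\<And>w. w \<in> words q N \<Longrightarrow> 0 \<le> f w) \<Longrightarrow> 0 \<le> avg q N f"
  by (simp add: avg_def sum_nonneg)

lemmas avg_lin = avg_add avg_diff avg_cmult avg_multc

lemma avg_ex:
  assumes "0 < q" "t \<le> avg q N f"
  shows "\<exists>w\<in>words q N. t \<le> f w"
proof (rule ccontr)
  assume "\<not> ?thesis"
  then have "\<And>w. w \<in> words q N \<Longrightarrow> f w < t" by auto
  moreover have "words q N \<noteq> {}" using card_words[of q N] assms(1) by auto
  ultimately have "(\<Sum>w\<in>words q N. f w) < (\<Sum>w\<in>words q N. t)"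
    by (intro sum_strict_mono) auto
  then have "avg q N f < avg q N (\<lambda>w. t)"
    using assms(1) by (simp add: avg_def divide_strict_right_mono)
  then show False using assms by (simp add: avg_const)
qed

text \<open>Exchanging the letter at p with a fresh letter x is an involution on pairs of a word and
  a letter. The independence statements below rest on this conditional expectation.\<close>

lemma avg_resample:
  assumes "p < N"
  shows "avg q N f = avg q N (\<lambda>w. (\<Sum>x<q. f (w(p := x))) / q)"
proof (cases "q = 0")
  case True
  with assms show ?thesis by (simp add: avg_def)
next
  case False
  have "(\<Sum>(w, x)\<in>words q N \<times> {..<q}. f (w(p := x))) = (\<Sum>(w, x)\<in>words q N \<times> {..<q}. f w)"
    by (rule sum.reindex_bij_witness[where i = "\<lambda>(w, x). (w(p := x), w p)" and j = "\<lambda>(w, x). (w(p := x), w p)"])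
      (use assms in \<open>auto simp: words_def\<close>)
  then have "(\<Sum>w\<in>words q N. \<Sum>x<q. f (w(p := x))) = q * (\<Sum>w\<in>words q N. f w)"
    by (simp add: sum_distrib_left flip: sum.cartesian_product)
  then show ?thesis
    using False by (simp add: avg_def flip: sum_divide_distrib)
qed

definition lmean :: "nat \<Rightarrow> (nat \<Rightarrow> real) \<Rightarrow> real" where
  "lmean q \<phi> = (\<Sum>x<q. \<phi> x) / q"

lemma avg_letter:
  assumes "p < N" "\<And>w x. f (w(p := x)) = f w"
  shows "avg q N (\<lambda>w. \<phi> (w p) * f w) = lmean q \<phi> * avg q N f"
proof -
  have "avg q N (\<lambda>w. \<phi> (w p) * f w) = avg q N (\<lambda>w. lmean q \<phi> * f w)"
    by (subst avg_resample[OF assms(1)]) (simp add: assms(2) lmean_def flip: sum_distrib_right)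
  then show ?thesis by (simp add: avg_cmult)
qed

text \<open>The letters of I are averaged out of f one at a time; none of them is seen by g.\<close>

lemma avg_indep:
  assumes "finite I" "I \<subseteq> {..<N}" "dep I f" "dep J g" "I \<inter> J = {}" "0 < q"
  shows "avg q N (\<lambda>w. f w * g w) = avg q N f * avg q N g"
  using assms(1-3,5)
proof (induction I arbitrary: f rule: finite_induct)
  case empty
  then obtain t where "f = (\<lambda>_. t)" using dep_empty by blast
  then show ?case using assms(6) by (simp add: avg_const avg_cmult)
next
  case (insert p I)
  define f' where "f' = (\<lambda>w. (\<Sum>x<q. f (w(p := x))) / q)"
  have "dep I f'"
    unfolding f'_def
  proof (rule depI)
    fix w w' :: "nat \<Rightarrow> nat" assume "\<And>i. i \<in> I \<Longrightarrow> w i = w' i"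
    then have "f (w(p := x)) = f (w'(p := x))" for x
      by (intro depD[OF insert.prems(2)]) auto
    then show "(\<Sum>x<q. f (w(p := x))) / q = (\<Sum>x<q. f (w'(p := x))) / q" by simp
  qed
  have g: "g (w(p := x)) = g w" for w x
    by (rule dep_upd[OF assms(4)]) (use insert.prems(3) in auto)
  have "avg q N (\<lambda>w. f w * g w) = avg q N (\<lambda>w. f' w * g w)"
    by (subst avg_resample[of p]) (use insert.prems(1) g in \<open>simp_all add: f'_def flip: sum_distrib_right\<close>)
  also have "\<dots> = avg q N f' * avg q N g"
    using insert \<open>dep I f'\<close> by auto
  also have "avg q N f' = avg q N f"
    unfolding f'_def by (rule avg_resample[symmetric]) (use insert.prems(1) in auto)
  finally show ?case .
qed

text \<open>An arbitrary injective choice of positions is allowed, not only a window: in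
  \<open>avg_pair\<close> some letters are read from the word and others from the translation
  vector.\<close>

lemma avg_marginal:
  assumes "inj_on \<pi> {..<a}" "\<pi> ` {..<a} \<subseteq> {..<N}" "dep {..<a} f" "0 < q"
  shows "avg q N (\<lambda>w. f (\<lambda>i. w (\<pi> i))) = avg q a f"
  using assms(1-3)
proof (induction a arbitrary: f)
  case 0
  then obtain t where "f = (\<lambda>_. t)" using dep_empty[of f] by auto
  then show ?case by (simp add: avg_const assms(4))
next
  case (Suc a)
  have *: "f (\<lambda>i. (w(\<pi> a := x)) (\<pi> i)) = f ((\<lambda>i. w (\<pi> i))(a := x))" for w x
    by (rule depD[OF Suc.prems(3)]) (use Suc.prems(1) in \<open>auto simp: inj_on_def\<close>)
  have "avg q N (\<lambda>w. f (\<lambda>i. w (\<pi> i))) = avg q N (\<lambda>w. (\<Sum>x<q. f (\<lambda>i. (w(\<pi> a := x)) (\<pi> i))) / q)"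
    by (subst avg_resample[of "\<pi> a"]) (use Suc.prems(2) in auto)
  also have "\<dots> = (\<Sum>x<q. avg q N (\<lambda>w. f ((\<lambda>i. w (\<pi> i))(a := x)))) / q"
    unfolding * avg_def
    by (simp add: sum_divide_distrib) (subst sum.swap, simp add: mult.commute)
  also have "\<dots> = (\<Sum>x<q. avg q a (\<lambda>w. f (w(a := x)))) / q"
  proof -
    have "avg q N (\<lambda>w. f ((\<lambda>i. w (\<pi> i))(a := x))) = avg q a (\<lambda>w. f (w(a := x)))" for x
    proof (rule Suc.IH)
      show "dep {..<a} (\<lambda>w. f (w(a := x)))"
        by (rule depI) (auto intro!: depD[OF Suc.prems(3)])
    qed (use Suc.prems in \<open>auto simp: inj_on_def image_subset_iff\<close>)
    then show ?thesis by simp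
  qed
  finally show ?case by (simp add: avg_Suc)
qed

lemma avg_shift:
  assumes "dep {..<a} f" "n + a \<le> N" "0 < q"
  shows "avg q N (\<lambda>w. f (shift n w)) = avg q a f"
  unfolding shift_def by (rule avg_marginal) (use assms in \<open>auto simp: inj_on_def\<close>)

lemma avg_extend:
  assumes "dep {..<a} f" "a \<le> N" "0 < q"
  shows "avg q N f = avg q a f"
  using avg_shift[OF assms(1), of 0 N q] assms(2,3) by simp

text \<open>A random vector v independent of the word w is realised as the tail of one longer random
  word, so that an average over translates becomes an average over words.\<close>

lemma avg_join:
  assumes "dep {..<N + a} G" "0 < q"
  shows "avg q (N + a) G = avg q a (\<lambda>v. avg q N (\<lambda>w. G (\<lambda>j. if j < N then w j else v (j - N))))"
  using assms(1)
proof (induction a arbitrary: G)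
  case 0
  have "G (\<lambda>j. if j < N then w j else 0) = G w" for w
    by (rule depD[OF 0]) auto
  then show ?case by simp
next
  case (Suc a)
  have *: "(\<lambda>j. if j < N then w j else (v(a := x)) (j - N)) = (\<lambda>j. if j < N then w j else v (j - N))(N + a := x)"
    for w v :: "nat \<Rightarrow> nat" and x by (auto simp: fun_eq_iff)
  have "avg q (N + Suc a) G = (\<Sum>x<q. avg q (N + a) (\<lambda>w. G (w(N + a := x)))) / q"
    by (simp add: avg_Suc)
  also have "\<dots> = (\<Sum>x<q. avg q a (\<lambda>v. avg q N (\<lambda>w. G ((\<lambda>j. if j < N then w j else v (j - N))(N + a := x))))) / q"
  proof -
    have "dep {..<N + a} (\<lambda>w. G (w(N + a := x)))" for x
      by (rule depI) (auto intro!: depD[OF Suc.prems])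
    then show ?thesis by (simp add: Suc.IH)
  qed
  finally show ?case by (simp add: avg_Suc *)
qed

section \<open>Events, Harris' inequality and translates\<close>

definition event :: "nat \<Rightarrow> ((nat \<Rightarrow> nat) \<Rightarrow> real) \<Rightarrow> bool" where
  "event a B \<longleftrightarrow> dep {..<a} B \<and> (\<forall>w. B w = 0 \<or> B w = 1)"

definition antim :: "((nat \<Rightarrow> nat) \<Rightarrow> real) \<Rightarrow> bool" where
  "antim f \<longleftrightarrow> (\<forall>w w'. (\<forall>i. w i \<le> w' i) \<longrightarrow> f w' \<le> f w)"

lemma antimD: "antim f \<Longrightarrow> (\<And>i. w i \<le> w' i) \<Longrightarrow> f w' \<le> f w"
  unfolding antim_def by blast

text \<open>Harris' inequality by induction on the length: for a fixed last letter the induction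
  hypothesis treats the others, and the two conditional means decrease in the last letter, so that
  Chebyshev's sum inequality applies to them.\<close>

lemma avg_mult_antim:
  assumes "antim f" "antim g" "0 < q"
  shows "avg q N f * avg q N g \<le> avg q N (\<lambda>w. f w * g w)"
  using assms(1,2)
proof (induction N arbitrary: f g)
  case 0
  show ?case by simp
next
  case (Suc N)
  define F where "F x = avg q N (\<lambda>w. f (w(N := x)))" for x
  define G where "G x = avg q N (\<lambda>w. g (w(N := x)))" for x
  have mono: "F y \<le> F x" "G y \<le> G x" if "x \<le> y" for x y
    unfolding F_def G_def
    by (auto intro!: avg_mono antimD[OF Suc.prems(1)] antimD[OF Suc.prems(2)] simp: that)
  \<comment> \<open>Chebyshev's inequality is applied to one increasing and one decreasing sequence,
    hence the sign in front of \<open>F\<close>.\<close>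
  have "real q * (\<Sum>k = 0..<q. - F k * G k) \<le> (\<Sum>k = 0..<q. - F k) * (\<Sum>k = 0..<q. G k)"
    using Chebyshev_sum_upper[of q "\<lambda>k. - F k" G] mono by simp
  then have "(\<Sum>x<q. F x) * (\<Sum>x<q. G x) \<le> real q * (\<Sum>x<q. F x * G x)"
    by (simp add: sum_negf lessThan_atLeast0)
  moreover have "(\<Sum>x<q. F x * G x) \<le> (\<Sum>x<q. avg q N (\<lambda>w. f (w(N := x)) * g (w(N := x))))"
    unfolding F_def G_def
  proof (intro sum_mono Suc.IH)
    fix x
    show "antim (\<lambda>w. f (w(N := x)))" "antim (\<lambda>w. g (w(N := x)))"
      using Suc.prems unfolding antim_def by (auto simp: fun_upd_def)
  qed
  ultimately have "(\<Sum>x<q. F x) * (\<Sum>x<q. G x)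
      \<le> real q * (\<Sum>x<q. avg q N (\<lambda>w. f (w(N := x)) * g (w(N := x))))"
    by (meson mult_left_mono of_nat_0_le_iff order_trans)
  then show ?case
    using assms(3) by (simp add: avg_Suc F_def G_def field_simps)
qed

lemma event_dep: "event a B \<Longrightarrow> dep {..<a} B"
  and event_01: "event a B \<Longrightarrow> B w = 0 \<or> B w = 1"
  and event_ge0: "event a B \<Longrightarrow> 0 \<le> B w"
  and event_le1: "event a B \<Longrightarrow> B w \<le> 1"
  unfolding event_def by (blast, blast, metis order_refl zero_le_one, metis order_refl zero_le_one)

lemma eventI: "dep {..<a} B \<Longrightarrow> (\<And>w. B w = 0 \<or> B w = 1) \<Longrightarrow> event a B"
  unfolding event_def by blast

lemma avg_event:
  assumes "event a B" "0 < q"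
  shows "avg q a B = card {w \<in> words q a. B w = 1} / q ^ a"
proof -
  have "(\<Sum>w\<in>words q a. B w) = (\<Sum>w\<in>words q a. if B w = 1 then 1 else 0)"
    by (intro sum.cong refl) (use event_01[OF assms(1)] in force)
  also have "\<dots> = card {w \<in> words q a. B w = 1}"
    by (subst sum.inter_filter[symmetric]) auto
  finally show ?thesis by (simp add: avg_def)
qed

lemma event_between:
  assumes "event a C" "event a D" "\<And>w. C w \<le> D w" "0 < q"
    and "avg q a C \<le> real n / q ^ a" "real n / q ^ a \<le> avg q a D"
  shows "\<exists>B. event a B \<and> (\<forall>w. C w \<le> B w \<and> B w \<le> D w) \<and> avg q a B = real n / q ^ a"
proof -
  let ?X = "{w \<in> words q a. C w = 1}" and ?Y = "{w \<in> words q a. D w = 1}"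
  have "?X \<subseteq> ?Y"
    using assms(3) event_01[OF assms(1)] event_01[OF assms(2)]
    by (auto, metis not_one_le_zero)
  moreover have "card ?X \<le> n" "n \<le> card ?Y"
    using assms(4-6) by (auto simp: avg_event[OF assms(1)] avg_event[OF assms(2)] divide_le_cancel)
  ultimately obtain S where S: "?X \<subseteq> S" "S \<subseteq> ?Y" "card S = n"
    using exists_subset_between[of ?X n ?Y] by auto
  \<comment> \<open>Events are functions on all sequences. Outside the alphabet B copies C, so that
    the two inequalities hold everywhere.\<close>
  define B where "B w = (if \<forall>i<a. w i < q then of_bool (restr a w \<in> S) else C w)" for w
  have restr: "restr a w \<in> words q a" if "\<forall>i<a. w i < q" for w
    using that by (simp add: words_def restr_def)
  have 1: "event a B"
  proof (rule eventI)
    show "dep {..<a} B"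
    proof (rule depI)
      fix w w' :: "nat \<Rightarrow> nat" assume eq: "\<And>i. i \<in> {..<a} \<Longrightarrow> w i = w' i"
      then have "restr a w = restr a w'" by (auto simp: restr_def)
      moreover have "C w = C w'" by (rule depD[OF event_dep[OF assms(1)] eq])
      ultimately show "B w = B w'" using eq by (auto simp: B_def)
    qed
  qed (use event_01[OF assms(1)] in \<open>auto simp: B_def\<close>)
  have C: "C (restr a w) = C w" and D: "D (restr a w) = D w" for w
    by (rule dep_restr, rule event_dep, fact)+
  have 2: "C w \<le> B w \<and> B w \<le> D w" for w
  proof (cases "\<forall>i<a. w i < q")
    case True
    note r = restr[OF True]
    show ?thesis
    proof (cases "restr a w \<in> S")
      case T: True
      then have "D w = 1" using S(2) D by auto
      then show ?thesis using True T event_le1[OF assms(1)] by (simp add: B_def)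
    next
      case F: False
      then have "C w \<noteq> 1" using S(1) C[of w] r by auto
      then show ?thesis using True F event_01[OF assms(1), of w] event_ge0[OF assms(2), of w] by (simp add: B_def)
    qed
  qed (auto simp: B_def assms(3))
  have "B w = of_bool (w \<in> S)" if "w \<in> words q a" for w
    using that restr_words[OF that] by (simp add: B_def words_def[of q a])
  then have "{w \<in> words q a. B w = 1} = S" using S(2) by auto
  then have "avg q a B = real n / q ^ a"
    using avg_event[OF 1 assms(4)] S(3) by simp
  with 1 2 show ?thesis by blast
qed

lemma ex_antim_event:
  assumes "n \<le> q ^ a" "0 < q"
  shows "\<exists>B. event a B \<and> antim B \<and> avg q a B = real n / q ^ a"
proof -
  have "\<exists>S \<subseteq> words q a. card S = n \<and> (\<forall>w\<in>S. \<forall>w'. (\<forall>i. w' i \<le> w i) \<longrightarrow> w' \<in> S)"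
    using assms(1)
  proof (induction n)
    case 0
    show ?case by (intro exI[of _ "{}"]) auto
  next
    case (Suc n)
    then obtain S where S: "S \<subseteq> words q a" "card S = n" "\<forall>w\<in>S. \<forall>w'. (\<forall>i. w' i \<le> w i) \<longrightarrow> w' \<in> S"
      by auto
    have "words q a - S \<noteq> {}"
      using S Suc.prems card_words[of q a] by (metis Diff_eq_empty_iff Suc_le_lessD card_mono finite_words leD subset_antisym)
    \<comment> \<open>The new word has least letter sum among the missing ones: a word strictly
      below it has a smaller sum and is therefore already in S.\<close>
    then obtain w where w: "w \<in> words q a - S" "\<And>w'. w' \<in> words q a - S \<Longrightarrow> sum w {..<a} \<le> sum w' {..<a}"
      using ex_has_least_nat[of "\<lambda>w. w \<in> words q a - S" _ "\<lambda>w. sum w {..<a}"] by blast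
    have "w' \<in> insert w S" if le: "\<forall>i. w' i \<le> w i" for w'
    proof (rule ccontr)
      assume *: "w' \<notin> insert w S"
      have "w' \<in> words q a" using w(1) le by (auto simp: words_def) (metis le_less_trans, metis le_zero_eq)
      then have "sum w {..<a} \<le> sum w' {..<a}" using * w(2) by auto
      moreover obtain i where "w' i \<noteq> w i" using * by (auto simp: fun_eq_iff)
      then have "w' i < w i" using le by (simp add: le_neq_implies_less)
      moreover have "i < a" using \<open>w' i < w i\<close> w(1) by (auto simp: words_def not_less) (metis not_less less_nat_zero_code)
      ultimately show False
        using sum_strict_mono_ex1[of "{..<a}" w' w] le by auto
    qed
    then show ?case
      using S w(1) finite_subset[OF S(1)]
      by (intro exI[of _ "insert w S"]) (auto simp: card_insert_if)
  qed
  then obtain S where S: "S \<subseteq> words q a" "card S = n"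
    "\<And>w w'. w \<in> S \<Longrightarrow> (\<And>i. w' i \<le> w i) \<Longrightarrow> w' \<in> S"
    by blast
  define B :: "(nat \<Rightarrow> nat) \<Rightarrow> real" where "B w = of_bool (restr a w \<in> S)" for w
  have 1: "event a B"
  proof (rule eventI)
    show "dep {..<a} B"
    proof (rule depI)
      fix w w' :: "nat \<Rightarrow> nat" assume eq: "\<And>i. i \<in> {..<a} \<Longrightarrow> w i = w' i"
      then have "restr a w = restr a w'" by (auto simp: restr_def)
      then show "B w = B w'" by (simp add: B_def)
    qed
  qed (auto simp: B_def)
  have "antim B"
    unfolding antim_def
  proof (intro allI impI)
    fix w w' :: "nat \<Rightarrow> nat" assume "\<forall>i. w i \<le> w' i"
    then have "restr a w' \<in> S \<Longrightarrow> restr a w \<in> S"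
      by (elim S(3)) (auto simp: restr_def)
    then show "B w' \<le> B w" by (simp add: B_def)
  qed
  moreover have "{w \<in> words q a. B w = 1} = S" using S(1) by (auto simp: B_def)
  then have "avg q a B = real n / q ^ a" using avg_event[OF 1 assms(2)] S(2) by simp
  ultimately show ?thesis using 1 by blast
qed

section \<open>Random translations of words\<close>

lemma avg_inj:
  assumes "\<And>w. w \<in> words q N \<Longrightarrow> T w \<in> words q N" "inj_on T (words q N)"
  shows "avg q N (\<lambda>w. f (T w)) = avg q N f"
proof -
  have "T ` words q N = words q N"
    using assms by (intro endo_inj_surj) auto
  then have "(\<Sum>w\<in>words q N. f (T w)) = (\<Sum>w\<in>words q N. f w)"
    using sum.reindex[OF assms(2), of f] by simp
  then show ?thesis by (simp add: avg_def)
qed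

lemma mod_add_cancel:
  fixes x y :: nat
  assumes "(x + v) mod q = (y + v) mod q" "x < q" "y < q"
  shows "x = y"
proof (cases "x \<le> y")
  case True
  then have "q dvd y - x" using assms(1) mod_eq_dvd_iff_nat[of "x + v" "y + v" q] by simp
  then show ?thesis using assms(3) True by (auto dest!: dvd_imp_le)
next
  case False
  then have "q dvd x - y" using assms(1) mod_eq_dvd_iff_nat[of "y + v" "x + v" q] by simp
  then show ?thesis using assms(2) False by (auto dest!: dvd_imp_le)
qed

text \<open>Z is the set of letters left alone; conditions that concern only these letters survive
  the translation.\<close>

definition translate :: "nat \<Rightarrow> nat set \<Rightarrow> (nat \<Rightarrow> nat) \<Rightarrow> (nat \<Rightarrow> nat) \<Rightarrow> nat \<Rightarrow> nat" where
  "translate q Z v w = (\<lambda>i. if i \<in> Z then w i else (w i + v i) mod q)"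

lemma avg_translate:
  assumes "dep {..<a} f" "0 < q"
  shows "avg q a (\<lambda>w. f (translate q Z v w)) = avg q a f"
proof -
  have "avg q a (\<lambda>w. f (restr a (translate q Z v w))) = avg q a f"
  proof (rule avg_inj)
    fix w assume "w \<in> words q a"
    then show "restr a (translate q Z v w) \<in> words q a"
      using assms(2) by (intro restr_in_words) (auto simp: translate_def words_def)
  next
    show "inj_on (\<lambda>w. restr a (translate q Z v w)) (words q a)"
    proof (rule inj_onI, rule ext)
      fix w w' i
      assume w: "w \<in> words q a" "w' \<in> words q a"
        and "restr a (translate q Z v w) = restr a (translate q Z v w')"
      then have *: "i < a \<Longrightarrow> translate q Z v w i = translate q Z v w' i"
        by (simp add: restr_def fun_eq_iff) metis
      show "w i = w' i"
      proof (cases "i < a")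
        case True
        then show ?thesis
          using * w by (auto simp: translate_def words_def split: if_splits intro: mod_add_cancel)
      qed (use w in \<open>simp add: words_def\<close>)
    qed
  qed
  then show ?thesis by (simp add: dep_restr[OF assms(1)])
qed

lemma dep_translate:
  "dep {..<a} f \<Longrightarrow> dep {..<a} (\<lambda>w. f (translate q Z v w))"
  by (rule depI, erule depD) (auto simp: translate_def)

lemma event_translate:
  assumes "event a B"
  shows "event a (\<lambda>w. B (translate q Z v w))"
  using assms dep_translate[OF event_dep[OF assms]] unfolding event_def by blast

text \<open>Two overlapping windows of a random word, both translated by the same random vector, are
  independent and uniform: fixing the coordinates in \<^term>\<open>Z\<close> does no harm as long as they lie below
  the offset \<^term>\<open>j\<close> of the windows, for then the first window determines the translation
  recursively.\<close>

lemma avg_pair: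
  assumes f: "dep {..<a} f" and g: "dep {..<a} g" and N: "n + j + a \<le> N" and p: "p < n + j"
    and Z: "Z \<subseteq> {..<j}" "\<not> (n \<le> p \<and> p - n \<in> Z) \<or> \<psi> = (\<lambda>_. 1)" and j: "0 < j" and q: "0 < q"
  shows "avg q (N + a) (\<lambda>W. \<psi> (W p) * (f (translate q Z (shift N W) (shift n W))
      * g (translate q Z (shift N W) (shift (n + j) W)))) = lmean q \<psi> * (avg q a f * avg q a g)"
proof -
  \<comment> \<open>\<open>\<Phi>\<close> replaces both windows by their translates. At the places
    in S this cannot be done in the word, because the letter n + i is overwritten by the second
    window, or is the letter p that \<open>\<psi>\<close> still has to see. There the translated
    letter is stored in the translation vector instead.\<close>
  define S where "S = {i. i < a \<and> (j \<le> i \<or> n + i = p \<and> i \<notin> Z)}"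
  define \<Phi> where "\<Phi> W m =
    (if n + j \<le> m \<and> m < n + j + a then translate q Z (shift N W) (shift (n + j) W) (m - (n + j))
     else if N \<le> m \<and> m < N + a \<and> m - N \<in> S then (W (n + (m - N)) + W m) mod q
     else if n \<le> m \<and> m < n + j \<and> m < n + a \<and> m - n \<notin> S then translate q Z (shift N W) (shift n W) (m - n)
     else W m)" for W m
  have SZ: "i \<notin> Z" if "i \<in> S" for i using that Z by (auto simp: S_def)
  define h where "h W = \<psi> (W p) * (f (\<lambda>i. if i \<in> S then W (N + i) else W (n + i)) * g (shift (n + j) W))" for W
  have \<Phi>1: "\<Phi> W (n + j + i) = translate q Z (shift N W) (shift (n + j) W) i" if "i < a" for W i
    using that by (simp add: \<Phi>_def)
  have \<Phi>2: "\<Phi> W (N + i) = (W (n + i) + W (N + i)) mod q" if "i \<in> S" for W i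
    using that N by (auto simp: \<Phi>_def S_def)
  have \<Phi>3: "\<Phi> W (n + i) = translate q Z (shift N W) (shift n W) i" if "i < a" "i \<notin> S" for W i
    using that N by (auto simp: \<Phi>_def S_def)
  have \<Phi>4: "\<Phi> W (N + i) = W (N + i)" if "i < a" "i \<notin> S" for W i
    using that N by (auto simp: \<Phi>_def)
  have \<Phi>5: "\<Phi> W p = W p" for W
    using p N by (auto simp: \<Phi>_def S_def translate_def shift_def)
  have G: "\<psi> (W p) * (f (translate q Z (shift N W) (shift n W))
      * g (translate q Z (shift N W) (shift (n + j) W))) = h (\<Phi> W)" for W
  proof -
    have "f (translate q Z (shift N W) (shift n W)) = f (\<lambda>i. if i \<in> S then \<Phi> W (N + i) else \<Phi> W (n + i))"
      by (rule depD[OF f]) (auto simp: \<Phi>2 \<Phi>3 translate_def shift_def SZ)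
    moreover have "g (translate q Z (shift N W) (shift (n + j) W)) = g (shift (n + j) (\<Phi> W))"
      by (rule depD[OF g]) (simp add: shift_def[of "n + j" "\<Phi> W"] \<Phi>1)
    ultimately show ?thesis by (simp add: h_def \<Phi>5)
  qed
  have "avg q (N + a) (\<lambda>W. h (\<Phi> W)) = avg q (N + a) h"
  proof (rule avg_inj)
    fix W assume "W \<in> words q (N + a)"
    then show "\<Phi> W \<in> words q (N + a)"
      using N q by (auto simp: words_def \<Phi>_def translate_def shift_def)
  next
    show "inj_on \<Phi> (words q (N + a))"
    proof (rule inj_onI)
      fix W W' assume W: "W \<in> words q (N + a)" "W' \<in> words q (N + a)" and eq: "\<Phi> W = \<Phi> W'"
      have lt: "W m < q" "W' m < q" if "m < N + a" for m using W that by (auto simp: words_def)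
      have undo: "W (n' + i) = W' (n' + i)"
        if "translate q Z (shift N W) (shift n' W) i = translate q Z (shift N W') (shift n' W') i"
          "W (N + i) = W' (N + i)" "n' + i < N + a" for n' i
        using that lt[OF that(3)] by (auto simp: translate_def shift_def split: if_splits intro: mod_add_cancel)
      \<comment> \<open>The vector is recovered from low to high places: for j <= i the letter n + i
        is letter i - j of the second window, which is known once entry i - j of the vector is
        known.\<close>
      have V: "W (N + i) = W' (N + i)" if "i < a" for i
        using that
      proof (induction i rule: less_induct)
        case (less i)
        show ?case
        proof (cases "i \<in> S")
          case False
          then show ?thesis using \<Phi>4[of i W] \<Phi>4[of i W'] less.prems eq by simp
        next
          case True
          have "W (n + i) = W' (n + i)"
          proof (cases "n + i = p")
            case True
            then show ?thesis using \<Phi>5[of W] \<Phi>5[of W'] eq by simp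
          next
            case False
            with \<open>i \<in> S\<close> have i: "j \<le> i" by (simp add: S_def)
            have "W (n + j + (i - j)) = W' (n + j + (i - j))"
            proof (rule undo)
              have "i - j < i" "i - j < a" using i j less.prems by auto
              then show "W (N + (i - j)) = W' (N + (i - j))" by (rule less.IH)
              show "translate q Z (shift N W) (shift (n + j) W) (i - j) = translate q Z (shift N W') (shift (n + j) W') (i - j)"
                using \<Phi>1[OF \<open>i - j < a\<close>, of W] \<Phi>1[OF \<open>i - j < a\<close>, of W'] eq by simp
              show "n + j + (i - j) < N + a" using \<open>i - j < a\<close> N by simp
            qed
            then show ?thesis using i by simp
          qed
          then have "(W (N + i) + W (n + i)) mod q = (W' (N + i) + W (n + i)) mod q"
            using \<Phi>2[OF True, of W] \<Phi>2[OF True, of W'] eq by (simp add: add.commute)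
          then show ?thesis using lt[of "N + i"] less.prems by (auto intro: mod_add_cancel)
        qed
      qed
      show "W = W'"
      proof
        fix m
        consider "N + a \<le> m" | "n + j \<le> m" "m < n + j + a" | "N \<le> m" "m < N + a"
          | "n \<le> m" "m < n + j" "m < n + a" "m - n \<notin> S"
          | "m < N" "\<not> (n + j \<le> m \<and> m < n + j + a)" "\<not> (n \<le> m \<and> m < n + j \<and> m < n + a \<and> m - n \<notin> S)"
          by linarith
        then show "W m = W' m"
        proof cases
          case 1
          then show ?thesis using W by (simp add: words_def)
        next
          case 2
          then show ?thesis
            using undo[of "n + j" "m - (n + j)"] V[of "m - (n + j)"] \<Phi>1[of "m - (n + j)" W]
              \<Phi>1[of "m - (n + j)" W'] eq N by auto
        next
          case 3
          then show ?thesis using V[of "m - N"] by simp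
        next
          case 4
          then show ?thesis
            using undo[of n "m - n"] V[of "m - n"] \<Phi>3[of "m - n" W] \<Phi>3[of "m - n" W'] eq N by auto
        next
          case 5
          then have "\<Phi> W m = W m" "\<Phi> W' m = W' m" by (auto simp: \<Phi>_def)
          then show ?thesis using eq by simp
        qed
      qed
    qed
  qed
  also have "avg q (N + a) h = lmean q \<psi> * avg q (N + a) (\<lambda>W. f (\<lambda>i. if i \<in> S then W (N + i) else W (n + i)) * g (shift (n + j) W))"
  proof (cases "\<psi> = (\<lambda>_. 1)")
    case True
    then have "h = (\<lambda>W. f (\<lambda>i. if i \<in> S then W (N + i) else W (n + i)) * g (shift (n + j) W))"
      by (simp add: h_def fun_eq_iff)
    then show ?thesis using q True by (simp add: lmean_def)
  next
    case False
    show ?thesis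
      unfolding h_def
      proof (rule avg_letter)
        fix W :: "nat \<Rightarrow> nat" and x
        have "f (\<lambda>i. if i \<in> S then (W(p := x)) (N + i) else (W(p := x)) (n + i)) = f (\<lambda>i. if i \<in> S then W (N + i) else W (n + i))"
          by (rule depD[OF f]) (use p N Z False in \<open>auto simp: S_def\<close>)
        moreover have "shift (n + j) (W(p := x)) = shift (n + j) W"
          using p by (simp add: shift_upd)
        ultimately show "f (\<lambda>i. if i \<in> S then (W(p := x)) (N + i) else (W(p := x)) (n + i)) * g (shift (n + j) (W(p := x)))
          = f (\<lambda>i. if i \<in> S then W (N + i) else W (n + i)) * g (shift (n + j) W)" by simp
      qed (use p N in simp)
  qed
  also have "avg q (N + a) (\<lambda>W. f (\<lambda>i. if i \<in> S then W (N + i) else W (n + i)) * g (shift (n + j) W))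
    = avg q (N + a) (\<lambda>W. f (\<lambda>i. if i \<in> S then W (N + i) else W (n + i))) * avg q (N + a) (\<lambda>W. g (shift (n + j) W))"
  proof (rule avg_indep)
    show "dep ({n..<n + j} \<union> {N..<N + a}) (\<lambda>W. f (\<lambda>i. if i \<in> S then W (N + i) else W (n + i)))"
      by (rule depI, rule depD[OF f]) (auto simp: S_def)
    show "dep {n + j..<n + j + a} (\<lambda>W. g (shift (n + j) W))"
      by (rule dep_shift[OF g])
  qed (use N q in auto)
  also have "avg q (N + a) (\<lambda>W. f (\<lambda>i. if i \<in> S then W (N + i) else W (n + i))) = avg q a f"
  proof -
    have "(\<lambda>W. f (\<lambda>i. if i \<in> S then W (N + i) else W (n + i))) = (\<lambda>W. f (\<lambda>i. W (if i \<in> S then N + i else n + i)))"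
      by (intro ext arg_cong[where f = f]) auto
    then show ?thesis
      using N q by (simp only:) (intro avg_marginal f, auto simp: inj_on_def S_def)
  qed
  also have "avg q (N + a) (\<lambda>W. g (shift (n + j) W)) = avg q a g"
    using N q by (intro avg_shift g) auto
  finally show ?thesis unfolding G .
qed

section \<open>Fractional sets of codewords\<close>

definition lo :: "nat \<Rightarrow> nat \<Rightarrow> real" where
  "lo g x = of_bool (x < g)"

lemma lo_01: "lo g x = 0 \<or> lo g x = 1"
  by (simp add: lo_def)

lemma dep_lo: "p \<in> I \<Longrightarrow> dep I (\<lambda>w. lo g (w p))"
  by (rule dep_letter)

lemma lmean_lo: "g \<le> q \<Longrightarrow> lmean q (lo g) = g / q"
proof -
  assume "g \<le> q"
  then have "{..<q} \<inter> {x. x < g} = {..<g}" by auto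
  then show ?thesis by (simp add: lmean_def lo_def of_bool_def sum.If_cases)
qed

lemma lmean_const: "0 < q \<Longrightarrow> lmean q (\<lambda>x. t) = t"
  by (simp add: lmean_def)

lemma lmean_affine: "0 < q \<Longrightarrow> lmean q (\<lambda>x. s + t * \<phi> x) = s + t * lmean q \<phi>"
  by (simp add: lmean_def sum.distrib add_divide_distrib flip: sum_distrib_left)

lemma lmean_hi: "g \<le> q \<Longrightarrow> 0 < q \<Longrightarrow> lmean q (\<lambda>x. 1 - t * lo g x) = 1 - t * (g / q)"
  using lmean_affine[of q 1 "- t" "lo g"] by (simp add: lmean_lo)

lemma lmean_hi1: "g \<le> q \<Longrightarrow> 0 < q \<Longrightarrow> lmean q (\<lambda>x. 1 - lo g x) = 1 - g / q"
  using lmean_hi[of g q 1] by simp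

text \<open>Here \<^term>\<open>\<alpha>\<close> is a fractional set of codewords of length \<^term>\<open>a + k\<close>, and the last average is the
  density of the words of length \<^term>\<open>a + k + k'\<close> that begin and end in \<^term>\<open>B\<close> and avoid \<^term>\<open>\<alpha>\<close> at
  both ends.\<close>

definition splittable :: "nat \<Rightarrow> nat \<Rightarrow> nat \<Rightarrow> nat \<Rightarrow> real \<Rightarrow> real \<Rightarrow> bool" where
  "splittable q a k k' \<beta> \<delta> \<longleftrightarrow> (\<exists>B \<alpha>. event a B \<and> avg q a B = \<beta> \<and> dep {..<a + k} \<alpha> \<and>
     (\<forall>w. 0 \<le> \<alpha> w \<and> \<alpha> w \<le> B w * B (shift k w)) \<and> avg q (a + k) \<alpha> = \<delta> \<and>
     \<beta> - \<delta> - 1 / 4 \<le> avg q (a + k + k')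
       (\<lambda>w. (B w - \<alpha> w) * (B (shift (k + k') w) - \<alpha> (shift k' w))))"

lemma square_bound: "(x::real) - 1 / 4 \<le> x\<^sup>2"
  using zero_le_power2[of "x - 1 / 2"] by (simp add: power2_eq_square algebra_simps)

section \<open>Averages over words of length a + k + k'\<close>

locale three_lengths =
  fixes q a k k' :: nat
  assumes q: "2 \<le> q" and a: "0 < a" and k: "0 < k" and k': "0 < k'"
begin

abbreviation E :: "((nat \<Rightarrow> nat) \<Rightarrow> real) \<Rightarrow> real" where
  "E \<equiv> avg q (a + k + k')"

lemma q0: "0 < q" using q by simp

lemma E_window: "dep {..<a} f \<Longrightarrow> n \<le> k + k' \<Longrightarrow> E (\<lambda>w. f (shift n w)) = avg q a f"
  by (intro avg_shift q0) auto

lemma E_word: "dep {..<a} f \<Longrightarrow> E f = avg q a f"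
  using E_window[of f 0] by simp

lemma E_shift_word: "dep {..<a + k} f \<Longrightarrow> E (\<lambda>w. f (shift k' w)) = E f"
  using avg_shift[of "a + k" f k' "a + k + k'" q] avg_extend[of "a + k" f "a + k + k'" q] q0 by simp

lemma E_letter_window:
  "dep {..<a} f \<Longrightarrow> p < n \<Longrightarrow> n \<le> k + k' \<Longrightarrow> E (\<lambda>w. \<phi> (w p) * f (shift n w)) = lmean q \<phi> * avg q a f"
  by (subst avg_letter) (auto simp: shift_upd E_window)

lemma avg_event_bounds: "event a B \<Longrightarrow> 0 \<le> avg q a B" "event a B \<Longrightarrow> avg q a B \<le> 1"
  using avg_nonneg[of q a B] avg_mono[of q a B "\<lambda>_. 1"] avg_const[OF q0, of a 1]
    event_ge0[of a B] event_le1[of a B] by auto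

lemma avg_pair':
  assumes "dep {..<a} f" "dep {..<a} g" "n + j \<le> k + k'" "p < n + j"
    and "Z \<subseteq> {..<j}" "\<not> (n \<le> p \<and> p - n \<in> Z) \<or> \<psi> = (\<lambda>_. 1)" "0 < j"
  shows "avg q a (\<lambda>v. E (\<lambda>w. \<psi> (w p) * (f (translate q Z v (shift n w)) * g (translate q Z v (shift (n + j) w)))))
    = lmean q \<psi> * (avg q a f * avg q a g)"
proof -
  let ?N = "a + k + k'"
  define G where "G W = \<psi> (W p) * (f (translate q Z (shift ?N W) (shift n W))
      * g (translate q Z (shift ?N W) (shift (n + j) W)))" for W
  have "dep {..<?N + a} G"
  proof (rule depI)
    fix w w' :: "nat \<Rightarrow> nat" assume eq: "\<And>i. i \<in> {..<?N + a} \<Longrightarrow> w i = w' i"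
    have "f (translate q Z (shift ?N w) (shift n w)) = f (translate q Z (shift ?N w') (shift n w'))"
      by (rule depD[OF assms(1)]) (use assms(3) in \<open>auto simp: translate_def shift_def eq\<close>)
    moreover have "g (translate q Z (shift ?N w) (shift (n + j) w)) = g (translate q Z (shift ?N w') (shift (n + j) w'))"
      by (rule depD[OF assms(2)]) (use assms(3) in \<open>auto simp: translate_def shift_def eq\<close>)
    moreover have "w p = w' p" using assms(3,4) by (intro eq) auto
    ultimately show "G w = G w'" by (simp add: G_def)
  qed
  then have J: "avg q (?N + a) G = avg q a (\<lambda>v. E (\<lambda>w. G (\<lambda>j. if j < ?N then w j else v (j - ?N))))"
    by (rule avg_join) (rule q0)
  have GJ: "G (\<lambda>j. if j < ?N then w j else v (j - ?N)) =
    \<psi> (w p) * (f (translate q Z v (shift n w)) * g (translate q Z v (shift (n + j) w)))" for v w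
  proof -
    let ?W = "\<lambda>j. if j < ?N then w j else v (j - ?N)"
    have "f (translate q Z (shift ?N ?W) (shift n ?W)) = f (translate q Z v (shift n w))"
      by (rule depD[OF assms(1)]) (use assms(3) in \<open>auto simp: translate_def shift_def\<close>)
    moreover have "g (translate q Z (shift ?N ?W) (shift (n + j) ?W)) = g (translate q Z v (shift (n + j) w))"
      by (rule depD[OF assms(2)]) (use assms(3) in \<open>auto simp: translate_def shift_def\<close>)
    ultimately show ?thesis using assms(3,4) by (simp add: G_def)
  qed
  have "avg q (?N + a) G = lmean q \<psi> * (avg q a f * avg q a g)"
    unfolding G_def using assms q0 by (intro avg_pair) auto
  with J show ?thesis by (simp add: GJ)
qed

lemma avg_E_pair:
  assumes "dep {..<a} f" "dep {..<a} g" "n + j \<le> k + k'" "Z \<subseteq> {..<j}" "0 < j"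
  shows "avg q a (\<lambda>v. E (\<lambda>w. f (translate q Z v (shift n w)) * g (translate q Z v (shift (n + j) w))))
    = avg q a f * avg q a g"
  using avg_pair'[OF assms(1-3), of 0 Z "\<lambda>_. 1"] assms(4,5) q0 by (simp add: lmean_const)

end

section \<open>Constructions with a single family of weighted codewords\<close>

lemma antim_shift: "antim f \<Longrightarrow> antim (\<lambda>w. f (shift m w))"
  unfolding antim_def shift_def by simp

context three_lengths
begin

lemma splittableI:
  assumes "event a B" "avg q a B = \<beta>" "dep {..<a + k} \<alpha>"
    and "\<And>w. 0 \<le> \<alpha> w" "\<And>w. \<alpha> w \<le> B w * B (shift k w)" "E \<alpha> = \<delta>"
    and "\<beta> - \<delta> - 1 / 4 \<le> E (\<lambda>w. (B w - \<alpha> w) * (B (shift (k + k') w) - \<alpha> (shift k' w)))"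
  shows "splittable q a k k' \<beta> \<delta>"
  unfolding splittable_def using assms avg_extend[OF assms(3), of "a + k + k'" q] q0
  by (intro exI[of _ B] exI[of _ \<alpha>]) auto

lemma lo_mult_event:
  assumes "event n B" "\<And>w. lo g (w 0) \<le> B w"
  shows "lo g (w p) * B (shift p w) = lo g (w p)"
  using event_01[OF assms(1), of "shift p w"] lo_01[of g "w p"] assms(2)[of "shift p w"]
  by (auto simp: shift_def)

lemma dep_event_shift: "event a B \<Longrightarrow> n \<le> k \<Longrightarrow> dep {..<a + k} (\<lambda>w. B (shift n w))"
  by (rule dep_mono[OF dep_shift[OF event_dep]]) auto

lemma dep_event_word: "event a B \<Longrightarrow> dep {..<a + k} B"
  using dep_event_shift[of B 0] by simp

lemma E_letter: "p < a + k + k' \<Longrightarrow> E (\<lambda>w. \<phi> (w p)) = lmean q \<phi>"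
  using avg_letter[of p "a + k + k'" "\<lambda>_. 1" q \<phi>] q0 by (simp add: avg_const)

lemma E_indep:
  assumes "dep {..<x} f" "dep {y..<z} g" "x \<le> y" "x \<le> a + k + k'"
  shows "E (\<lambda>w. f w * g w) = E f * E g"
  by (rule avg_indep[OF _ _ assms(1,2)]) (use assms q0 in auto)

lemma avg_lo_le:
  assumes "\<And>w. lo g (w 0) \<le> B w" "g \<le> q"
  shows "g / q \<le> avg q a B"
proof -
  have "avg q a (\<lambda>w. lo g (w 0) * 1) = g / q"
    using avg_letter[of 0 a "\<lambda>_. 1" q "lo g"] a q0 assms(2) by (simp add: avg_const lmean_lo)
  then show ?thesis using avg_mono[of q a "\<lambda>w. lo g (w 0) * 1" B] assms(1) by simp
qed

text \<open>A is s times the set of words with first letter below g that end in B. Its density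
  \<open>s * (b * \<beta>)\<close> is the same for every translate, since the first letter is
  outside the last window. The remaining density is \<open>X v - s * b * Y v\<close>; on average X
  is \<open>(1 - s * b) * \<beta>^2\<close> and Y is at most that, which leaves
  \<open>((1 - s * b) * \<beta>)^2 = (\<beta> - \<delta>)^2\<close>.\<close>

lemma splittable_small:
  assumes B: "event a B" and C: "\<And>w. lo g (w 0) \<le> B w" and g: "0 < g" "g \<le> q"
    and \<beta>: "avg q a B = \<beta>" and \<delta>: "0 \<le> \<delta>" "\<delta> \<le> g / q * \<beta>"
  shows "splittable q a k k' \<beta> \<delta>"
proof -
  define b where "b = real g / q"
  have b: "0 < b" "b \<le> 1" "b \<le> \<beta>" "\<beta> \<le> 1"
    using g q0 avg_lo_le[where B = B, OF C g(2)] avg_event_bounds[OF B] \<beta> by (auto simp: b_def)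
  define s where "s = \<delta> / (b * \<beta>)"
  have s: "0 \<le> s" "s \<le> 1" "s * (b * \<beta>) = \<delta>"
    using \<delta> b by (auto simp: s_def b_def[symmetric] divide_le_eq)
  define Bv where "Bv v w = B (translate q {0} v w)" for v w
  have ev: "event a (Bv v)" for v unfolding Bv_def by (rule event_translate[OF B])
  have Cv: "lo g (w 0) \<le> Bv v w" for v w
    using C[of "translate q {0} v w"] by (simp add: Bv_def translate_def)
  have \<psi>: "lmean q (\<lambda>x. 1 - s * lo g x) = 1 - s * b"
    using lmean_hi g q0 by (simp add: b_def)
  define X where "X v = E (\<lambda>w. (1 - s * lo g (w k')) * (Bv v (shift 0 w) * Bv v (shift (0 + (k + k')) w)))" for v
  define Y where "Y v = E (\<lambda>w. (1 - s * lo g (w k')) * (Bv v (shift k w) * Bv v (shift (k + k') w)))" for v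
  have X: "avg q a X = (1 - s * b) * \<beta>\<^sup>2"
    unfolding X_def Bv_def
    by (subst avg_pair') (use event_dep[OF B] k k' in \<open>auto simp: \<psi> \<beta> power2_eq_square\<close>)
  have Y: "avg q a Y \<le> (1 - s * b) * \<beta>\<^sup>2"
  proof (cases "k = k'")
    case False
    have "avg q a Y = (1 - s * b) * \<beta>\<^sup>2"
      unfolding Y_def Bv_def
      by (subst avg_pair') (use event_dep[OF B] k k' False in \<open>auto simp: \<psi> \<beta> power2_eq_square\<close>)
    then show ?thesis by simp
  next
    case True
    \<comment> \<open>Now the letter k' is the first letter of the window at k, which the
      translation fixes, so \<open>avg_pair'\<close> does not cover this factor. But a low first
      letter already puts that window into B. The average of Y becomes
      \<open>\<beta>^2 - s * b * \<beta>\<close>, which is small enough by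
      \<open>\<beta> \<le> 1\<close>.\<close>
    have "Y v = E (\<lambda>w. Bv v (shift k w) * Bv v (shift (k + k') w)) - s * (b * \<beta>)" for v
    proof -
      have "Y v = E (\<lambda>w. Bv v (shift k w) * Bv v (shift (k + k') w)
          - s * (lo g (w k) * Bv v (shift (k + k') w)))"
        unfolding Y_def
      proof (rule avg_cong)
        fix w
        have "(1 - s * lo g (w k')) * (Bv v (shift k w) * Bv v (shift (k + k') w))
          = Bv v (shift k w) * Bv v (shift (k + k') w) - s * ((lo g (w k) * Bv v (shift k w)) * Bv v (shift (k + k') w))"
          using True by (simp add: algebra_simps)
        then show "(1 - s * lo g (w k')) * (Bv v (shift k w) * Bv v (shift (k + k') w))
          = Bv v (shift k w) * Bv v (shift (k + k') w) - s * (lo g (w k) * Bv v (shift (k + k') w))"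
          by (simp add: lo_mult_event[OF ev Cv])
      qed
      also have "E (\<lambda>w. lo g (w k) * Bv v (shift (k + k') w)) = b * avg q a (Bv v)"
        using E_letter_window[OF event_dep[OF ev], of k "k + k'" "lo g" v] k' g
        by (simp add: lmean_lo b_def)
      then have "E (\<lambda>w. Bv v (shift k w) * Bv v (shift (k + k') w) - s * (lo g (w k) * Bv v (shift (k + k') w)))
        = E (\<lambda>w. Bv v (shift k w) * Bv v (shift (k + k') w)) - s * (b * avg q a (Bv v))"
        by (simp add: avg_lin)
      also have "avg q a (Bv v) = \<beta>"
        unfolding Bv_def using avg_translate[OF event_dep[OF B]] q0 \<beta> by simp
      finally show ?thesis .
    qed
    then have "Y = (\<lambda>v. E (\<lambda>w. Bv v (shift k w) * Bv v (shift (k + k') w)) - s * (b * \<beta>))"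
      by (rule ext)
    then have "avg q a Y = \<beta>\<^sup>2 - s * (b * \<beta>)"
      using avg_E_pair[OF event_dep[OF B] event_dep[OF B], of k k' "{0}"] k k' q0
      by (simp add: avg_lin avg_const Bv_def \<beta> power2_eq_square)
    moreover have "s * b * \<beta> * \<beta> \<le> s * b * \<beta> * 1"
      using s b by (intro mult_left_mono) auto
    ultimately show ?thesis by (simp add: algebra_simps power2_eq_square)
  qed
  have "avg q a (\<lambda>v. X v - s * b * Y v) \<ge> (1 - s * b) * \<beta>\<^sup>2 - s * b * ((1 - s * b) * \<beta>\<^sup>2)"
    using X mult_left_mono[OF Y, of "s * b"] s b by (simp add: avg_lin)
  also have "(1 - s * b) * \<beta>\<^sup>2 - s * b * ((1 - s * b) * \<beta>\<^sup>2) = (\<beta> - \<delta>)\<^sup>2"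
    using s(3) by (simp add: power2_eq_square algebra_simps)
  finally obtain v where v: "(\<beta> - \<delta>)\<^sup>2 \<le> X v - s * b * Y v"
    using avg_ex[OF q0] by blast
  define \<alpha> where "\<alpha> w = s * (lo g (w 0) * Bv v (shift k w))" for w
  show ?thesis
  proof (rule splittableI)
    show "event a (Bv v)" by (rule ev)
    show "avg q a (Bv v) = \<beta>"
      unfolding Bv_def using avg_translate[OF event_dep[OF B]] q0 \<beta> by simp
    show "dep {..<a + k} \<alpha>"
      unfolding \<alpha>_def using a by (intro dep_mult dep_const dep_lo dep_event_shift ev) auto
    show "0 \<le> \<alpha> w" for w
      using s event_ge0[OF ev] by (simp add: \<alpha>_def lo_def)
    show "\<alpha> w \<le> Bv v w * Bv v (shift k w)" for w
    proof -
      have "\<alpha> w \<le> 1 * (lo g (w 0) * Bv v (shift k w))"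
        unfolding \<alpha>_def using s event_ge0[OF ev] by (intro mult_right_mono) (auto simp: lo_def)
      also have "\<dots> \<le> Bv v w * Bv v (shift k w)"
        using Cv event_ge0[OF ev] by (simp add: mult_right_mono)
      finally show ?thesis .
    qed
    have "E (\<lambda>w. lo g (w 0) * Bv v (shift k w)) = b * \<beta>"
      using E_letter_window[OF event_dep[OF ev], of 0 k "lo g" v] k g \<open>avg q a (Bv v) = \<beta>\<close>
      by (simp add: lmean_lo b_def)
    then show "E \<alpha> = \<delta>" unfolding \<alpha>_def using s by (simp add: avg_lin)
    have "E (\<lambda>w. (Bv v w - \<alpha> w) * (Bv v (shift (k + k') w) - \<alpha> (shift k' w)))
      = E (\<lambda>w. (1 - s * lo g (w k')) * (Bv v (shift 0 w) * Bv v (shift (0 + (k + k')) w))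
        - s * (lo g (w 0) * ((1 - s * lo g (w k')) * (Bv v (shift k w) * Bv v (shift (k + k') w)))))"
    proof (rule avg_cong)
      fix w
      have e: "\<alpha> (shift k' w) = s * (lo g (w k') * Bv v (shift (k + k') w))"
        by (simp add: \<alpha>_def shift_shift add.commute[of k' k]) (simp add: shift_def)
      show "(Bv v w - \<alpha> w) * (Bv v (shift (k + k') w) - \<alpha> (shift k' w))
        = (1 - s * lo g (w k')) * (Bv v (shift 0 w) * Bv v (shift (0 + (k + k')) w))
          - s * (lo g (w 0) * ((1 - s * lo g (w k')) * (Bv v (shift k w) * Bv v (shift (k + k') w))))"
        unfolding e by (simp add: \<alpha>_def algebra_simps)
    qed
    also have "\<dots> = X v - s * E (\<lambda>w. lo g (w 0) * ((1 - s * lo g (w k')) * (Bv v (shift k w) * Bv v (shift (k + k') w))))"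
      by (simp add: avg_lin X_def)
    also have "E (\<lambda>w. lo g (w 0) * ((1 - s * lo g (w k')) * (Bv v (shift k w) * Bv v (shift (k + k') w)))) = b * Y v"
      unfolding Y_def by (subst avg_letter) (use k k' g in \<open>auto simp: shift_upd lmean_lo b_def\<close>)
    finally show "\<beta> - \<delta> - 1 / 4 \<le> E (\<lambda>w. (Bv v w - \<alpha> w) * (Bv v (shift (k + k') w) - \<alpha> (shift k' w)))"
      using v square_bound[of "\<beta> - \<delta>"] by (simp add: mult.assoc)
  qed
qed

text \<open>By a <= k' the window at 0 is disjoint from the suffix of length a + k, and the prefix
  of length a + k from the window at k + k'. So both negative terms factor exactly, and the overlap
  is confined to the positive term \<open>V w * V (shift k' w)\<close>, where Harris' inequality
  points the right way. It also shows that the words beginning and ending in B have density at least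
  \<open>\<beta>^2\<close>, enough to carry \<open>\<delta>\<close>.\<close>

lemma splittable_disjoint:
  assumes k'a: "a \<le> k'" and n: "n \<le> q ^ a" "real n / q ^ a = \<beta>" and \<delta>: "0 \<le> \<delta>" "\<delta> \<le> \<beta> - 1 / 4"
  shows "splittable q a k k' \<beta> \<delta>"
proof -
  obtain B where B: "event a B" "antim B" "avg q a B = \<beta>"
    using ex_antim_event[OF n(1) q0] n(2) by blast
  note dB = event_dep[OF B(1)]
  have anti: "antim (\<lambda>w. B (shift m w))" for m
    by (rule antim_shift[OF B(2)])
  define V where "V w = B w * B (shift k w)" for w
  have V01: "V w = 0 \<or> V w = 1" for w
    unfolding V_def using event_01[OF B(1), of w] event_01[OF B(1), of "shift k w"] by auto
  have dV: "dep {..<a + k} V"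
    unfolding V_def by (intro dep_mult dep_event_word dep_event_shift B(1)) simp
  have antiV: "antim V"
    unfolding antim_def V_def
    by (intro allI impI mult_mono antimD[OF B(2)] antimD[OF anti[of k]] event_ge0[OF B(1)]) auto
  define \<rho> where "\<rho> = E V"
  have \<rho>: "\<beta>\<^sup>2 \<le> \<rho>"
    using avg_mult_antim[OF B(2) anti[of k] q0, of "a + k + k'"] E_word[OF dB] E_window[OF dB, of k] B(3)
      avg_cong[of q _ V "\<lambda>w. B w * B (shift k w)"] V_def
    by (simp add: \<rho>_def power2_eq_square)
  have "0 < \<beta>\<^sup>2" using \<delta> by simp
  then have "0 < \<rho>" using \<rho> by linarith
  define t where "t = \<delta> / \<rho>"
  have t: "0 \<le> t" "t \<le> 1" "t * \<rho> = \<delta>"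
    using \<delta> \<open>0 < \<rho>\<close> \<rho> square_bound[of \<beta>] by (simp_all add: t_def)
  have E1: "E (\<lambda>w. B w * B (shift (k + k') w)) = \<beta> * \<beta>"
    using E_indep[OF dB dep_shift[OF dB, of "k + k'"]] k'a E_word[OF dB] E_window[OF dB, of "k + k'"] B(3)
    by simp
  have E2: "E (\<lambda>w. V w * B (shift (k + k') w)) = \<rho> * \<beta>"
    using E_indep[OF dV dep_shift[OF dB, of "k + k'"]] k'a E_window[OF dB, of "k + k'"] B(3)
    by (simp add: \<rho>_def)
  have dV': "dep {k'..<k' + (a + k)} (\<lambda>w. V (shift k' w))"
    using dep_shift[OF dV, of k'] .
  have E3: "E (\<lambda>w. B w * V (shift k' w)) = \<beta> * \<rho>"
    using E_indep[OF dB dV'] k'a E_word[OF dB] B(3) E_shift_word[OF dV] by (simp add: \<rho>_def)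
  have E4: "\<rho> * \<rho> \<le> E (\<lambda>w. V w * V (shift k' w))"
  proof -
    from avg_mult_antim[OF antiV antim_shift[OF antiV, of k'] q0, of "a + k + k'"] show ?thesis
      using E_shift_word[OF dV] by (simp add: \<rho>_def)
  qed
  show ?thesis
  proof (rule splittableI[OF B(1,3)])
    show "dep {..<a + k} (\<lambda>w. t * V w)" by (intro dep_mult dep_const dV)
    show "0 \<le> t * V w" for w using t V01[of w] by auto
    show "t * V w \<le> B w * B (shift k w)" for w
      using t V01[of w] by (auto simp: V_def[symmetric])
    show "E (\<lambda>w. t * V w) = \<delta>" using t by (simp add: avg_lin \<rho>_def)
    have "E (\<lambda>w. (B w - t * V w) * (B (shift (k + k') w) - t * V (shift k' w)))
      = E (\<lambda>w. B w * B (shift (k + k') w) - t * (V w * B (shift (k + k') w)) - t * (B w * V (shift k' w))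
         + t * t * (V w * V (shift k' w)))"
      by (rule avg_cong) (simp add: left_diff_distrib right_diff_distrib)
    also have "\<dots> \<ge> \<beta> * \<beta> - t * (\<rho> * \<beta>) - t * (\<beta> * \<rho>) + t * t * (\<rho> * \<rho>)"
      using mult_left_mono[OF E4, of "t * t"] t by (simp add: avg_lin E1 E2 E3)
    also have "\<beta> * \<beta> - t * (\<rho> * \<beta>) - t * (\<beta> * \<rho>) + t * t * (\<rho> * \<rho>) = (\<beta> - \<delta>)\<^sup>2"
      using t(3)[symmetric] by (simp add: power2_eq_square algebra_simps)
    finally show "\<beta> - \<delta> - 1 / 4 \<le> E (\<lambda>w. (B w - t * V w) * (B (shift (k + k') w) - t * V (shift k' w)))"
      using square_bound[of "\<beta> - \<delta>"] by linarith
  qed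
qed

end

section \<open>Events given by the cyclic sum of two letters\<close>

lemma card_cyclic:
  fixes q h v :: nat
  assumes "h \<le> q" "0 < q"
  shows "(\<Sum>x<q. of_bool ((x + v) mod q < h) :: real) = h"
proof -
  have inj: "inj_on (\<lambda>x. (x + v) mod q) {..<q}"
    by (rule inj_onI) (auto intro: mod_add_cancel)
  then have img: "(\<lambda>x. (x + v) mod q) ` {..<q} = {..<q}"
    using assms(2) by (intro endo_inj_surj) auto
  have "(\<Sum>x<q. of_bool ((x + v) mod q < h) :: real) = (\<Sum>x<q. of_bool (x < h))"
    using sum.reindex[OF inj, of "\<lambda>x. of_bool (x < h) :: real"] img by simp
  also have "\<dots> = h"
    using lmean_lo[OF assms(1)] assms(2) by (simp add: lmean_def lo_def[abs_def])
  finally show ?thesis .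
qed

definition cyc :: "nat \<Rightarrow> nat \<Rightarrow> nat \<Rightarrow> nat \<Rightarrow> real" where
  "cyc q h x y = of_bool ((x + y) mod q < h)"

lemma lmean_cyc: "h \<le> q \<Longrightarrow> 0 < q \<Longrightarrow> lmean q (\<lambda>x. cyc q h x y) = h / q"
  "h \<le> q \<Longrightarrow> 0 < q \<Longrightarrow> lmean q (\<lambda>y. cyc q h x y) = h / q"
  using card_cyclic[of h q] by (simp_all add: lmean_def cyc_def add.commute[of x])

text \<open>A factor dominated by \<^term>\<open>cyc q h\<close> has conditional mean at most \<^term>\<open>h / q\<close> given all letters
  but one, so both conditional means lie on the same side of \<^term>\<open>h / q\<close>.\<close>

lemma avg_balanced:
  assumes q: "0 < q" and h: "h \<le> q" and N: "0 < N - 1" and u: "u \<noteq> 0" and v: "v \<noteq> N - 1"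
    and f: "\<And>w. f w \<le> cyc q h (w 0) (w u)" "\<And>w x. f (w(N - 1 := x)) = f w"
    and g: "\<And>w. g w \<le> cyc q h (w v) (w (N - 1))" "\<And>w x. g (w(0 := x)) = g w"
  shows "h / q * avg q N f + h / q * avg q N g - (h / q)\<^sup>2 \<le> avg q N (\<lambda>w. f w * g w)"
proof -
  define l where "l = real h / q"
  define F where "F w = (\<Sum>x<q. f (w(0 := x))) / q" for w
  define G where "G w = (\<Sum>x<q. g (w(N - 1 := x))) / q" for w
  have F1: "F w \<le> l" for w
  proof -
    have "F w \<le> (\<Sum>x<q. cyc q h x (w u)) / q"
      unfolding F_def using f(1)[of "w(0 := x)" for x] u by (intro divide_right_mono sum_mono) auto
    then show ?thesis using lmean_cyc(1)[OF h q, of "w u"] q by (simp add: l_def lmean_def)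
  qed
  have G1: "G w \<le> l" for w
  proof -
    have "G w \<le> (\<Sum>x<q. cyc q h (w v) x) / q"
      unfolding G_def using g(1)[of "w(N - 1 := x)" for x] v by (intro divide_right_mono sum_mono) auto
    then show ?thesis using lmean_cyc(2)[OF h q, of "w v"] q by (simp add: l_def lmean_def)
  qed
  have FN: "F (w(N - 1 := x)) = F w" for w x
  proof -
    have "f (w(N - 1 := x, 0 := y)) = f (w(0 := y))" for y
      using N f(2)[of "w(0 := y)" x] by (subst fun_upd_twist) auto
    then show ?thesis by (simp add: F_def)
  qed
  have "avg q N f = avg q N F" "avg q N g = avg q N G"
    unfolding F_def G_def using N by (auto intro!: avg_resample)
  moreover have "avg q N (\<lambda>w. f w * g w) = avg q N (\<lambda>w. F w * g w)"
    using N by (subst avg_resample[of 0]) (simp_all add: F_def g(2) flip: sum_distrib_right)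
  moreover have "avg q N (\<lambda>w. F w * g w) = avg q N (\<lambda>w. F w * G w)"
  proof -
    have "(\<Sum>x<q. F (w(N - 1 := x)) * g (w(N - 1 := x))) / q = F w * G w" for w
      unfolding FN G_def by (simp flip: sum_distrib_left)
    then show ?thesis
      using avg_resample[of "N - 1" N q "\<lambda>w. F w * g w"] N by simp
  qed
  moreover have "avg q N (\<lambda>w. l * F w + l * G w - l\<^sup>2) \<le> avg q N (\<lambda>w. F w * G w)"
  proof (rule avg_mono)
    fix w
    have "0 \<le> (l - F w) * (l - G w)" using F1 G1 by simp
    then show "l * F w + l * G w - l\<^sup>2 \<le> F w * G w" by (simp add: algebra_simps power2_eq_square)
  qed
  ultimately show ?thesis
    using q unfolding l_def[symmetric] by (simp add: avg_add avg_diff avg_cmult avg_const)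
qed

context three_lengths
begin

text \<open>B is chosen among the words whose end letters have a cyclic sum below h.
  \<open>avg_balanced\<close> is used twice: at length a + k it shows that words beginning and
  ending in B have density at least \<open>\<beta> - 1/4\<close>, so that they can carry A, and at
  length a + k + k' it bounds the remainder.\<close>

lemma splittable_balanced:
  assumes k'a: "k' < a" and h: "2 * h \<le> q" and n: "real n / q ^ a = \<beta>"
    and \<beta>: "\<beta> \<le> h / q" and \<delta>: "0 \<le> \<delta>" "\<delta> \<le> \<beta> - 1 / 4"
  shows "splittable q a k k' \<beta> \<delta>"
proof -
  define l where "l = real h / q"
  have l: "0 \<le> l" "l \<le> 1 / 2" using h q0 by (auto simp: l_def field_simps)
  have h': "h \<le> q" using h by simp
  have a2: "a - 1 \<noteq> 0" using k'a k' by simp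
  define H where "H w = cyc q h (w 0) (w (a - 1))" for w
  have H: "event a H"
    by (rule eventI, rule depI) (use a in \<open>auto simp: H_def cyc_def\<close>)
  have avgH: "avg q a H = l"
  proof -
    have "avg q a H = avg q a (\<lambda>w. (\<Sum>x<q. H (w(0 := x))) / q)"
      by (rule avg_resample) (rule a)
    also have "\<dots> = avg q a (\<lambda>w. l)"
      using a2 lmean_cyc(1)[OF h' q0] q0 by (simp add: H_def l_def lmean_def)
    finally show ?thesis using q0 by (simp add: avg_const)
  qed
  have "event a (\<lambda>w. 0)" by (rule eventI) (auto intro: dep_const)
  then obtain B where B: "event a B" "\<And>w. B w \<le> H w" "avg q a B = \<beta>"
    using event_between[of a "\<lambda>w. 0" H q n] H q0 avgH \<beta> n event_ge0[OF H]
    by (auto simp: avg_const l_def)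
  note dB = event_dep[OF B(1)]
  define V where "V w = B w * B (shift k w)" for w
  have V01: "V w = 0 \<or> V w = 1" for w
    unfolding V_def using event_01[OF B(1), of w] event_01[OF B(1), of "shift k w"] by auto
  have dV: "dep {..<a + k} V"
    unfolding V_def by (intro dep_mult dep_event_word dep_event_shift B(1)) simp
  \<comment> \<open>The right side is what \<open>avg_balanced\<close> gives for two means equal to
    x. The difference of the two sides is (1 - 2l)(1/4 + l/2 - x); both factors are nonnegative by l
    <= 1/2 and x <= l.\<close>
  have bound: "x - 1 / 4 \<le> 2 * (l * x) - l\<^sup>2" if "x \<le> l" for x
  proof -
    have "0 \<le> (1 - 2 * l) * (1 / 4 + l / 2 - x)"
      using l that by (intro mult_nonneg_nonneg) auto
    then show ?thesis by (simp add: algebra_simps power2_eq_square)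
  qed
  define \<rho> where "\<rho> = E V"
  have \<rho>: "\<beta> - 1 / 4 \<le> \<rho>"
  proof -
    have "l * avg q (a + k) B + l * avg q (a + k) (\<lambda>w. B (shift k w)) - l\<^sup>2 \<le> avg q (a + k) (\<lambda>w. B w * B (shift k w))"
      unfolding l_def
    proof (rule avg_balanced[OF q0 h', where u = "a - 1" and v = k])
      show "B (shift k w) \<le> cyc q h (w k) (w (a + k - 1))" for w
        using B(2)[of "shift k w"] a by (simp add: H_def shift_def add.commute)
      show "B (w(a + k - 1 := x)) = B w" for w x
        by (rule dep_upd[OF dB]) (use k in auto)
    qed (use a k a2 B(2) in \<open>auto simp: H_def shift_upd\<close>)
    moreover have "avg q (a + k) B = \<beta>"
      using avg_extend[OF dB _ q0, of "a + k"] B(3) by simp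
    moreover have "avg q (a + k) (\<lambda>w. B (shift k w)) = \<beta>"
      using avg_shift[OF dB _ q0, of k "a + k"] B(3) by simp
    moreover have "avg q (a + k) V = avg q (a + k) (\<lambda>w. B w * B (shift k w))"
      by (rule avg_cong) (rule V_def)
    ultimately have "2 * (l * \<beta>) - l\<^sup>2 \<le> avg q (a + k) V"
      by (simp add: mult.commute)
    then show ?thesis using bound[of \<beta>] \<beta> avg_extend[OF dV, of "a + k + k'" q] q0 by (simp add: l_def \<rho>_def)
  qed
  \<comment> \<open>If \<open>\<rho> = 0\<close>, then \<open>\<beta> - 1/4 \<le> 0\<close>, which
    forces \<open>\<delta> = 0\<close>.\<close>
  define t where "t = (if \<rho> = 0 then 0 else \<delta> / \<rho>)"
  have t: "0 \<le> t" "t \<le> 1" "t * \<rho> = \<delta>"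
    using \<delta> \<rho> by (auto simp: t_def)
  have tV: "0 \<le> t * V w" "t * V w \<le> V w" for w using t V01[of w] by auto
  define \<alpha> where "\<alpha> = (\<lambda>w. t * V w)"
  have d\<alpha>: "dep {..<a + k} \<alpha>" unfolding \<alpha>_def by (intro dep_mult dep_const dV)
  have E\<alpha>: "E \<alpha> = \<delta>" using t by (simp add: \<alpha>_def avg_lin \<rho>_def)
  have \<alpha>0: "0 \<le> \<alpha> w" for w using tV by (simp add: \<alpha>_def)
  show ?thesis
  proof (rule splittableI[OF B(1,3) d\<alpha>])
    show "0 \<le> \<alpha> w" for w by (rule \<alpha>0)
    show "\<alpha> w \<le> B w * B (shift k w)" for w using tV by (simp add: V_def \<alpha>_def)
    show "E \<alpha> = \<delta>" by (rule E\<alpha>)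
    let ?f = "\<lambda>w. B w - \<alpha> w" and ?g = "\<lambda>w. B (shift (k + k') w) - \<alpha> (shift k' w)"
    have "l * E ?f + l * E ?g - l\<^sup>2 \<le> E (\<lambda>w. ?f w * ?g w)"
      unfolding l_def
    proof (rule avg_balanced[OF q0 h', where u = "a - 1" and v = "k + k'"])
      show "?f w \<le> cyc q h (w 0) (w (a - 1))" for w
        using B(2)[of w] \<alpha>0[of w] by (simp add: H_def)
      show "?g w \<le> cyc q h (w (k + k')) (w (a + k + k' - 1))" for w
        using B(2)[of "shift (k + k') w"] \<alpha>0[of "shift k' w"] a by (simp add: H_def shift_def algebra_simps)
      show "?f (w(a + k + k' - 1 := x)) = ?f w" for w x
        using dep_upd[OF dB, of "a + k + k' - 1" w x] dep_upd[OF d\<alpha>, of "a + k + k' - 1" w x] k k' by auto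
      show "?g (w(0 := x)) = ?g w" for w x
        using k k' by (simp add: shift_upd)
    qed (use a k k' a2 in auto)
    moreover have "E ?f = \<beta> - \<delta>"
      using E_word[OF dB] B(3) E\<alpha> by (simp add: avg_diff)
    moreover have "E ?g = \<beta> - \<delta>"
      using E_window[OF dB, of "k + k'"] B(3) E\<alpha> E_shift_word[OF d\<alpha>] by (simp add: avg_diff)
    ultimately show "\<beta> - \<delta> - 1 / 4 \<le> E (\<lambda>w. ?f w * ?g w)"
      using bound[of "\<beta> - \<delta>"] \<beta> \<delta> by (simp add: l_def)
  qed
qed

section \<open>Constructions in two stages\<close>

text \<open>The remaining density is quadratic in s with second-order term E of
  \<open>D w * D (shift k' w)\<close>. It therefore equals the chord between its values at s = 0
  (bounded by \<open>\<phi>\<close>) and s = 1 (bounded by \<open>\<chi>\<close>) minus s(1 - s)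
  times that term.\<close>

lemma splittable_two_stage:
  assumes B: "event a B" and C: "\<And>w. lo g (w 0) \<le> B w" and g: "g \<le> q" and \<beta>: "avg q a B = \<beta>"
    and D: "dep {..<a + k} D" "\<And>w. 0 \<le> D w" "\<And>w. lo g (w 0) * B (shift k w) + D w \<le> B w * B (shift k w)"
    and s: "0 \<le> s" "s \<le> 1" "\<delta> = g / q * \<beta> + s * E D"
    and \<phi>: "\<phi> \<le> E (\<lambda>w. (B w - lo g (w 0) * B (shift k w)) *
        (B (shift (k + k') w) - lo g (w k') * B (shift (k + k') w)))"
    and \<chi>: "\<chi> \<le> E (\<lambda>w. (B w - lo g (w 0) * B (shift k w) - D w) *
        (B (shift (k + k') w) - lo g (w k') * B (shift (k + k') w) - D (shift k' w)))"
    and \<kappa>: "E (\<lambda>w. D w * D (shift k' w)) \<le> \<kappa>"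
    and num: "\<beta> - \<delta> - 1 / 4 \<le> (1 - s) * \<phi> + s * \<chi> - s * (1 - s) * \<kappa>"
  shows "splittable q a k k' \<beta> \<delta>"
proof -
  define \<alpha> where "\<alpha> = (\<lambda>w. lo g (w 0) * B (shift k w) + s * D w)"
  have sD: "0 \<le> s * D w" "s * D w \<le> D w" for w
    using s D(2)[of w] mult_right_mono[of s 1 "D w"] by auto
  show ?thesis
  proof (rule splittableI[OF B \<beta>])
    show "dep {..<a + k} \<alpha>"
      unfolding \<alpha>_def using a by (intro dep_add dep_mult dep_const dep_lo dep_event_shift B D) auto
    show "0 \<le> \<alpha> w" for w
      using sD[of w] event_ge0[OF B, of "shift k w"] by (simp add: \<alpha>_def lo_def)
    show "\<alpha> w \<le> B w * B (shift k w)" for w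
      using sD[of w] D(3)[of w] by (simp add: \<alpha>_def)
    have "E (\<lambda>w. lo g (w 0) * B (shift k w)) = g / q * \<beta>"
      using E_letter_window[OF event_dep[OF B], of 0 k "lo g"] k g \<beta> by (simp add: lmean_lo)
    then show "E \<alpha> = \<delta>" unfolding \<alpha>_def using s(3) by (simp add: avg_lin)
    have "E (\<lambda>w. (B w - \<alpha> w) * (B (shift (k + k') w) - \<alpha> (shift k' w)))
      = E (\<lambda>w. (1 - s) * ((B w - lo g (w 0) * B (shift k w)) *
            (B (shift (k + k') w) - lo g (w k') * B (shift (k + k') w)))
          + s * ((B w - lo g (w 0) * B (shift k w) - D w) *
        (B (shift (k + k') w) - lo g (w k') * B (shift (k + k') w) - D (shift k' w)))
          - s * (1 - s) * (D w * D (shift k' w)))"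
    proof (rule avg_cong)
      fix w
      have e: "\<alpha> (shift k' w) = lo g (w k') * B (shift (k + k') w) + s * D (shift k' w)"
        by (simp add: \<alpha>_def shift_shift add.commute[of k' k]) (simp add: shift_def)
      have "(x - s * d) * (y - s * e) = (1 - s) * (x * y) + s * ((x - d) * (y - e)) - s * (1 - s) * (d * e)"
        for x y d e :: real by (simp add: algebra_simps)
      from this[of "B w - lo g (w 0) * B (shift k w)" "D w"
          "B (shift (k + k') w) - lo g (w k') * B (shift (k + k') w)" "D (shift k' w)"]
      show "(B w - \<alpha> w) * (B (shift (k + k') w) - \<alpha> (shift k' w)) =
          (1 - s) * ((B w - lo g (w 0) * B (shift k w)) *
            (B (shift (k + k') w) - lo g (w k') * B (shift (k + k') w)))
          + s * ((B w - lo g (w 0) * B (shift k w) - D w) *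
        (B (shift (k + k') w) - lo g (w k') * B (shift (k + k') w) - D (shift k' w)))
          - s * (1 - s) * (D w * D (shift k' w))"
        unfolding e by (simp add: \<alpha>_def diff_diff_eq)
    qed
    also have "\<dots> = (1 - s) * E (\<lambda>w. (B w - lo g (w 0) * B (shift k w)) *
            (B (shift (k + k') w) - lo g (w k') * B (shift (k + k') w)))
          + s * E (\<lambda>w. (B w - lo g (w 0) * B (shift k w) - D w) *
        (B (shift (k + k') w) - lo g (w k') * B (shift (k + k') w) - D (shift k' w)))
          - s * (1 - s) * E (\<lambda>w. D w * D (shift k' w))"
      unfolding avg_diff avg_add avg_cmult ..
    also have "\<dots> \<ge> (1 - s) * \<phi> + s * \<chi> - s * (1 - s) * \<kappa>"
      using s by (intro diff_mono add_mono mult_left_mono \<phi> \<chi> \<kappa>) auto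
    finally show "\<beta> - \<delta> - 1 / 4 \<le> E (\<lambda>w. (B w - \<alpha> w) * (B (shift (k + k') w) - \<alpha> (shift k' w)))"
      using num by linarith
  qed
qed

lemma remainder_nonneg:
  assumes B: "event a B"
    and D: "\<And>w. lo g (w 0) * B (shift k w) + D w \<le> B w * B (shift k w)"
  shows "0 \<le> B w - lo g (w 0) * B (shift k w) - D w"
    and "0 \<le> B (shift (k + k') w) - lo g (w k') * B (shift (k + k') w) - D (shift k' w)"
proof -
  have *: "B u * B v \<le> B u" "B u * B v \<le> B v" for u v
    using event_01[OF B, of u] event_01[OF B, of v] by auto
  show "0 \<le> B w - lo g (w 0) * B (shift k w) - D w"
    using D[of w] *(1)[of w "shift k w"] by linarith
  have "lo g (w k') * B (shift (k + k') w) + D (shift k' w) \<le> B (shift k' w) * B (shift (k + k') w)"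
    using D[of "shift k' w"] by (simp add: shift_shift add.commute[of k' k]) (simp add: shift_def)
  then show "0 \<le> B (shift (k + k') w) - lo g (w k') * B (shift (k + k') w) - D (shift k' w)"
    using *(2)[of "shift k' w" "shift (k + k') w"] by linarith
qed

text \<open>In the second stage of the constructions below \<^term>\<open>D\<close> is carried by words whose first letter is
  at least \<^term>\<open>g\<close>, and the first letter of a word of length \<^term>\<open>a + k + k'\<close> is not seen by its suffix.\<close>

lemma splittable_high:
  assumes B: "event a B" and C: "\<And>w. lo g (w 0) \<le> B w" and g: "g \<le> q" and \<beta>: "avg q a B = \<beta>"
    and D: "dep {..<a + k} D" "\<And>w. 0 \<le> D w" "\<And>w. lo g (w 0) * B (shift k w) + D w \<le> B w * B (shift k w)"
    and D': "\<And>w. D w \<le> 1 - lo g (w 0)"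
    and s: "0 \<le> s" "s \<le> 1" "\<delta> = g / q * \<beta> + s * E D"
    and \<phi>: "\<phi> \<le> E (\<lambda>w. (B w - lo g (w 0) * B (shift k w)) *
        (B (shift (k + k') w) - lo g (w k') * B (shift (k + k') w)))"
    and num: "\<beta> - \<delta> - 1 / 4 \<le> (1 - s) * \<phi> - s * (1 - s) * ((1 - g / q) * E D)"
  shows "splittable q a k k' \<beta> \<delta>"
proof (rule splittable_two_stage[OF B C g \<beta> D s \<phi>])
  show "0 \<le> E (\<lambda>w. (B w - lo g (w 0) * B (shift k w) - D w) *
        (B (shift (k + k') w) - lo g (w k') * B (shift (k + k') w) - D (shift k' w)))"
    by (intro avg_nonneg mult_nonneg_nonneg remainder_nonneg[OF B D(3)])
  have "E (\<lambda>w. D w * D (shift k' w)) \<le> E (\<lambda>w. (1 - lo g (w 0)) * D (shift k' w))"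
    by (intro avg_mono mult_right_mono D' D(2))
  also have "\<dots> = (1 - g / q) * E D"
    using avg_letter[of 0 "a + k + k'" "\<lambda>w. D (shift k' w)" q "\<lambda>x. 1 - lo g x"] a k' g q0 E_shift_word[OF D(1)]
    by (simp add: shift_upd lmean_hi1)
  finally show "E (\<lambda>w. D w * D (shift k' w)) \<le> (1 - g / q) * E D" .
qed (use num in simp)

text \<open>After the first stage a long word with letters at least g at 0 and k' has lost neither
  end to A. As B contains every word with such a letter at k', its prefix is in B automatically, so
  only membership of the last window remains: density \<open>(1 - g/q)^2 * \<beta>\<close>. The
  density M available to the second stage is known only from below, hence the quantified
  assumption.\<close>

lemma splittable_full:
  assumes B: "event a B" and g: "g \<le> q" and \<beta>: "avg q a B = \<beta>" and k'a: "k' < a"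
    and full: "\<And>w. w 0 < g \<or> g \<le> w k' \<Longrightarrow> B w = 1"
    and M: "\<And>M. (1 - g / q) * \<beta> - (1 - \<beta>) \<le> M \<Longrightarrow> \<exists>s. 0 \<le> s \<and> s \<le> 1 \<and> \<delta> = g / q * \<beta> + s * M \<and>
      \<beta> - \<delta> - 1 / 4 \<le> (1 - s) * ((1 - g / q)\<^sup>2 * \<beta>) - s * (1 - s) * ((1 - g / q) * M)"
  shows "splittable q a k k' \<beta> \<delta>"
proof -
  note dB = event_dep[OF B]
  note B01 = event_01[OF B]
  have C: "lo g (w 0) \<le> B w" for w
    using full[of w] event_ge0[OF B, of w] by (auto simp: lo_def)
  define D where "D = (\<lambda>w. (B w - lo g (w 0)) * B (shift k w))"
  have "(1 - g / q) * \<beta> - (1 - \<beta>) \<le> E D"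
  proof -
    have "E (\<lambda>w. (1 - lo g (w 0)) * B (shift k w) - (1 - B w)) \<le> E D"
    proof (rule avg_mono)
      fix w
      show "(1 - lo g (w 0)) * B (shift k w) - (1 - B w) \<le> D w"
        using B01[of w] B01[of "shift k w"] full[of w] by (auto simp: D_def lo_def)
    qed
    moreover have "E (\<lambda>w. (1 - lo g (w 0)) * B (shift k w)) = (1 - g / q) * \<beta>"
      using E_letter_window[OF dB, of 0 k "\<lambda>x. 1 - lo g x"] k g q0 \<beta> by (simp add: lmean_hi1)
    ultimately show ?thesis
      using E_word[OF dB] \<beta> q0 by (simp add: avg_diff avg_const)
  qed
  then obtain s where s: "0 \<le> s" "s \<le> 1" "\<delta> = g / q * \<beta> + s * E D"
    and num: "\<beta> - \<delta> - 1 / 4 \<le> (1 - s) * ((1 - g / q)\<^sup>2 * \<beta>) - s * (1 - s) * ((1 - g / q) * E D)"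
    using M[of "E D"] by blast
  show ?thesis
  proof (rule splittable_high[OF B C g \<beta> _ _ _ _ s _ num])
    show "dep {..<a + k} D"
      unfolding D_def using a by (intro dep_mult dep_diff dep_lo dep_event_word dep_event_shift B) auto
    fix w
    show "0 \<le> D w" "lo g (w 0) * B (shift k w) + D w \<le> B w * B (shift k w)" "D w \<le> 1 - lo g (w 0)"
      using C[of w] B01[of w] B01[of "shift k w"] lo_01[of g "w 0"] by (auto simp: D_def)
  next
    have "E (\<lambda>w. (1 - lo g (w 0)) * ((1 - lo g (w k')) * B (shift (k + k') w)))
      = (1 - g / q) * E (\<lambda>w. (1 - lo g (w k')) * B (shift (k + k') w))"
      using avg_letter[of 0 "a + k + k'" "\<lambda>w. (1 - lo g (w k')) * B (shift (k + k') w)" q "\<lambda>x. 1 - lo g x"] a k' g q0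
      by (simp add: shift_upd lmean_hi1)
    also have "\<dots> = (1 - g / q)\<^sup>2 * \<beta>"
      using E_letter_window[OF dB, of k' "k + k'" "\<lambda>x. 1 - lo g x"] k g q0 \<beta>
      by (simp add: lmean_hi1 power2_eq_square)
    finally have "(1 - g / q)\<^sup>2 * \<beta> = E (\<lambda>w. (1 - lo g (w 0)) * ((1 - lo g (w k')) * B (shift (k + k') w)))" ..
    also have "\<dots> \<le> E (\<lambda>w. (B w - lo g (w 0) * B (shift k w)) *
        (B (shift (k + k') w) - lo g (w k') * B (shift (k + k') w)))"
    proof (rule avg_mono)
      fix w
      show "(1 - lo g (w 0)) * ((1 - lo g (w k')) * B (shift (k + k') w))
        \<le> (B w - lo g (w 0) * B (shift k w)) * (B (shift (k + k') w) - lo g (w k') * B (shift (k + k') w))"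
        using B01[of w] B01[of "shift k w"] B01[of "shift (k + k') w"] full[of w]
        by (auto simp: lo_def)
    qed
    finally show "(1 - g / q)\<^sup>2 * \<beta> \<le> E (\<lambda>w. (B w - lo g (w 0) * B (shift k w)) *
        (B (shift (k + k') w) - lo g (w k') * B (shift (k + k') w)))" .
  qed
qed

text \<open>Call a letter low if it is below g. A word of B with high first letter is now high at
  k'. Two disjoint families survive the first stage: words starting in B with a high first letter
  and low at k + k', and words that are low, high, high, low at 0, k, k', k + k'. In the second
  family the window at k starts high and is low at its letter k', hence it is not in B. The density
  of that family uses four distinct positions, so k must differ from k'.\<close>

lemma splittable_sparse:
  assumes B: "event a B" and C: "\<And>w. lo g (w 0) \<le> B w" and g: "g \<le> q" and \<beta>: "avg q a B = \<beta>"
    and k'a: "k' < a" and kk': "k \<noteq> k'"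
    and sparse: "\<And>w. B w = 1 \<Longrightarrow> \<not> w 0 < g \<Longrightarrow> \<not> w k' < g"
    and e: "g / q * (\<beta> - g / q) \<le> E (\<lambda>w. (B w - lo g (w 0)) * lo g (w (k + k')))"
    and \<mu>: "E (\<lambda>w. (B w - lo g (w 0)) * lo g (w k)) = \<mu>"
    and s: "0 \<le> s" "s \<le> 1" "\<delta> = g / q * \<beta> + s * \<mu>"
    and num: "\<beta> - \<delta> - 1 / 4 \<le> (1 - s) * (g / q * (\<beta> - g / q) + (g / q)\<^sup>2 * (1 - g / q)\<^sup>2)
      - s * (1 - s) * ((1 - g / q) * \<mu>)"
  shows "splittable q a k k' \<beta> \<delta>"
proof -
  note dB = event_dep[OF B]
  note B01 = event_01[OF B]
  define D where "D = (\<lambda>w. (B w - lo g (w 0)) * lo g (w k))"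
  have ED: "E D = \<mu>" using \<mu> by (simp add: D_def)
  show ?thesis
  proof (rule splittable_high[OF B C g \<beta> _ _ _ _ s(1,2) _ _ num[folded ED]])
    show "dep {..<a + k} D"
      unfolding D_def using a by (intro dep_mult dep_diff dep_lo dep_event_word dep_event_shift B) auto
    fix w
    show "0 \<le> D w" "D w \<le> 1 - lo g (w 0)"
      using C[of w] B01[of w] lo_01[of g "w 0"] lo_01[of g "w k"] by (auto simp: D_def)
    have "lo g (w k) \<le> B (shift k w)" using C[of "shift k w"] by (simp add: shift_def)
    then show "lo g (w 0) * B (shift k w) + D w \<le> B w * B (shift k w)"
      using C[of w] B01[of w] B01[of "shift k w"] lo_01[of g "w 0"] lo_01[of g "w k"] by (auto simp: D_def)
  next
    show "\<delta> = g / q * \<beta> + s * E D" using s(3) ED by simp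
    have "E (\<lambda>w. lo g (w 0) * ((1 - lo g (w k)) * ((1 - lo g (w k')) * lo g (w (k + k')))))
      = g / q * E (\<lambda>w. (1 - lo g (w k)) * ((1 - lo g (w k')) * lo g (w (k + k'))))"
      using avg_letter[of 0 "a + k + k'" "\<lambda>w. (1 - lo g (w k)) * ((1 - lo g (w k')) * lo g (w (k + k')))" q "lo g"]
        a k k' g q0 by (simp add: lmean_lo)
    also have "E (\<lambda>w. (1 - lo g (w k)) * ((1 - lo g (w k')) * lo g (w (k + k'))))
      = (1 - g / q) * E (\<lambda>w. (1 - lo g (w k')) * lo g (w (k + k')))"
      using avg_letter[of k "a + k + k'" "\<lambda>w. (1 - lo g (w k')) * lo g (w (k + k'))" q "\<lambda>x. 1 - lo g x"]
        a k k' kk' g q0 by (simp add: lmean_hi1)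
    also have "E (\<lambda>w. (1 - lo g (w k')) * lo g (w (k + k'))) = (1 - g / q) * E (\<lambda>w. lo g (w (k + k')))"
      using avg_letter[of k' "a + k + k'" "\<lambda>w. lo g (w (k + k'))" q "\<lambda>x. 1 - lo g x"]
        a k k' kk' g q0 by (simp add: lmean_hi1)
    also have "E (\<lambda>w. lo g (w (k + k'))) = g / q"
      using E_letter[of "k + k'" "lo g"] a g by (simp add: lmean_lo)
    finally have "E (\<lambda>w. lo g (w 0) * ((1 - lo g (w k)) * ((1 - lo g (w k')) * lo g (w (k + k')))))
      = (g / q)\<^sup>2 * (1 - g / q)\<^sup>2" by (simp add: power2_eq_square)
    then have "g / q * (\<beta> - g / q) + (g / q)\<^sup>2 * (1 - g / q)\<^sup>2 \<le>
      E (\<lambda>w. (B w - lo g (w 0)) * lo g (w (k + k')) +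
        lo g (w 0) * ((1 - lo g (w k)) * ((1 - lo g (w k')) * lo g (w (k + k')))))"
      using e by (simp add: avg_add)
    also have "\<dots> \<le> E (\<lambda>w. (B w - lo g (w 0) * B (shift k w)) *
        (B (shift (k + k') w) - lo g (w k') * B (shift (k + k') w)))"
    proof (rule avg_mono)
      fix w
      have "lo g (w (k + k')) \<le> B (shift (k + k') w)" "lo g (w k) \<le> B (shift k w)"
        using C[of "shift (k + k') w"] C[of "shift k w"] by (auto simp: shift_def)
      then show "(B w - lo g (w 0)) * lo g (w (k + k')) +
        lo g (w 0) * ((1 - lo g (w k)) * ((1 - lo g (w k')) * lo g (w (k + k'))))
        \<le> (B w - lo g (w 0) * B (shift k w)) * (B (shift (k + k') w) - lo g (w k') * B (shift (k + k') w))"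
        using B01[of w] B01[of "shift k w"] B01[of "shift (k + k') w"] C[of w]
          sparse[of w] sparse[of "shift k w"]
        by (auto simp: lo_def shift_def)
    qed
    finally show "g / q * (\<beta> - g / q) + (g / q)\<^sup>2 * (1 - g / q)\<^sup>2 \<le>
      E (\<lambda>w. (B w - lo g (w 0) * B (shift k w)) *
        (B (shift (k + k') w) - lo g (w k') * B (shift (k + k') w)))" .
  qed
qed

text \<open>A word of B with high first letter is low at k, so each of its extensions by k letters
  ends in B. All these extensions enter A with full weight, and those with a low first letter with
  weight s. What is left of the prefix condition is a low first letter, up to the weight s on the
  window at k.\<close>

lemma splittable_equal_steps:
  assumes B: "event a B" and C: "\<And>w. lo g (w 0) \<le> B w" and g: "0 < g" "g \<le> q" and \<beta>: "avg q a B = \<beta>"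
    and kk': "k = k'"
    and T: "\<And>w. B w = 1 \<Longrightarrow> \<not> w 0 < g \<Longrightarrow> w k < g"
    and \<delta>: "\<beta> - g / q \<le> \<delta>" "\<delta> \<le> \<beta> - 1 / 4"
  shows "splittable q a k k' \<beta> \<delta>"
proof -
  note dB = event_dep[OF B]
  note B01 = event_01[OF B]
  define b where "b = real g / q"
  have b: "0 < b" "b \<le> 1" "b \<le> \<beta>" "\<beta> \<le> 1"
    using g q0 avg_lo_le[where B = B, OF C g(2)] avg_event_bounds[OF B] \<beta> by (auto simp: b_def)
  define s where "s = (\<delta> - (\<beta> - b)) / (b * \<beta>)"
  have "b - 1 / 4 \<le> b * b" using square_bound[of b] by (simp add: power2_eq_square)
  also have "b * b \<le> b * \<beta>" using b by (intro mult_left_mono) auto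
  finally have "\<delta> - (\<beta> - b) \<le> b * \<beta>" using \<delta> by simp
  then have s: "0 \<le> s" "s \<le> 1" "s * (b * \<beta>) = \<delta> - (\<beta> - b)"
    using \<delta> b by (auto simp: s_def b_def[symmetric] divide_le_eq)
  define \<alpha> where "\<alpha> = (\<lambda>w. (B w - lo g (w 0)) + s * (lo g (w 0) * B (shift k w)))"
  have Ck: "lo g (w k) \<le> B (shift k w)" for w using C[of "shift k w"] by (simp add: shift_def)
  have Elo: "E (\<lambda>w. lo g (w p)) = b" if "p \<le> k" for p
    using E_letter[of p "lo g"] a g that by (simp add: lmean_lo b_def)
  show ?thesis
  proof (rule splittableI[OF B \<beta>])
    show "dep {..<a + k} \<alpha>"
      unfolding \<alpha>_def using a
      by (intro dep_add dep_mult dep_diff dep_const dep_lo dep_event_shift dep_event_word B) auto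
    fix w
    show "0 \<le> \<alpha> w"
      using s C[of w] event_ge0[OF B, of "shift k w"] by (simp add: \<alpha>_def lo_def)
    show "\<alpha> w \<le> B w * B (shift k w)"
      using s C[of w] B01[of w] B01[of "shift k w"] T[of w] Ck[of w]
      by (auto simp: \<alpha>_def lo_def split: if_splits)
  next
    have "E (\<lambda>w. lo g (w 0) * B (shift k w)) = b * \<beta>"
      using E_letter_window[OF dB, of 0 k "lo g"] k g \<beta> by (simp add: lmean_lo b_def)
    then show "E \<alpha> = \<delta>"
      unfolding \<alpha>_def using s Elo[of 0] E_word[OF dB] \<beta> by (simp add: avg_lin)
    have "E (\<lambda>w. (B w - \<alpha> w) * (B (shift (k + k') w) - \<alpha> (shift k' w)))
      = E (\<lambda>w. lo g (w 0) * (B (shift (k + k') w) - (B (shift k w) - lo g (w k))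
          - (2 * s - s\<^sup>2) * (lo g (w k) * B (shift (k + k') w))))"
    proof (rule avg_cong)
      fix w
      have e: "\<alpha> (shift k' w) = (B (shift k w) - lo g (w k)) + s * (lo g (w k) * B (shift (k + k') w))"
        using kk' by (simp add: \<alpha>_def shift_shift) (simp add: shift_def)
      have "lo g (w (k + k)) \<le> B (shift (k + k') w)"
        using C[of "shift (k + k') w"] kk' by (simp add: shift_def)
      \<comment> \<open>If the window at k is in B with a high first letter, \<open>T\<close> makes
        the letter 2k low, so the last window is in B and the second factor vanishes. Otherwise the
        window at k is in B exactly if its first letter is low.\<close>
      then show "(B w - \<alpha> w) * (B (shift (k + k') w) - \<alpha> (shift k' w))
        = lo g (w 0) * (B (shift (k + k') w) - (B (shift k w) - lo g (w k))
          - (2 * s - s\<^sup>2) * (lo g (w k) * B (shift (k + k') w)))"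
        unfolding e
        using B01[of "shift k w"] B01[of "shift (k + k') w"] Ck[of w] T[of "shift k w"]
        by (auto simp: \<alpha>_def lo_def shift_def power2_eq_square algebra_simps)
    qed
    also have "\<dots> = b * E (\<lambda>w. B (shift (k + k') w) - (B (shift k w) - lo g (w k))
          - (2 * s - s\<^sup>2) * (lo g (w k) * B (shift (k + k') w)))"
      by (subst avg_letter) (use a k g in \<open>auto simp: shift_upd lmean_lo b_def\<close>)
    also have "E (\<lambda>w. B (shift (k + k') w) - (B (shift k w) - lo g (w k))
          - (2 * s - s\<^sup>2) * (lo g (w k) * B (shift (k + k') w)))
      = E (\<lambda>w. B (shift (k + k') w)) - (E (\<lambda>w. B (shift k w)) - E (\<lambda>w. lo g (w k)))
          - (2 * s - s\<^sup>2) * E (\<lambda>w. lo g (w k) * B (shift (k + k') w))"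
      unfolding avg_diff avg_cmult ..
    also have "\<dots> = b - (2 * s - s\<^sup>2) * (b * \<beta>)"
      using E_window[OF dB, of "k + k'"] E_window[OF dB, of k] \<beta> Elo[of k]
        E_letter_window[OF dB, of k "k + k'" "lo g"] k' g by (simp add: lmean_lo b_def)
    also have "b * (b - (2 * s - s\<^sup>2) * (b * \<beta>)) = b\<^sup>2 * (1 - 2 * s * \<beta> + s\<^sup>2 * \<beta>)"
      by (simp add: power2_eq_square algebra_simps)
    also have "\<dots> \<ge> b\<^sup>2 * (1 - 2 * s * \<beta> + s\<^sup>2 * \<beta>\<^sup>2)"
    proof -
      have "\<beta>\<^sup>2 \<le> \<beta>" using b by (simp add: power2_eq_square mult_left_le)
      then show ?thesis by (intro mult_left_mono add_left_mono) auto
    qed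
    also have "b\<^sup>2 * (1 - 2 * s * \<beta> + s\<^sup>2 * \<beta>\<^sup>2) = (\<beta> - \<delta>)\<^sup>2"
    proof -
      have "\<beta> - \<delta> = b * (1 - s * \<beta>)" using s(3) by (simp add: algebra_simps)
      then show ?thesis by (simp only: power2_eq_square) (simp add: algebra_simps)
    qed
    finally show "\<beta> - \<delta> - 1 / 4 \<le> E (\<lambda>w. (B w - \<alpha> w) * (B (shift (k + k') w) - \<alpha> (shift k' w)))"
      using square_bound[of "\<beta> - \<delta>"] by linarith
  qed
qed

end

text \<open>Only the letter p is translated. Summed over x, the rotated letter runs through the
  whole alphabet whatever \<open>w p\<close> is, so f becomes independent of the condition on that
  letter; some x reaches the average.\<close>

lemma ex_rotation:
  assumes f: "dep {..<a} f" and p: "p < a" and g: "g \<le> q" and q: "0 < q"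
  shows "\<exists>x. g / q * avg q a f \<le> avg q a (\<lambda>w. f (translate q (- {p}) (\<lambda>_. x) w) * lo g (w p))"
proof (rule ccontr)
  define R where "R x w = translate q (- {p}) (\<lambda>_. x) w" for x :: nat and w :: "nat \<Rightarrow> nat"
  assume "\<not> ?thesis"
  then have less: "avg q a (\<lambda>w. f (R x w) * lo g (w p)) < g / q * avg q a f" for x
    by (simp add: not_le R_def)
  have "{..<q} \<noteq> {}" using q by auto
  then have "(\<Sum>x<q. avg q a (\<lambda>w. f (R x w) * lo g (w p))) < (\<Sum>x<q. g / q * avg q a f)"
    by (intro sum_strict_mono less) auto
  moreover have "(\<Sum>x<q. avg q a (\<lambda>w. f (R x w) * lo g (w p))) = q * (g / q * avg q a f)"
  proof -
    define F where "F w = (\<Sum>x<q. f (w(p := x))) / q" for w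
    have sumF: "(\<Sum>x<q. f (R x w)) = q * F w" if "w \<in> words q a" for w
    proof -
      have "R x w = w(p := (x + w p) mod q)" for x
        by (auto simp: R_def translate_def add.commute)
      then have "(\<Sum>x<q. f (R x w)) = (\<Sum>x<q. f (w(p := (x + w p) mod q)))" by simp
      also have "\<dots> = (\<Sum>y<q. f (w(p := y)))"
      proof -
        have inj: "inj_on (\<lambda>x. (x + w p) mod q) {..<q}"
          by (rule inj_onI) (auto intro: mod_add_cancel)
        then have "(\<lambda>x. (x + w p) mod q) ` {..<q} = {..<q}"
          using q by (intro endo_inj_surj) auto
        then show ?thesis using sum.reindex[OF inj, of "\<lambda>y. f (w(p := y))"] by simp
      qed
      finally show ?thesis using q by (simp add: F_def)
    qed
    have "(\<Sum>x<q. avg q a (\<lambda>w. f (R x w) * lo g (w p))) = avg q a (\<lambda>w. (\<Sum>x<q. f (R x w)) * lo g (w p))"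
      unfolding avg_def sum_distrib_right sum_divide_distrib[symmetric] by (subst sum.swap) simp
    also have "\<dots> = avg q a (\<lambda>w. q * (lo g (w p) * F w))"
      by (rule avg_cong) (simp add: sumF)
    also have "\<dots> = q * (g / q * avg q a F)"
      unfolding avg_cmult by (subst avg_letter) (use p g in \<open>auto simp: F_def lmean_lo\<close>)
    also have "avg q a F = avg q a f"
      unfolding F_def by (rule avg_resample[symmetric]) (rule p)
    finally show ?thesis .
  qed
  ultimately show False by simp
qed

context three_lengths
begin

lemma ex_sparse:
  assumes k'a: "k' < a" and kk': "k \<noteq> k'" and g: "g \<le> q" and n: "real n / q ^ a = \<beta>"
    and \<beta>: "g / q \<le> \<beta>" "\<beta> \<le> g / q + (1 - g / q)\<^sup>2"
  shows "\<exists>B. event a B \<and> avg q a B = \<beta> \<and> (\<forall>w. lo g (w 0) \<le> B w) \<and>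
    (\<forall>w. B w = 1 \<longrightarrow> \<not> w 0 < g \<longrightarrow> \<not> w k' < g) \<and>
    g / q * (\<beta> - g / q) \<le> E (\<lambda>w. (B w - lo g (w 0)) * lo g (w (k + k'))) \<and>
    g / q * (\<beta> - g / q) \<le> E (\<lambda>w. (B w - lo g (w 0)) * lo g (w k)) \<and>
    (k < a \<longrightarrow> \<beta> - g / q \<le> g / q * (1 - g / q)\<^sup>2 \<longrightarrow>
      E (\<lambda>w. (B w - lo g (w 0)) * lo g (w k)) = \<beta> - g / q)"
proof -
  define b where "b = real g / q"
  have b: "0 \<le> b" "b \<le> 1" using g q0 by (auto simp: b_def)
  define C where "C = (\<lambda>w::nat \<Rightarrow> nat. lo g (w 0))"
  define T where "T = (\<lambda>w::nat \<Rightarrow> nat. (1 - lo g (w 0)) * (1 - lo g (w k')))"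
  define T' where "T' = (\<lambda>w. T w * lo g (w k))"
  have C: "event a C"
    unfolding C_def by (rule eventI) (use a lo_01 in \<open>auto intro: dep_lo\<close>)
  have dT: "dep {..<a} T"
    unfolding T_def using a k'a by (intro dep_mult dep_diff dep_const dep_lo) auto
  have F: "event a (\<lambda>w. C w + T w)"
    by (rule eventI[OF dep_add[OF event_dep[OF C] dT]]) (auto simp: C_def T_def lo_def)
  have avgC: "avg q a C = b"
    using avg_letter[of 0 a "\<lambda>_. 1" q "lo g"] a q0 g by (simp add: C_def avg_const lmean_lo b_def)
  have avgT: "avg q a T = (1 - b)\<^sup>2"
  proof -
    have "avg q a T = (1 - b) * avg q a (\<lambda>w. 1 - lo g (w k'))"
      unfolding T_def by (subst avg_letter) (use a k' g q0 in \<open>auto simp: lmean_hi1 b_def\<close>)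
    moreover have "avg q a (\<lambda>w. (1 - lo g (w k')) * 1) = 1 - b"
      by (subst avg_letter) (use k'a g q0 in \<open>auto simp: lmean_hi1 avg_const b_def\<close>)
    ultimately show ?thesis by (simp add: power2_eq_square)
  qed
  have between: "\<exists>B. event a B \<and> (\<forall>w. X w \<le> B w \<and> B w \<le> Y w) \<and> avg q a B = \<beta>"
    if "event a X" "event a Y" "\<And>w. X w \<le> Y w" "avg q a X \<le> \<beta>" "\<beta> \<le> avg q a Y" for X Y
    using event_between[OF that(1-3) q0, of n] that(4,5) n by auto
  have CT: "C w \<le> C w + T w" for w by (simp add: T_def lo_def)
  define \<mu> where "\<mu> = (\<lambda>B. E (\<lambda>w. (B w - C w) * lo g (w k)))"
  have "\<exists>B. event a B \<and> avg q a B = \<beta> \<and> (\<forall>w. C w \<le> B w \<and> B w \<le> C w + T w) \<and>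
    b * (\<beta> - b) \<le> \<mu> B \<and> (k < a \<longrightarrow> \<beta> - b \<le> b * (1 - b)\<^sup>2 \<longrightarrow> \<mu> B = \<beta> - b)"
  proof (cases "k < a")
    case False
    obtain B where B: "event a B" "\<And>w. C w \<le> B w \<and> B w \<le> C w + T w" "avg q a B = \<beta>"
      using between[OF C F CT] avgC avgT \<beta> by (auto simp: avg_add b_def)
    have "E (\<lambda>w. lo g (w k) * (B w - C w)) = b * E (\<lambda>w. B w - C w)"
      by (subst avg_letter)
        (use False a k g dep_upd[OF event_dep[OF B(1)]] in \<open>auto simp: lmean_lo b_def C_def\<close>)
    also have "E (\<lambda>w. B w - C w) = \<beta> - b"
      using E_word[OF event_dep[OF B(1)]] E_word[OF event_dep[OF C]] avgC B(3) by (simp add: avg_diff)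
    finally have "\<mu> B = b * (\<beta> - b)" by (simp add: \<mu>_def mult.commute)
    then show ?thesis using B False by (intro exI[of _ B]) auto
  next
    case True
    have dT': "dep {..<a} T'"
      unfolding T'_def using True by (intro dep_mult dT dep_lo) auto
    have F': "event a (\<lambda>w. C w + T' w)"
      by (rule eventI[OF dep_add[OF event_dep[OF C] dT']]) (auto simp: C_def T_def T'_def lo_def)
    have avgT': "avg q a T' = b * (1 - b)\<^sup>2"
    proof -
      have "avg q a (\<lambda>w. lo g (w k) * T w) = b * avg q a T"
        by (subst avg_letter) (use True k kk' g in \<open>auto simp: T_def lmean_lo b_def\<close>)
      then show ?thesis by (simp add: T'_def mult.commute avgT)
    qed
    have CT': "C w \<le> C w + T' w" "C w + T' w \<le> C w + T w" for w by (auto simp: T_def T'_def lo_def)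
    show ?thesis
    proof (cases "\<beta> - b \<le> b * (1 - b)\<^sup>2")
      case small: True
      obtain B where B: "event a B" "\<And>w. C w \<le> B w \<and> B w \<le> C w + T' w" "avg q a B = \<beta>"
        using between[OF C F' CT'(1)] avgC avgT' \<beta> small by (auto simp: avg_add b_def)
      have "(B w - C w) * lo g (w k) = B w - C w" for w
        using B(2)[of w] by (auto simp: T'_def lo_def)
      then have "\<mu> B = E (\<lambda>w. B w - C w)" unfolding \<mu>_def by (intro avg_cong)
      then have "\<mu> B = \<beta> - b"
        using E_word[OF event_dep[OF B(1)]] E_word[OF event_dep[OF C]] avgC B(3) by (simp add: avg_diff \<mu>_def)
      moreover have "b * (\<beta> - b) \<le> 1 * (\<beta> - b)" using b \<beta> by (intro mult_right_mono) (auto simp: b_def)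
      moreover have "C w \<le> B w \<and> B w \<le> C w + T w" for w using B(2)[of w] CT'(2)[of w] by auto
      ultimately show ?thesis using B by (intro exI[of _ B]) auto
    next
      case big: False
      obtain B where B: "event a B" "\<And>w. C w + T' w \<le> B w \<and> B w \<le> C w + T w" "avg q a B = \<beta>"
        using between[OF F' F CT'(2)] avgC avgT avgT' \<beta> big by (auto simp: avg_add b_def)
      have "E T' \<le> \<mu> B"
        unfolding \<mu>_def
      proof (rule avg_mono)
        fix w show "T' w \<le> (B w - C w) * lo g (w k)"
          using B(2)[of w] by (auto simp: T'_def lo_def)
      qed
      moreover have "b * (\<beta> - b) \<le> b * (1 - b)\<^sup>2" using b \<beta> by (intro mult_left_mono) (auto simp: b_def)
      ultimately have "b * (\<beta> - b) \<le> \<mu> B" using E_word[OF dT'] avgT' by simp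
      moreover have "C w \<le> B w \<and> B w \<le> C w + T w" for w using B(2)[of w] CT'(1)[of w] by auto
      ultimately show ?thesis using B big by (intro exI[of _ B]) auto
    qed
  qed
  then obtain B where B: "event a B" "avg q a B = \<beta>" "\<And>w. C w \<le> B w \<and> B w \<le> C w + T w"
    and \<mu>B: "b * (\<beta> - b) \<le> \<mu> B" "k < a \<longrightarrow> \<beta> - b \<le> b * (1 - b)\<^sup>2 \<longrightarrow> \<mu> B = \<beta> - b" by blast
  define d where "d = (\<lambda>w. B w - C w)"
  have dd: "dep {..<a} d" unfolding d_def by (intro dep_diff event_dep B C)
  have avgd: "avg q a d = \<beta> - b" using B(2) avgC by (simp add: d_def avg_diff)
  have sparse: "\<not> w k' < g" if "B w = 1" "\<not> w 0 < g" for w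
    using B(3)[of w] that by (auto simp: C_def T_def lo_def)
  have "\<exists>B'. event a B' \<and> avg q a B' = \<beta> \<and> (\<forall>w. C w \<le> B' w) \<and>
    (\<forall>w. B' w = 1 \<longrightarrow> \<not> w 0 < g \<longrightarrow> \<not> w k' < g) \<and>
    b * (\<beta> - b) \<le> E (\<lambda>w. (B' w - C w) * lo g (w (k + k'))) \<and> \<mu> B' = \<mu> B"
  proof (cases "k + k' < a")
    case False
    have "E (\<lambda>w. lo g (w (k + k')) * d w) = b * E d"
      by (subst avg_letter)
        (use False a g dep_upd[OF dd] in \<open>auto simp: lmean_lo b_def\<close>)
    then have "b * (\<beta> - b) = E (\<lambda>w. (B w - C w) * lo g (w (k + k')))"
      using E_word[OF dd] avgd by (simp add: d_def mult.commute)
    then show ?thesis using B sparse by (intro exI[of _ B]) auto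
  next
    case True
    obtain x where x: "b * avg q a d \<le> avg q a (\<lambda>w. d (translate q (- {k + k'}) (\<lambda>_. x) w) * lo g (w (k + k')))"
      using ex_rotation[OF dd True g q0] by (auto simp: b_def)
    define R where "R = translate q (- {k + k'}) (\<lambda>_. x)"
    have R: "R w 0 = w 0" "R w k' = w k'" "R w k = w k" for w
      using k k' by (auto simp: R_def translate_def)
    have CR: "C (R w) = C w" for w by (simp add: C_def R)
    have "event a (\<lambda>w. B (R w))" unfolding R_def by (rule event_translate[OF B(1)])
    moreover have "avg q a (\<lambda>w. B (R w)) = \<beta>"
      unfolding R_def using avg_translate[OF event_dep[OF B(1)] q0] B(2) by simp
    moreover have "C w \<le> B (R w)" for w using B(3)[of "R w"] CR by simp
    moreover have "\<not> w k' < g" if "B (R w) = 1" "\<not> w 0 < g" for w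
      using sparse[OF that(1)] that(2) R by simp
    moreover have "b * (\<beta> - b) \<le> E (\<lambda>w. (B (R w) - C w) * lo g (w (k + k')))"
    proof -
      have "dep {..<a} (\<lambda>w. d (R w) * lo g (w (k + k')))"
        unfolding R_def using True by (intro dep_mult dep_translate dd dep_lo) auto
      from E_word[OF this] show ?thesis using x avgd by (simp add: R_def[symmetric] d_def CR)
    qed
    moreover have "\<mu> (\<lambda>w. B (R w)) = \<mu> B"
    proof -
      have *: "dep {..<a} (\<lambda>w. d w * lo g (w k))"
        using True by (intro dep_mult dd dep_lo) auto
      have **: "dep {..<a} (\<lambda>w. d (R w) * lo g (R w k))"
        using dep_translate[OF *] unfolding R_def .
      have "avg q a (\<lambda>w. d (R w) * lo g (R w k)) = avg q a (\<lambda>w. d w * lo g (w k))"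
        unfolding R_def by (rule avg_translate[OF * q0])
      then show ?thesis
        using E_word[OF *] E_word[OF **] by (simp add: \<mu>_def d_def CR R)
    qed
    ultimately show ?thesis by (intro exI[of _ "\<lambda>w. B (R w)"]) auto
  qed
  then obtain B' where B': "event a B'" "avg q a B' = \<beta>" "\<And>w. C w \<le> B' w"
    "\<And>w. B' w = 1 \<Longrightarrow> \<not> w 0 < g \<Longrightarrow> \<not> w k' < g"
    "b * (\<beta> - b) \<le> E (\<lambda>w. (B' w - C w) * lo g (w (k + k')))" "\<mu> B' = \<mu> B"
    by blast
  show ?thesis
  proof (intro exI[of _ B'] conjI allI impI)
    show "event a B'" "avg q a B' = \<beta>" by (rule B')+
    show "lo g (w 0) \<le> B' w" for w using B'(3)[of w] by (simp add: C_def)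
    show "\<not> w k' < g" if "B' w = 1" "\<not> w 0 < g" for w by (rule B'(4)[OF that])
    show "g / q * (\<beta> - g / q) \<le> E (\<lambda>w. (B' w - lo g (w 0)) * lo g (w (k + k')))"
      using B'(5) by (simp add: b_def C_def)
    have "E (\<lambda>w. (B' w - lo g (w 0)) * lo g (w k)) = \<mu> B"
      using B'(6) by (simp add: \<mu>_def C_def)
    then show "g / q * (\<beta> - g / q) \<le> E (\<lambda>w. (B' w - lo g (w 0)) * lo g (w k))"
      "k < a \<Longrightarrow> \<beta> - g / q \<le> g / q * (1 - g / q)\<^sup>2 \<Longrightarrow>
        E (\<lambda>w. (B' w - lo g (w 0)) * lo g (w k)) = \<beta> - g / q"
      using \<mu>B by (simp_all add: b_def)
  qed
qed

section \<open>Variants for odd q and densities near one half\<close>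

text \<open>If the window at k is in B, it starts with a letter below l; together with
  \<open>w 0 < l\<close> this puts w into B. Hence A can be a multiple of all words with
  \<open>w 0 < l\<close> that end in B, although B does not contain every word with such a first
  letter. The translation fixes the letters 0 and k because both conditions on B refer to
  them.\<close>

lemma splittable_window:
  assumes B: "event a B" and l: "0 < l" "l \<le> q" and \<beta>: "avg q a B = \<beta>" and ka: "k < a"
    and lower: "\<And>w. w 0 < l \<Longrightarrow> w k < l \<Longrightarrow> B w = 1" and upper: "\<And>w. B w = 1 \<Longrightarrow> w 0 < l"
    and t: "0 \<le> t" "t \<le> 1" "\<delta> = t * (l / q * \<beta>)"
    and num1: "k \<noteq> k' \<Longrightarrow> \<beta> - \<delta> - 1 / 4 \<le> (1 - t * (l / q)) * \<beta>\<^sup>2 - t * (l / q) * (l / q * ((1 - t * (l / q)) * \<beta>))"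
    and num2: "k = k' \<Longrightarrow> \<beta> - \<delta> - 1 / 4 \<le> \<beta>\<^sup>2 - t * (l / q * (l / q * \<beta>)) - t * (l / q) * ((1 - t) * (l / q * \<beta>))"
  shows "splittable q a k k' \<beta> \<delta>"
proof -
  note dB = event_dep[OF B]
  define lam where "lam = real l / q"
  have lam: "0 \<le> lam" "lam \<le> 1" using l q0 by (auto simp: lam_def)
  define Bv where "Bv v w = B (translate q {0, k} v w)" for v w
  have ev: "event a (Bv v)" for v unfolding Bv_def by (rule event_translate[OF B])
  note dBv = event_dep[OF ev]
  have avgv: "avg q a (Bv v) = \<beta>" for v
    unfolding Bv_def using avg_translate[OF dB q0] \<beta> by simp
  have lower': "w 0 < l \<Longrightarrow> w k < l \<Longrightarrow> Bv v w = 1" and upper': "Bv v w = 1 \<Longrightarrow> w 0 < l" for v w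
    using lower[of "translate q {0, k} v w"] upper[of "translate q {0, k} v w"] by (auto simp: Bv_def translate_def)
  have up: "Bv v (shift n w) \<le> lo l (w n)" for v w n
    using upper'[of v "shift n w"] event_01[OF ev, of v "shift n w"] by (auto simp: lo_def shift_def)
  define X where "X v = E (\<lambda>w. (1 - t * lo l (w k')) * (Bv v (shift 0 w) * Bv v (shift (0 + (k + k')) w)))" for v
  define Y where "Y v = E (\<lambda>w. (1 - t * lo l (w k')) * (Bv v (shift k w) * Bv v (shift (k + k') w)))" for v
  have *: "splittable q a k k' \<beta> \<delta>" if v: "\<beta> - \<delta> - 1 / 4 \<le> X v - t * lam * Y v" for v
  proof -
    define \<alpha> where "\<alpha> = (\<lambda>w. t * (lo l (w 0) * Bv v (shift k w)))"
    show ?thesis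
    proof (rule splittableI[OF ev avgv])
      show "dep {..<a + k} \<alpha>"
        unfolding \<alpha>_def using a by (intro dep_mult dep_const dep_lo dep_event_shift ev) auto
      show "0 \<le> \<alpha> w" for w
        using t event_ge0[OF ev] by (simp add: \<alpha>_def lo_def)
      show "\<alpha> w \<le> Bv v w * Bv v (shift k w)" for w
      proof -
        have "\<alpha> w \<le> 1 * (lo l (w 0) * Bv v (shift k w))"
          unfolding \<alpha>_def using t event_ge0[OF ev] by (intro mult_right_mono) (auto simp: lo_def)
        also have "\<dots> \<le> Bv v w * Bv v (shift k w)"
          using lower'[of w v] upper'[of v "shift k w"] event_01[OF ev, of v "shift k w"] event_ge0[OF ev, of v w]
          by (auto simp: lo_def shift_def)
        finally show ?thesis .
      qed
      have "E (\<lambda>w. lo l (w 0) * Bv v (shift k w)) = lam * \<beta>"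
        using E_letter_window[OF dBv, of 0 k "lo l" v] k l avgv by (simp add: lmean_lo lam_def)
      then show "E \<alpha> = \<delta>" unfolding \<alpha>_def using t(3) by (simp add: avg_lin lam_def)
      have "E (\<lambda>w. (Bv v w - \<alpha> w) * (Bv v (shift (k + k') w) - \<alpha> (shift k' w)))
        = E (\<lambda>w. (1 - t * lo l (w k')) * (Bv v (shift 0 w) * Bv v (shift (0 + (k + k')) w))
          - t * (lo l (w 0) * ((1 - t * lo l (w k')) * (Bv v (shift k w) * Bv v (shift (k + k') w)))))"
      proof (rule avg_cong)
        fix w
        have e: "\<alpha> (shift k' w) = t * (lo l (w k') * Bv v (shift (k + k') w))"
          by (simp add: \<alpha>_def shift_shift add.commute[of k' k]) (simp add: shift_def)
        show "(Bv v w - \<alpha> w) * (Bv v (shift (k + k') w) - \<alpha> (shift k' w))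
          = (1 - t * lo l (w k')) * (Bv v (shift 0 w) * Bv v (shift (0 + (k + k')) w))
            - t * (lo l (w 0) * ((1 - t * lo l (w k')) * (Bv v (shift k w) * Bv v (shift (k + k') w))))"
          unfolding e by (simp add: \<alpha>_def algebra_simps)
      qed
      also have "\<dots> = X v - t * E (\<lambda>w. lo l (w 0) * ((1 - t * lo l (w k')) * (Bv v (shift k w) * Bv v (shift (k + k') w))))"
        by (simp add: avg_lin X_def)
      also have "E (\<lambda>w. lo l (w 0) * ((1 - t * lo l (w k')) * (Bv v (shift k w) * Bv v (shift (k + k') w)))) = lam * Y v"
        unfolding Y_def by (subst avg_letter) (use k k' l in \<open>auto simp: shift_upd lmean_lo lam_def\<close>)
      finally show "\<beta> - \<delta> - 1 / 4 \<le> E (\<lambda>w. (Bv v w - \<alpha> w) * (Bv v (shift (k + k') w) - \<alpha> (shift k' w)))"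
        using v by (simp add: mult.assoc)
    qed
  qed
  show ?thesis
  proof (cases "k = k'")
    case False
    have \<psi>: "lmean q (\<lambda>x. 1 - t * lo l x) = 1 - t * lam"
      using lmean_hi l q0 by (simp add: lam_def)
    have "avg q a X = (1 - t * lam) * \<beta>\<^sup>2"
      unfolding X_def Bv_def
      by (subst avg_pair') (use dB k k' False in \<open>auto simp: \<psi> \<beta> power2_eq_square\<close>)
    then obtain v where v: "(1 - t * lam) * \<beta>\<^sup>2 \<le> X v"
      using avg_ex[OF q0, of "(1 - t * lam) * \<beta>\<^sup>2" a X] by auto
    \<comment> \<open>Only X needs a good translate. Y is bounded for every v by keeping of the
      window at k only that its first letter is below l.\<close>
    have "Y v \<le> E (\<lambda>w. lo l (w k) * ((1 - t * lo l (w k')) * Bv v (shift (k + k') w)))"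
      unfolding Y_def
    proof (rule avg_mono)
      fix w
      have "0 \<le> (1 - t * lo l (w k')) * Bv v (shift (k + k') w)"
        using t event_ge0[OF ev] lo_01[of l "w k'"] by auto
      from mult_right_mono[OF up[of v k w] this]
      show "(1 - t * lo l (w k')) * (Bv v (shift k w) * Bv v (shift (k + k') w))
        \<le> lo l (w k) * ((1 - t * lo l (w k')) * Bv v (shift (k + k') w))" by (simp add: algebra_simps)
    qed
    also have "\<dots> = lam * E (\<lambda>w. (1 - t * lo l (w k')) * Bv v (shift (k + k') w))"
      by (subst avg_letter) (use k k' l False in \<open>auto simp: shift_upd lmean_lo lam_def\<close>)
    also have "E (\<lambda>w. (1 - t * lo l (w k')) * Bv v (shift (k + k') w)) = (1 - t * lam) * \<beta>"
      using E_letter_window[OF dBv, of k' "k + k'" "\<lambda>x. 1 - t * lo l x" v] k \<psi> avgv by simp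
    finally have "t * lam * Y v \<le> t * lam * (lam * ((1 - t * lam) * \<beta>))"
      using t lam by (intro mult_left_mono) auto
    then show ?thesis using *[of v] v num1[OF False] by (simp add: lam_def)
  next
    case True
    \<comment> \<open>The letter k' = k is fixed by the translation. The identity
      \<open>lo l (w k) * B w = lo l (w 0) * lo l (w k)\<close> splits it off from X, and only the
      plain pair P is averaged over translates.\<close>
    define P where "P v = E (\<lambda>w. Bv v (shift 0 w) * Bv v (shift (0 + (k + k')) w))" for v
    have "avg q a P = \<beta>\<^sup>2"
      unfolding P_def Bv_def
      by (subst avg_E_pair) (use dB k k' in \<open>auto simp: \<beta> power2_eq_square\<close>)
    then obtain v where v: "\<beta>\<^sup>2 \<le> P v"
      using avg_ex[OF q0, of "\<beta>\<^sup>2" a P] by auto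
    have E3: "E (\<lambda>w. lo l (w k) * Bv v (shift (k + k') w)) = lam * \<beta>"
      using E_letter_window[OF dBv, of k "k + k'" "lo l" v] k' l avgv by (simp add: lmean_lo lam_def)
    have XP: "P v - t * E (\<lambda>w. lo l (w 0) * (lo l (w k) * Bv v (shift (k + k') w))) = X v"
    proof -
      have "X v = E (\<lambda>w. Bv v (shift 0 w) * Bv v (shift (0 + (k + k')) w)
        - t * (lo l (w 0) * (lo l (w k) * Bv v (shift (k + k') w))))"
        unfolding X_def
      proof (rule avg_cong)
        fix w
        have "lo l (w k) * Bv v w = lo l (w 0) * lo l (w k)"
          using lower'[of w v] upper'[of v w] event_01[OF ev, of v w] by (auto simp: lo_def)
        then show "(1 - t * lo l (w k')) * (Bv v (shift 0 w) * Bv v (shift (0 + (k + k')) w))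
          = Bv v (shift 0 w) * Bv v (shift (0 + (k + k')) w)
            - t * (lo l (w 0) * (lo l (w k) * Bv v (shift (k + k') w)))"
          using True by (auto simp: algebra_simps)
      qed
      then show ?thesis by (simp add: avg_lin P_def)
    qed
    have E4: "E (\<lambda>w. lo l (w 0) * (lo l (w k) * Bv v (shift (k + k') w))) = lam * (lam * \<beta>)"
      unfolding E3[symmetric] by (subst avg_letter) (use k k' l in \<open>auto simp: shift_upd lmean_lo lam_def\<close>)
    have Y: "Y v \<le> (1 - t) * (lam * \<beta>)"
    proof -
      have "Y v \<le> E (\<lambda>w. (1 - t) * (lo l (w k) * Bv v (shift (k + k') w)))"
        unfolding Y_def
      proof (rule avg_mono)
        fix w
        show "(1 - t * lo l (w k')) * (Bv v (shift k w) * Bv v (shift (k + k') w))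
          \<le> (1 - t) * (lo l (w k) * Bv v (shift (k + k') w))"
          using up[of v k w] event_01[OF ev, of v "shift k w"] event_01[OF ev, of v "shift (k + k') w"] t True
          by (auto simp: lo_def split: if_splits)
      qed
      then show ?thesis using E3 by (simp add: avg_lin)
    qed
    have "t * lam * Y v \<le> t * lam * ((1 - t) * (lam * \<beta>))"
      using t lam by (intro mult_left_mono Y) auto
    then show ?thesis
      using XP[unfolded E4] v num2[OF True, folded lam_def] by (intro *[of v]) linarith
  qed
qed

text \<open>By a <= k the windows at 0 and k are disjoint, so words beginning and ending in B have
  density \<open>\<beta>^2\<close>; the second stage takes those with first letter at least g. A
  long word that begins and ends in B survives both stages if its windows at k and k' miss B, which
  is certain when these start with letters at least g'. Four averages occur with different signs, so
  one translate is chosen for their combination.\<close>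

lemma splittable_far:
  assumes B: "event a B" and C: "\<And>w. lo g (w 0) \<le> B w" and g: "g \<le> q" "g' \<le> q" and \<beta>: "avg q a B = \<beta>"
    and ka: "a \<le> k" and k'a: "k' < a"
    and upper: "\<And>w. B w = 1 \<Longrightarrow> w 0 < g'"
    and s: "0 \<le> s" "s \<le> 1" "\<delta> = g / q * \<beta> + s * ((\<beta> - g / q) * \<beta>)"
    and num: "\<beta> - \<delta> - 1 / 4 \<le> (1 - s) * ((1 - g / q) * \<beta>)\<^sup>2 + s * ((1 - g' / q) * \<beta>)\<^sup>2
      - s * (1 - s) * (\<beta> * (\<beta> - g / q)\<^sup>2)"
  shows "splittable q a k k' \<beta> \<delta>"
proof -
  note dB = event_dep[OF B]
  define b where "b = real g / q"
  define c where "c = 1 - real g' / q"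
  define Bv where "Bv v w = B (translate q {0} v w)" for v w
  have ev: "event a (Bv v)" for v unfolding Bv_def by (rule event_translate[OF B])
  note dBv = event_dep[OF ev]
  have avgv: "avg q a (Bv v) = \<beta>" for v
    unfolding Bv_def using avg_translate[OF dB q0] \<beta> by simp
  have Cv: "lo g (w 0) \<le> Bv v w" and upper': "Bv v w = 1 \<Longrightarrow> w 0 < g'" for v w
    using C[of "translate q {0} v w"] upper[of "translate q {0} v w"] by (auto simp: Bv_def translate_def)
  define d where "d = (\<lambda>w. B w - lo g (w 0))"
  define dv where "dv v w = Bv v w - lo g (w 0)" for v w
  have dv: "dv v w = d (translate q {0} v w)" for v w
    by (simp add: d_def dv_def Bv_def translate_def)
  have dd: "dep {..<a} d" unfolding d_def using a by (intro dep_diff dB dep_lo) auto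
  have ddv: "dep {..<a} (dv v)" for v unfolding dv by (rule dep_translate[OF dd])
  have lo_avg: "avg q a (\<lambda>w. lo g (w 0)) = b"
    using avg_letter[of 0 a "\<lambda>_. 1" q "lo g"] a q0 g by (simp add: avg_const lmean_lo b_def)
  have avgd: "avg q a d = \<beta> - b" by (simp add: d_def avg_diff \<beta> lo_avg)
  have avgdv: "avg q a (dv v) = \<beta> - b" for v
    unfolding dv using avg_translate[OF dd q0] avgd by simp
  define X where "X = (\<lambda>v. E (\<lambda>w. (1 - lo g (w k')) * (Bv v (shift 0 w) * Bv v (shift (0 + (k + k')) w))))"
  define Y where "Y = (\<lambda>v. E (\<lambda>w. (1 - lo g (w k')) * (Bv v (shift k w) * Bv v (shift (k + k') w))))"
  define Z where "Z = (\<lambda>v. E (\<lambda>w. (1 - lo g' (w k')) * (Bv v (shift 0 w) * Bv v (shift (0 + (k + k')) w))))"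
  define U where "U = (\<lambda>v. E (\<lambda>w. dv v (shift 0 w) * dv v (shift (0 + k') w)))"
  have "avg q a X = (1 - b) * \<beta>\<^sup>2"
    unfolding X_def Bv_def
    by (subst avg_pair') (use dB k k' g q0 in \<open>auto simp: lmean_hi1 b_def \<beta> power2_eq_square\<close>)
  moreover have "avg q a Y = (1 - b) * \<beta>\<^sup>2"
    unfolding Y_def Bv_def
    by (subst avg_pair') (use dB k k' g q0 ka k'a in \<open>auto simp: lmean_hi1 b_def \<beta> power2_eq_square\<close>)
  moreover have "avg q a Z = c * \<beta>\<^sup>2"
    unfolding Z_def Bv_def
    by (subst avg_pair') (use dB k k' g q0 in \<open>auto simp: lmean_hi1 c_def \<beta> power2_eq_square\<close>)
  moreover have "avg q a U = (\<beta> - b)\<^sup>2"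
    unfolding U_def dv
    by (subst avg_E_pair) (use dd k k' in \<open>auto simp: avgd power2_eq_square\<close>)
  ultimately have "avg q a (\<lambda>v. (1 - s) * (X v - b * Y v) + s * (c * Z v) - s * (1 - s) * (\<beta> * U v))
    = (1 - s) * ((1 - b) * \<beta>)\<^sup>2 + s * (c * \<beta>)\<^sup>2 - s * (1 - s) * (\<beta> * (\<beta> - b)\<^sup>2)"
    by (simp add: avg_lin) (simp add: power2_eq_square algebra_simps)
  then obtain v where v: "\<beta> - \<delta> - 1 / 4 \<le> (1 - s) * (X v - b * Y v) + s * (c * Z v) - s * (1 - s) * (\<beta> * U v)"
    using avg_ex[OF q0, of "\<beta> - \<delta> - 1 / 4" a "\<lambda>v. (1 - s) * (X v - b * Y v) + s * (c * Z v) - s * (1 - s) * (\<beta> * U v)"]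
      num by (auto simp: b_def c_def)
  define D where "D = (\<lambda>w. dv v w * Bv v (shift k w))"
  have ED: "E D = (\<beta> - b) * \<beta>"
    using E_indep[OF ddv dep_shift[OF dBv, of k], of v v] ka E_word[OF ddv] E_window[OF dBv, of k]
      avgdv avgv by (simp add: D_def)
  show ?thesis
  proof (rule splittable_two_stage[OF ev Cv g(1) avgv, of D])
    show "dep {..<a + k} D"
      unfolding D_def dv_def using a by (intro dep_mult dep_diff dep_lo dep_event_shift dep_event_word ev) auto
    show "0 \<le> D w" for w
      using Cv[of w v] event_ge0[OF ev] by (simp add: D_def dv_def)
    show "lo g (w 0) * Bv v (shift k w) + D w \<le> Bv v w * Bv v (shift k w)" for w
      by (simp add: D_def dv_def algebra_simps)
    show "0 \<le> s" "s \<le> 1" by (rule s)+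
    show "\<delta> = g / q * \<beta> + s * E D" using s(3) ED by (simp add: b_def)
    show "X v - b * Y v \<le> E (\<lambda>w. (Bv v w - lo g (w 0) * Bv v (shift k w)) *
        (Bv v (shift (k + k') w) - lo g (w k') * Bv v (shift (k + k') w)))"
    proof -
      have "E (\<lambda>w. lo g (w 0) * ((1 - lo g (w k')) * (Bv v (shift k w) * Bv v (shift (k + k') w)))) = b * Y v"
        unfolding Y_def by (subst avg_letter) (use k k' g in \<open>auto simp: shift_upd lmean_lo b_def\<close>)
      then have "X v - b * Y v = E (\<lambda>w. (1 - lo g (w k')) * (Bv v (shift 0 w) * Bv v (shift (0 + (k + k')) w))
        - lo g (w 0) * ((1 - lo g (w k')) * (Bv v (shift k w) * Bv v (shift (k + k') w))))"
        by (simp add: avg_diff X_def)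
      also have "\<dots> = E (\<lambda>w. (Bv v w - lo g (w 0) * Bv v (shift k w)) *
        (Bv v (shift (k + k') w) - lo g (w k') * Bv v (shift (k + k') w)))"
        by (rule avg_cong) (simp add: algebra_simps)
      finally show ?thesis by simp
    qed
    show "c * Z v \<le> E (\<lambda>w. (Bv v w - lo g (w 0) * Bv v (shift k w) - D w) *
        (Bv v (shift (k + k') w) - lo g (w k') * Bv v (shift (k + k') w) - D (shift k' w)))"
    proof -
      have "c * Z v = E (\<lambda>w. (1 - lo g' (w k)) * ((1 - lo g' (w k')) * (Bv v (shift 0 w) * Bv v (shift (0 + (k + k')) w))))"
        unfolding Z_def
        by (subst avg_letter)
          (use k k' g ka k'a q0 dep_upd[OF dBv] in \<open>auto simp: shift_upd lmean_hi1 c_def\<close>)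
      also have "\<dots> \<le> E (\<lambda>w. (Bv v w - lo g (w 0) * Bv v (shift k w) - D w) *
        (Bv v (shift (k + k') w) - lo g (w k') * Bv v (shift (k + k') w) - D (shift k' w)))"
      proof (rule avg_mono)
        fix w
        have 1: "Bv v w - lo g (w 0) * Bv v (shift k w) - D w = Bv v w * (1 - Bv v (shift k w))"
          by (simp add: D_def dv_def algebra_simps)
        have 2: "Bv v (shift (k + k') w) - lo g (w k') * Bv v (shift (k + k') w) - D (shift k' w)
          = Bv v (shift (k + k') w) * (1 - Bv v (shift k' w))"
          by (simp add: D_def dv_def shift_shift add.commute[of k' k] algebra_simps) (simp add: shift_def)
        show "(1 - lo g' (w k)) * ((1 - lo g' (w k')) * (Bv v (shift 0 w) * Bv v (shift (0 + (k + k')) w)))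
          \<le> (Bv v w - lo g (w 0) * Bv v (shift k w) - D w) *
        (Bv v (shift (k + k') w) - lo g (w k') * Bv v (shift (k + k') w) - D (shift k' w))"
          unfolding 1 2
          using event_01[OF ev, of v w] event_01[OF ev, of v "shift k w"] event_01[OF ev, of v "shift k' w"]
            event_01[OF ev, of v "shift (k + k') w"] upper'[of v "shift k w"] upper'[of v "shift k' w"]
          by (auto simp: lo_def shift_def[of k] shift_def[of k'])
      qed
      finally show ?thesis .
    qed
    show "E (\<lambda>w. D w * D (shift k' w)) \<le> \<beta> * U v"
    proof -
      have "E (\<lambda>w. D w * D (shift k' w)) \<le> E (\<lambda>w. (dv v w * dv v (shift k' w)) * Bv v (shift (k + k') w))"
      proof (rule avg_mono)
        fix w
        have "D w * D (shift k' w) = Bv v (shift k w) * ((dv v w * dv v (shift k' w)) * Bv v (shift (k + k') w))"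
          by (simp add: D_def shift_shift add.commute[of k' k])
        also have "\<dots> \<le> 1 * ((dv v w * dv v (shift k' w)) * Bv v (shift (k + k') w))"
          using event_le1[OF ev] event_ge0[OF ev] Cv[of w v] Cv[of "shift k' w" v]
          by (intro mult_right_mono mult_nonneg_nonneg) (auto simp: dv_def)
        finally show "D w * D (shift k' w) \<le> (dv v w * dv v (shift k' w)) * Bv v (shift (k + k') w)" by simp
      qed
      also have "\<dots> = E (\<lambda>w. dv v w * dv v (shift k' w)) * E (\<lambda>w. Bv v (shift (k + k') w))"
      proof (rule E_indep)
        show "dep {..<k' + a} (\<lambda>w. dv v w * dv v (shift k' w))"
          by (intro dep_mult dep_mono[OF ddv] dep_mono[OF dep_shift[OF ddv]]) auto
        show "dep {k + k'..<k + k' + a} (\<lambda>w. Bv v (shift (k + k') w))" by (rule dep_shift[OF dBv])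
      qed (use ka in auto)
      also have "\<dots> = \<beta> * U v"
        using E_window[OF dBv, of "k + k'" v] avgv by (simp add: U_def)
      finally show ?thesis .
    qed
    show "\<beta> - \<delta> - 1 / 4 \<le> (1 - s) * (X v - b * Y v) + s * (c * Z v) - s * (1 - s) * (\<beta> * U v)" by (rule v)
  qed
qed

end

section \<open>Numerical estimates for the constructions\<close>

lemma prod_complement_le: "(x::real) * (1 - x) \<le> 1 / 4"
  using zero_le_power2[of "x - 1 / 2"] by (simp add: power2_eq_square algebra_simps)

text \<open>Right side minus left side is nondecreasing in M, with slope
  \<open>s * (1 - (1 - s) * r)\<close>, so M may take its least value. What remains is the affine
  function f of \<open>1 - \<beta>\<close>, checked at the ends 0 and \<open>y = b * (1 - b)\<close>
  of the range.\<close>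

lemma full_estimate:
  fixes b \<beta> s M :: real
  assumes b: "1 / 2 \<le> b" "b \<le> 1" and s: "0 \<le> s" "s \<le> 1"
    and \<beta>: "\<beta> \<le> 1" "1 - \<beta> \<le> b * (1 - b)" and M: "(1 - b) * \<beta> - (1 - \<beta>) \<le> M"
  shows "\<beta> - (b * \<beta> + s * M) - 1 / 4 \<le> (1 - s) * ((1 - b)\<^sup>2 * \<beta>) - s * (1 - s) * ((1 - b) * M)"
proof -
  define r where "r = 1 - b"
  define y where "y = b * r"
  define f where "f x = (1 - s) * (r\<^sup>2 * (1 - x)) - s * (1 - s) * (r * (r - x * (1 + r))) - r * (1 - x)
    + s * (r - x * (1 + r)) + 1 / 4" for x
  have r: "0 \<le> r" "r \<le> 1 / 2" using b by (auto simp: r_def)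
  have y: "0 \<le> y" "y \<le> 1 / 4" using b r prod_complement_le[of b] by (auto simp: y_def r_def)
  have r2: "r\<^sup>2 \<le> 1 / 4" using power_mono[OF r(2,1), of 2] by (simp add: power2_eq_square)
  have "f 0 = (1 - s) * (1 / 4 - y) + s * (1 / 4 - (1 - s) * r\<^sup>2)"
    by (simp add: f_def y_def r_def power2_eq_square algebra_simps add_divide_distrib diff_divide_distrib)
  moreover have "(1 - s) * r\<^sup>2 \<le> 1 * (1 / 4)" using s r2 by (intro mult_mono) auto
  ultimately have f0: "0 \<le> f 0" using s y by simp
  have "f y = (1 - s) * ((1 / 2 - y)\<^sup>2 - s * (r\<^sup>2)\<^sup>2) + s * (1 / 4 - y)"
    by (simp add: f_def y_def r_def power2_eq_square algebra_simps add_divide_distrib diff_divide_distrib)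
  moreover have "s * (r\<^sup>2)\<^sup>2 \<le> 1 * (1 / 4)\<^sup>2" using s r2 by (intro mult_mono power_mono) auto
  moreover have "(1 / 4)\<^sup>2 \<le> (1 / 2 - y)\<^sup>2" using y by (intro power_mono) auto
  ultimately have "0 \<le> (1 / 2 - y)\<^sup>2 - s * (r\<^sup>2)\<^sup>2" "f y = (1 - s) * ((1 / 2 - y)\<^sup>2 - s * (r\<^sup>2)\<^sup>2) + s * (1 / 4 - y)"
    by linarith+
  then have fy: "0 \<le> f y" using s y by (simp only:) (intro add_nonneg_nonneg mult_nonneg_nonneg, auto)
  have "0 \<le> f (1 - \<beta>)"
  proof (cases "y = 0")
    case True
    then have "1 - \<beta> = 0" using \<beta> unfolding y_def r_def by linarith
    then show ?thesis using f0 by simp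
  next
    case False
    have "y * f (1 - \<beta>) = (y - (1 - \<beta>)) * f 0 + (1 - \<beta>) * f y"
      by (simp add: f_def algebra_simps) (simp add: field_simps)
    also have "\<dots> \<ge> 0" using f0 fy \<beta> by (simp add: y_def r_def)
    finally show ?thesis using False y by (simp add: zero_le_mult_iff)
  qed
  moreover have "0 \<le> s * (1 - (1 - s) * r) * (M - (r * \<beta> - (1 - \<beta>)))"
  proof -
    have "(1 - s) * r \<le> 1 * 1" using s r by (intro mult_mono) auto
    then show ?thesis using s M by (simp add: r_def)
  qed
  moreover have "(1 - s) * (r\<^sup>2 * \<beta>) - s * (1 - s) * (r * M) - (\<beta> - (b * \<beta> + s * M) - 1 / 4)
    = f (1 - \<beta>) + s * (1 - (1 - s) * r) * (M - (r * \<beta> - (1 - \<beta>)))"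
    by (simp add: f_def r_def power2_eq_square algebra_simps)
  ultimately show ?thesis by (simp add: r_def)
qed

text \<open>As before, the difference is nondecreasing in \<open>\<mu>\<close>. At
  \<open>\<mu> = b * \<tau>\<close> it is a sum with weights 1 - s and s of two expressions,
  nonnegative because \<open>b \<ge> 1 - b\<close> and \<open>b * (1 - b) \<le> 1/4\<close>.\<close>

lemma sparse_estimate:
  fixes b \<tau> s \<mu> :: real
  assumes b: "1 / 2 \<le> b" "b \<le> 1" and s: "0 \<le> s" "s \<le> 1"
    and \<tau>: "0 \<le> \<tau>" "\<tau> \<le> (1 - b)\<^sup>2" and \<mu>: "b * \<tau> \<le> \<mu>"
  shows "(b + \<tau>) - (b * (b + \<tau>) + s * \<mu>) - 1 / 4
    \<le> (1 - s) * (b * \<tau> + b\<^sup>2 * (1 - b)\<^sup>2) - s * (1 - s) * ((1 - b) * \<mu>)"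
proof -
  define r where "r = 1 - b"
  have gen: "0 \<le> (1 - s) * x + s * y" if "0 \<le> x" "0 \<le> y" for x y :: real
    using s that by simp
  have r: "0 \<le> r" "r \<le> 1 / 2" using b by (auto simp: r_def)
  have y: "0 \<le> r * b" "r * b \<le> 1 / 4" using b r prod_complement_le[of b] by (auto simp: r_def mult.commute)
  have "\<tau> \<le> 1 / 4" using \<tau>(2) power_mono[OF r(2,1), of 2] by (simp add: power2_eq_square r_def)
  then have "s * (r * b * \<tau>) \<le> 1 * (1 / 4 * (1 / 4))" using s y \<tau> by (intro mult_mono) auto
  moreover have "(1 / 4)\<^sup>2 \<le> (1 / 2 - r * b)\<^sup>2" using y by (intro power_mono) auto
  moreover have "(1 / 4 :: real)\<^sup>2 = 1 / 16" by (simp add: power2_eq_square)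
  moreover have br: "0 \<le> (b - r) * \<tau>" using b \<tau> by (simp add: r_def)
  ultimately have "0 \<le> (b - r) * \<tau> + (1 / 2 - r * b)\<^sup>2 - s * (r * b * \<tau>)" by linarith
  moreover have "0 \<le> 1 / 4 - r * b + (b - r) * \<tau>" using br y by linarith
  ultimately have "0 \<le> (1 - s) * ((b - r) * \<tau> + (1 / 2 - r * b)\<^sup>2 - s * (r * b * \<tau>)) + s * (1 / 4 - r * b + (b - r) * \<tau>)"
    by (rule gen)
  moreover have "0 \<le> s * (1 - (1 - s) * r) * (\<mu> - b * \<tau>)"
  proof -
    have "(1 - s) * r \<le> 1 * 1" using s r by (intro mult_mono) auto
    then show ?thesis using s \<mu> by simp
  qed
  moreover have "(1 - s) * (b * \<tau> + b\<^sup>2 * r\<^sup>2) - s * (1 - s) * (r * \<mu>) - ((b + \<tau>) - (b * (b + \<tau>) + s * \<mu>) - 1 / 4)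
    = (1 - s) * ((b - r) * \<tau> + (1 / 2 - r * b)\<^sup>2 - s * (r * b * \<tau>)) + s * (1 / 4 - r * b + (b - r) * \<tau>)
      + s * (1 - (1 - s) * r) * (\<mu> - b * \<tau>)"
    by (simp add: r_def power2_eq_square algebra_simps) (simp add: field_simps)
  ultimately show ?thesis by (simp add: r_def)
qed

text \<open>The value b = 1/3 is out of reach of \<open>sparse_estimate\<close>; the full
  correlation \<open>\<mu> = \<tau>\<close> in place of \<open>b * \<tau>\<close>
  compensates.\<close>

lemma ternary_estimate:
  fixes \<tau> s :: real
  assumes s: "0 \<le> s" "s \<le> 1" and \<tau>: "0 \<le> \<tau>" "\<tau> \<le> 1 / 9"
  shows "(1 / 3 + \<tau>) - (1 / 3 * (1 / 3 + \<tau>) + s * \<tau>) - 1 / 4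
    \<le> (1 - s) * (1 / 3 * \<tau> + (1 / 3)\<^sup>2 * (1 - 1 / 3)\<^sup>2) - s * (1 - s) * ((1 - 1 / 3) * \<tau>)"
proof -
  have "s * (1 - s) * \<tau> \<le> 1 / 4 * \<tau>" using prod_complement_le[of s] \<tau> by (intro mult_right_mono) auto
  then have "0 \<le> (1 - s) * (4 / 81 + 1 / 36 - \<tau> / 2) + s * (1 / 36 + \<tau> / 6) + 2 / 3 * (1 / 4 * \<tau> - s * (1 - s) * \<tau>)"
    using s \<tau> by (intro add_nonneg_nonneg mult_nonneg_nonneg) auto
  also have "\<dots> = (1 - s) * (1 / 3 * \<tau> + (1 / 3)\<^sup>2 * (1 - 1 / 3)\<^sup>2) - s * (1 - s) * ((1 - 1 / 3) * \<tau>)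
    - ((1 / 3 + \<tau>) - (1 / 3 * (1 / 3 + \<tau>) + s * \<tau>) - 1 / 4)"
    by (simp add: power2_eq_square algebra_simps add_divide_distrib diff_divide_distrib)
  finally show ?thesis by (rule iffD1[OF diff_ge_0_iff_ge])
qed

text \<open>The difference of the sides is a square, plus \<open>s * s * (b * \<beta>)^2\<close>,
  plus s(1 - s) times \<open>2 * (b * \<beta>)^2 - \<beta> * \<tau>^2\<close>; the last is
  nonnegative by \<open>\<tau> \<le> 1/3 \<le> b\<close>.\<close>

lemma far_estimate:
  fixes b \<tau> s :: real
  assumes b: "1 / 3 \<le> b" and s: "0 \<le> s" "s \<le> 1" and \<tau>: "0 \<le> \<tau>" "\<tau> \<le> 1 / 3"
  shows "(b + \<tau>) - (b * (b + \<tau>) + s * (\<tau> * (b + \<tau>))) - 1 / 4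
    \<le> (1 - s) * ((1 - b) * (b + \<tau>))\<^sup>2 + s * (b * (b + \<tau>))\<^sup>2 - s * (1 - s) * ((b + \<tau>) * \<tau>\<^sup>2)"
proof -
  define \<beta> where "\<beta> = b + \<tau>"
  have \<beta>: "0 \<le> \<beta>" using b \<tau> by (simp add: \<beta>_def)
  have "\<tau>\<^sup>2 \<le> 2 * b\<^sup>2 * \<beta>"
  proof -
    have "(1 / 3)\<^sup>2 \<le> b\<^sup>2" using b by (intro power_mono) auto
    then have "2 * (1 / 3)\<^sup>2 * (1 / 3 + \<tau>) \<le> 2 * b\<^sup>2 * \<beta>"
      using b \<tau> by (intro mult_mono) (auto simp: \<beta>_def)
    moreover have "\<tau>\<^sup>2 \<le> 1 / 3 * \<tau>" using \<tau> mult_right_mono[of \<tau> "1 / 3" \<tau>] by (simp add: power2_eq_square)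
    ultimately show ?thesis using \<tau> by (simp add: power2_eq_square)
  qed
  then have "\<beta> * \<tau>\<^sup>2 \<le> \<beta> * (2 * b\<^sup>2 * \<beta>)" using \<beta> by (intro mult_left_mono) auto
  then have "0 \<le> s * (1 - s) * (2 * (b * \<beta>)\<^sup>2 - \<beta> * \<tau>\<^sup>2)"
    using s by (intro mult_nonneg_nonneg) (auto simp: power2_eq_square algebra_simps)
  moreover have "0 \<le> s * s * (b * \<beta>)\<^sup>2" by simp
  moreover have "0 \<le> ((1 - s) * (1 / 2 - (1 - b) * \<beta>) - s * (\<beta> - 1 / 2))\<^sup>2" by simp
  moreover have "(1 - s) * ((1 - b) * \<beta>)\<^sup>2 + s * (b * \<beta>)\<^sup>2 - s * (1 - s) * (\<beta> * \<tau>\<^sup>2)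
      - (\<beta> - (b * \<beta> + s * (\<tau> * \<beta>)) - 1 / 4)
    = ((1 - s) * (1 / 2 - (1 - b) * \<beta>) - s * (\<beta> - 1 / 2))\<^sup>2 + s * s * (b * \<beta>)\<^sup>2
      + s * (1 - s) * (2 * (b * \<beta>)\<^sup>2 - \<beta> * \<tau>\<^sup>2)"
    by (simp add: \<beta>_def power2_eq_square algebra_simps) (simp add: field_simps)
  ultimately show ?thesis unfolding \<beta>_def[symmetric] by linarith
qed

text \<open>With y = 1 - u the claim reads
  \<open>\<beta> * y * (1 + lam - \<beta> - lam * y) \<le> 1/4\<close>. On the given range y = lam
  is the worst case, and then \<open>\<beta> = B / 2\<close>, with value
  \<open>lam * B^2 / 4\<close>. The crude bound \<open>B \<le> 5/4\<close> is good enough up to lam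
  = 3/5 but not at lam = 2/3, where the exact value is 121/486. The fractions (g + 1)/(2g + 1) skip
  the gap between.\<close>

lemma window_estimate_neq:
  fixes lam \<beta> u :: real
  assumes lam: "1 / 2 \<le> lam" "lam = 2 / 3 \<or> lam \<le> 3 / 5" and u: "1 - lam \<le> u" "u \<le> 1"
    and \<beta>: "0 \<le> \<beta>" "\<beta> \<le> lam"
  shows "\<beta> - u * \<beta> - 1 / 4 \<le> (1 - u) * \<beta>\<^sup>2 - u * (lam * ((1 - u) * \<beta>))"
proof -
  define y where "y = 1 - u"
  define B where "B = 1 + lam - lam * lam"
  have y: "0 \<le> y" "y \<le> lam" using u by (auto simp: y_def)
  have l: "lam \<le> 2 / 3" using lam(2) by auto
  have "lam * (lam + y) \<le> 2 / 3 * (2 / 3 + 2 / 3)" using y l lam by (intro mult_mono) auto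
  then have "0 \<le> (lam - y) * (1 + lam - \<beta> - lam * (lam + y))"
    using y \<beta> by (intro mult_nonneg_nonneg) auto
  then have "y * (1 + lam - \<beta> - lam * y) \<le> lam * (B - \<beta>)"
    by (simp add: B_def algebra_simps)
  then have "\<beta> * (y * (1 + lam - \<beta> - lam * y)) \<le> \<beta> * (lam * (B - \<beta>))"
    using \<beta> by (intro mult_left_mono) auto
  also have "\<dots> \<le> lam * (B * B / 4)"
  proof -
    have "0 \<le> lam * (B / 2 - \<beta>)\<^sup>2" using lam by simp
    then show ?thesis by (simp add: power2_eq_square algebra_simps)
  qed
  also have "lam * (B * B / 4) \<le> 1 / 4"
    using lam(2)
  proof
    assume l: "lam = 2 / 3"
    show ?thesis unfolding B_def l by simp
  next
    assume "lam \<le> 3 / 5"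
    moreover have "B \<le> 5 / 4" using prod_complement_le[of lam] by (simp add: B_def algebra_simps)
    moreover have "lam * lam \<le> 1 * 1" using l lam by (intro mult_mono) auto
    ultimately have "lam * (B * B) \<le> 3 / 5 * (5 / 4 * (5 / 4))"
      using lam by (intro mult_mono) (auto simp: B_def)
    then show ?thesis by simp
  qed
  finally show ?thesis by (simp add: y_def power2_eq_square algebra_simps)
qed

lemma window_estimate_eq:
  fixes lam \<beta> t :: real
  assumes lam: "1 / 2 \<le> lam" "lam \<le> 2 / 3" and t: "1 - lam \<le> t * lam" and \<beta>: "0 \<le> \<beta>"
  shows "\<beta> - t * lam * \<beta> - 1 / 4 \<le> \<beta>\<^sup>2 - t * (lam * (lam * \<beta>)) - t * lam * ((1 - t) * (lam * \<beta>))"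
proof -
  have "0 \<le> t * lam" "0 \<le> 1 - 2 * lam + t * lam" using lam t by linarith+
  then have "0 \<le> t * lam * (\<beta> * (1 - 2 * lam + t * lam))"
    using \<beta> by (intro mult_nonneg_nonneg[of "t * lam"] mult_nonneg_nonneg[of \<beta>]) auto
  moreover have "0 \<le> (\<beta> - 1 / 2)\<^sup>2" by simp
  ultimately show ?thesis by (simp add: power2_eq_square algebra_simps)
qed

section \<open>Choice of the construction for given densities\<close>

context three_lengths
begin

lemma event_lo: "event a (\<lambda>w. lo g (w 0))"
  by (rule eventI) (use a lo_01 in \<open>auto intro: dep_lo\<close>)

lemma avg_lo: "p < a \<Longrightarrow> g \<le> q \<Longrightarrow> avg q a (\<lambda>w. lo g (w p)) = g / q"
  using avg_letter[of p a "\<lambda>_. 1" q "lo g"] q0 by (simp add: avg_const lmean_lo)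

lemma event_one: "event a (\<lambda>w. 1)"
  by (rule eventI) (auto intro: dep_const)

lemma splittable_low:
  assumes g: "0 < g" "g \<le> q" and n: "real n / q ^ a = \<beta>"
    and \<beta>: "g / q \<le> \<beta>" "\<beta> \<le> 1" and \<delta>: "0 \<le> \<delta>" "\<delta> \<le> g / q * \<beta>"
  shows "splittable q a k k' \<beta> \<delta>"
proof -
  obtain B where "event a B" "\<And>w. lo g (w 0) \<le> B w" "avg q a B = \<beta>"
    using event_between[OF event_lo[of g] event_one _ q0, of n] avg_lo[OF a g(2)] q0 \<beta> n
    by (auto simp: avg_const lo_def)
  then show ?thesis using splittable_small[of B g \<beta> \<delta>] g \<delta> by blast
qed

lemma scale_exists:
  fixes \<sigma> M :: real
  assumes "0 < \<sigma>" "\<sigma> \<le> M"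
  obtains s where "0 \<le> s" "s \<le> 1" "s * M = \<sigma>"
  using that[of "\<sigma> / M"] assms by auto

lemma splittable_equal:
  assumes k'a: "k' < a" and kk': "k = k'" and g: "0 < g" "g \<le> q" and n: "real n / q ^ a = \<beta>"
    and \<beta>: "g / q \<le> \<beta>" "\<beta> \<le> g / q + g / q * (1 - g / q)" and \<delta>: "\<beta> - g / q \<le> \<delta>" "\<delta> \<le> \<beta> - 1 / 4"
  shows "splittable q a k k' \<beta> \<delta>"
proof -
  define F where "F = (\<lambda>w::nat \<Rightarrow> nat. lo g (w 0) + (1 - lo g (w 0)) * lo g (w k))"
  have F: "event a F"
    unfolding F_def
    by (rule eventI, intro dep_add dep_mult dep_diff dep_const dep_lo)
      (use a k'a kk' in \<open>auto simp: lo_def\<close>)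
  have avgF: "avg q a F = g / q + g / q * (1 - g / q)"
  proof -
    have "avg q a (\<lambda>w. (1 - lo g (w 0)) * lo g (w k)) = (1 - g / q) * (g / q)"
      by (subst avg_letter) (use a k k'a kk' g q0 in \<open>auto simp: lmean_hi1 avg_lo\<close>)
    then show ?thesis using a g by (simp add: F_def avg_add avg_lo mult.commute)
  qed
  obtain B where B: "event a B" "\<And>w. lo g (w 0) \<le> B w \<and> B w \<le> F w" "avg q a B = \<beta>"
    using event_between[OF event_lo[of g] F _ q0, of n] avg_lo[OF a g(2)] avgF \<beta> n
    by (auto simp: F_def lo_def)
  have "w k < g" if "B w = 1" "\<not> w 0 < g" for w
    using B(2)[of w] that by (cases "w k < g") (auto simp: F_def lo_def)
  then show ?thesis using splittable_equal_steps[of B g \<beta> \<delta>] B g kk' \<delta> by blast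
qed

text \<open>The event "first letter below g, or letter k' at least g" has density
  \<open>1 - b * (1 - b) = b + (1 - b)^2\<close>. If \<open>\<beta>\<close> is at least this, B is
  chosen to contain it; below this threshold, for k distinct from k', B is chosen inside it. For k =
  k' below the threshold the high letter at k' is replaced by a low one, and there is room because
  \<open>(1 - b)^2 \<le> b * (1 - b)\<close>.\<close>

lemma splittable_top:
  assumes k'a: "k' < a" and g: "g \<le> q" "1 / 2 \<le> g / q" and n: "real n / q ^ a = \<beta>"
    and \<beta>: "g / q \<le> \<beta>" "\<beta> \<le> 1" and \<delta>: "0 \<le> \<delta>" "\<delta> \<le> \<beta> - 1 / 4"
  shows "splittable q a k k' \<beta> \<delta>"
proof -
  define b where "b = real g / q"
  have b: "1 / 2 \<le> b" "b \<le> 1" "b \<le> \<beta>" using g \<beta> q0 by (auto simp: b_def)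
  have g0: "0 < g" using g by (cases g) auto
  have br: "b * (1 - b) \<le> 1 / 4" by (rule prod_complement_le)
  consider "\<delta> \<le> b * \<beta>" | "b * \<beta> < \<delta>" "1 - \<beta> \<le> b * (1 - b)" | "b * \<beta> < \<delta>" "b * (1 - b) < 1 - \<beta>" "k = k'"
    | "b * \<beta> < \<delta>" "b * (1 - b) < 1 - \<beta>" "k \<noteq> k'" by linarith
  then show ?thesis
  proof cases
    case 1
    then show ?thesis using splittable_low[OF g0 g(1) n \<beta> \<delta>(1)] by (simp add: b_def)
  next
    case 2
    define F where "F = (\<lambda>w::nat \<Rightarrow> nat. 1 - (1 - lo g (w 0)) * lo g (w k'))"
    have F: "event a F"
      unfolding F_def
      by (rule eventI, intro dep_mult dep_diff dep_const dep_lo) (use a k'a in \<open>auto simp: lo_def\<close>)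
    have "avg q a (\<lambda>w. (1 - lo g (w 0)) * lo g (w k')) = (1 - b) * b"
      unfolding b_def by (subst avg_letter) (use a k' k'a g q0 in \<open>auto simp: lmean_hi1 avg_lo\<close>)
    then have avgF: "avg q a F = 1 - b * (1 - b)"
      using q0 by (simp add: F_def avg_diff avg_const mult.commute)
    obtain B where B: "event a B" "\<And>w. F w \<le> B w \<and> B w \<le> 1" "avg q a B = \<beta>"
      using event_between[OF F event_one _ q0, of n] avgF 2(2) \<beta> n q0
      by (auto simp: F_def lo_def avg_const)
    have full: "B w = 1" if "w 0 < g \<or> g \<le> w k'" for w
      using B(2)[of w] that by (auto simp: F_def lo_def)
    show ?thesis
    proof (rule splittable_full[OF B(1) g(1) B(3) k'a full])
      fix M assume M: "(1 - g / q) * \<beta> - (1 - \<beta>) \<le> M"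
      have "(1 - b) * \<beta> = \<beta> - b * \<beta>" by (simp add: algebra_simps)
      then have "\<delta> - b * \<beta> \<le> M" using M[folded b_def] \<delta>(2) 2(2) br by linarith
      then obtain s where s: "0 \<le> s" "s \<le> 1" "s * M = \<delta> - b * \<beta>"
        using scale_exists[of "\<delta> - b * \<beta>" M] 2(1) by auto
      have "\<delta> = b * \<beta> + s * M" using s(3) by simp
      moreover have "\<beta> - (b * \<beta> + s * M) - 1 / 4 \<le> (1 - s) * ((1 - b)\<^sup>2 * \<beta>) - s * (1 - s) * ((1 - b) * M)"
        using full_estimate[OF b(1,2) s(1,2) \<beta>(2) 2(2), of M] M by (simp add: b_def)
      ultimately show "\<exists>s. 0 \<le> s \<and> s \<le> 1 \<and> \<delta> = g / q * \<beta> + s * M \<and>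
        \<beta> - \<delta> - 1 / 4 \<le> (1 - s) * ((1 - g / q)\<^sup>2 * \<beta>) - s * (1 - s) * ((1 - g / q) * M)"
        using s(1,2) unfolding b_def by (intro exI[of _ s]) auto
    qed auto
  next
    case 3
    have sq: "(1 - b) * (1 - b) = 1 - b - b * (1 - b)" by (simp add: algebra_simps)
    have "(1 - b) * (1 - b) \<le> b * (1 - b)" using b by (intro mult_right_mono) auto
    moreover have "b * b \<le> b * \<beta>" using b by (intro mult_left_mono) auto
    moreover have "b * (1 - b) \<le> b * b" using b by (intro mult_left_mono) auto
    ultimately have "\<beta> \<le> b + b * (1 - b)" "\<beta> - b \<le> \<delta>"
      using 3(1,2) sq by linarith+
    then show ?thesis
      using splittable_equal[OF k'a 3(3) g0 g(1) n] \<beta>(1) \<delta>(2) by (simp add: b_def)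
  next
    case 4
    define \<tau> where "\<tau> = \<beta> - b"
    have \<tau>: "0 \<le> \<tau>" "\<tau> \<le> (1 - b)\<^sup>2"
      using b 4(2) by (auto simp: \<tau>_def power2_eq_square algebra_simps)
    obtain B where B: "event a B" "avg q a B = \<beta>" "\<And>w. lo g (w 0) \<le> B w"
        "\<And>w. B w = 1 \<Longrightarrow> \<not> w 0 < g \<Longrightarrow> \<not> w k' < g"
        "g / q * (\<beta> - g / q) \<le> E (\<lambda>w. (B w - lo g (w 0)) * lo g (w (k + k')))"
        "b * \<tau> \<le> E (\<lambda>w. (B w - lo g (w 0)) * lo g (w k))"
      using ex_sparse[OF k'a 4(3) g(1) n \<beta>(1)] \<tau> by (auto simp: b_def \<tau>_def)
    define \<mu> where "\<mu> = E (\<lambda>w. (B w - lo g (w 0)) * lo g (w k))"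
    \<comment> \<open>By \<open>b * (1 - b) \<le> 1/4\<close> one has \<open>\<delta> - b * \<beta>
      \<le> (1 - b) * (b + \<tau>) - 1/4 \<le> (1 - b) * \<tau>\<close>, and
      \<open>1 - b \<le> b\<close>.\<close>
    have "\<delta> - b * \<beta> \<le> b * \<tau>"
    proof -
      have "0 \<le> (b - (1 - b)) * \<tau>" using b \<tau> by (intro mult_nonneg_nonneg) auto
      then show ?thesis using \<delta>(2) br by (simp add: \<tau>_def algebra_simps)
    qed
    then have "\<delta> - b * \<beta> \<le> \<mu>" using B(6) by (simp add: \<mu>_def)
    then obtain s where s: "0 \<le> s" "s \<le> 1" "s * \<mu> = \<delta> - b * \<beta>"
      using scale_exists[of "\<delta> - b * \<beta>" \<mu>] 4(1) by auto
    show ?thesis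
    proof (rule splittable_sparse[where B = B and g = g and s = s and \<mu> = \<mu>])
      show "event a B" "avg q a B = \<beta>" "g \<le> q" "k' < a" "k \<noteq> k'" "0 \<le> s" "s \<le> 1"
        "g / q * (\<beta> - g / q) \<le> E (\<lambda>w. (B w - lo g (w 0)) * lo g (w (k + k')))"
        "E (\<lambda>w. (B w - lo g (w 0)) * lo g (w k)) = \<mu>"
        by (fact B g k'a 4 s \<mu>_def[symmetric])+
      show "lo g (w 0) \<le> B w" "B w = 1 \<Longrightarrow> \<not> w 0 < g \<Longrightarrow> \<not> w k' < g" for w
        by (fact B(3), fact B(4))
      show \<delta>: "\<delta> = g / q * \<beta> + s * \<mu>" using s(3) by (simp add: b_def)
      show "\<beta> - \<delta> - 1 / 4 \<le> (1 - s) * (g / q * (\<beta> - g / q) + (g / q)\<^sup>2 * (1 - g / q)\<^sup>2)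
        - s * (1 - s) * ((1 - g / q) * \<mu>)"
        using sparse_estimate[OF b(1,2) s(1,2) \<tau> B(6)[folded \<mu>_def]]
        unfolding \<delta> b_def[symmetric] by (simp add: \<tau>_def)
    qed
  qed
qed

lemma splittable_mid:
  assumes k'a: "k' < a" and g: "q = 2 * g + 1" and n: "real n / q ^ a = \<beta>"
    and \<beta>: "g / q \<le> \<beta>" "\<beta> \<le> (g + 1) / q" and \<delta>: "0 \<le> \<delta>" "\<delta> \<le> \<beta> - 1 / 4"
  shows "splittable q a k k' \<beta> \<delta>"
proof -
  define b where "b = real g / q"
  define lam where "lam = (real g + 1) / q"
  have g0: "0 < g" "g \<le> q" "g + 1 \<le> q" using q g by auto
  have lamb: "lam = 1 - b" using q0 g by (simp add: b_def lam_def field_simps)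
  have b: "1 / 3 \<le> b" "b \<le> 1 / 2" using g g0 by (auto simp: b_def field_simps)
  have lam: "1 / 2 \<le> lam" "lam \<le> 2 / 3" using b by (auto simp: lamb)
  have lam35: "lam \<le> 3 / 5" if "g \<noteq> 1" using that g g0 by (auto simp: lam_def field_simps)
  have lam23: "lam = 2 / 3" if "g = 1" using that g by (simp add: lam_def)
  have "b \<le> \<beta>" "\<beta> \<le> lam" using \<beta> by (auto simp: b_def lam_def add.commute)
  with lam have \<beta>': "b \<le> \<beta>" "\<beta> \<le> lam" "\<beta> \<le> 1" by auto
  have lo_le: "lo g x \<le> lo (g + 1) x" for x by (simp add: lo_def)
  show ?thesis
  proof (cases "\<delta> \<le> b * \<beta>")
    case True
    then show ?thesis using splittable_low[OF g0(1,2) n \<beta>(1) _ \<delta>(1)] \<beta>' by (simp add: b_def)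
  next
    case \<delta>b: False
    show ?thesis
    proof (cases "k < a")
      case False
      define \<tau> where "\<tau> = \<beta> - b"
      have "1 / real q \<le> 1 / 3" using g g0 by (simp add: field_simps)
      moreover have "lam - b = 1 / q" using q0 by (simp add: lam_def b_def field_simps)
      ultimately have \<tau>: "0 \<le> \<tau>" "\<tau> \<le> 1 / 3" using \<beta>' by (auto simp: \<tau>_def)
      obtain B where B: "event a B" "\<And>w. lo g (w 0) \<le> B w \<and> B w \<le> lo (g + 1) (w 0)" "avg q a B = \<beta>"
        using event_between[OF event_lo[of g] event_lo[of "g + 1"] lo_le q0, of n]
          avg_lo[OF a g0(2)] avg_lo[OF a g0(3)] \<beta> n by (auto simp: add.commute)
      have upper: "w 0 < g + 1" if "B w = 1" for w
        using B(2)[of w] that by (cases "w 0 < g + 1") (auto simp: lo_def)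
      have "\<delta> - b * \<beta> \<le> \<tau> * \<beta>"
        using \<delta>(2) square_bound[of \<beta>] by (simp add: \<tau>_def power2_eq_square algebra_simps)
      then obtain s where s: "0 \<le> s" "s \<le> 1" "s * (\<tau> * \<beta>) = \<delta> - b * \<beta>"
        using scale_exists[of "\<delta> - b * \<beta>" "\<tau> * \<beta>"] \<delta>b by auto
      show ?thesis
      proof (rule splittable_far[where B = B and g = g and g' = "g + 1" and s = s])
        show "event a B" "avg q a B = \<beta>" "g \<le> q" "g + 1 \<le> q" "k' < a" "0 \<le> s" "s \<le> 1"
          by (fact B g0 k'a s)+
        show "w 0 < g + 1" if "B w = 1" for w by (rule upper[OF that])
        show "lo g (w 0) \<le> B w" for w using B(2) by simp
        show "a \<le> k" using False by simp
        show \<delta>': "\<delta> = g / q * \<beta> + s * ((\<beta> - g / q) * \<beta>)" using s(3) by (simp add: \<tau>_def b_def)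
        have "1 - real (g + 1) / q = b" using lamb by (simp add: lam_def add.commute)
        then show "\<beta> - \<delta> - 1 / 4 \<le> (1 - s) * ((1 - g / q) * \<beta>)\<^sup>2 + s * ((1 - real (g + 1) / q) * \<beta>)\<^sup>2
          - s * (1 - s) * (\<beta> * (\<beta> - g / q)\<^sup>2)"
          using far_estimate[OF b(1) s(1,2) \<tau>] unfolding \<delta>' b_def[symmetric] by (simp add: \<tau>_def)
      qed
    next
      case ka: True
      show ?thesis
      proof (cases "lam * lam \<le> \<beta>")
        case True
        define C where "C = (\<lambda>w::nat \<Rightarrow> nat. lo (g + 1) (w 0) * lo (g + 1) (w k))"
        have C: "event a C"
          unfolding C_def by (rule eventI, intro dep_mult dep_lo) (use a ka in \<open>auto simp: lo_def\<close>)
        have "avg q a C = lam * lam"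
          unfolding C_def by (subst avg_letter) (use a k ka g0 in \<open>auto simp: lmean_lo avg_lo lam_def add.commute\<close>)
        moreover have "C w \<le> lo (g + 1) (w 0)" for w by (simp add: C_def lo_def)
        ultimately obtain B where B: "event a B" "\<And>w. C w \<le> B w \<and> B w \<le> lo (g + 1) (w 0)" "avg q a B = \<beta>"
          using event_between[OF C event_lo[of "g + 1"] _ q0, of n] avg_lo[OF a g0(3)] \<beta>'(2) True n
          by (auto simp: lam_def add.commute)
        have "\<delta> \<le> lam * \<beta>"
        proof -
          have "b * \<beta> \<le> b * (1 - b)" using b \<beta>' lamb by (intro mult_left_mono) auto
          then show ?thesis using \<delta>(2) prod_complement_le[of b] by (simp add: lamb algebra_simps)
        qed
        moreover have "0 < \<delta>" using \<delta>b mult_nonneg_nonneg[of b \<beta>] b \<beta>' by linarith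
        ultimately obtain t where t: "0 \<le> t" "t \<le> 1" "t * (lam * \<beta>) = \<delta>"
          using scale_exists[of \<delta> "lam * \<beta>"] by auto
        have \<beta>0: "0 < \<beta>" using b \<beta>' by simp
        \<comment> \<open>That the first stage is exhausted becomes, after division by
          \<open>\<beta>\<close>, the lower bound on u = t * lam in the window estimates.\<close>
        have "b * \<beta> < t * lam * \<beta>" using \<delta>b t(3) by (simp add: mult.assoc)
        then have u: "1 - lam \<le> t * lam" using \<beta>0 by (simp add: lamb)
        have u1: "t * lam \<le> 1 * 1" using t lam by (intro mult_mono) auto
        have lam': "lam = 2 / 3 \<or> lam \<le> 3 / 5" using lam35 lam23 by blast
        have lamq: "real (g + 1) / q = lam" by (simp add: lam_def add.commute)
        show ?thesis
        proof (rule splittable_window[OF B(1) _ g0(3) B(3) ka _ _ t(1,2)])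
          show "B w = 1" if "w 0 < g + 1" "w k < g + 1" for w
            using B(2)[of w] event_le1[OF B(1), of w] that by (simp add: C_def lo_def)
          show "w 0 < g + 1" if "B w = 1" for w
            using B(2)[of w] that by (cases "w 0 < g + 1") (auto simp: lo_def)
          show "\<delta> = t * (real (g + 1) / q * \<beta>)" unfolding lamq using t(3) by simp
          have \<delta>': "\<delta> = t * lam * \<beta>" using t(3) by simp
          show "\<beta> - \<delta> - 1 / 4 \<le> (1 - t * (real (g + 1) / q)) * \<beta>\<^sup>2
            - t * (real (g + 1) / q) * (real (g + 1) / q * ((1 - t * (real (g + 1) / q)) * \<beta>))"
            unfolding lamq \<delta>' using window_estimate_neq[OF lam(1) lam' u _ _ \<beta>'(2)] u1 \<beta>0 by simp
          show "\<beta> - \<delta> - 1 / 4 \<le> \<beta>\<^sup>2 - t * (real (g + 1) / q * (real (g + 1) / q * \<beta>))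
            - t * (real (g + 1) / q) * ((1 - t) * (real (g + 1) / q * \<beta>))"
            unfolding lamq \<delta>' using window_estimate_eq[OF lam u] \<beta>0 by simp
        qed simp
      next
        case False
        have "g = 1"
        proof (rule ccontr)
          assume "g \<noteq> 1"
          have "lam * lam \<le> b"
          proof -
            have "(1 - lam) - lam * lam = (3 / 5 - lam) * (lam + 8 / 5) + 1 / 25" by (simp add: algebra_simps) (simp add: field_simps)
            moreover have "0 \<le> (3 / 5 - lam) * (lam + 8 / 5)" using lam35[OF \<open>g \<noteq> 1\<close>] lam by simp
            ultimately show ?thesis using lamb by simp
          qed
          then show False using False \<beta>' by simp
        qed
        then have b3: "b = 1 / 3" "real g / q = 1 / 3" using g by (auto simp: b_def)
        have "lam = 2 / 3" using \<open>g = 1\<close> by (rule lam23)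
        define \<tau> where "\<tau> = \<beta> - 1 / 3"
        have \<tau>: "0 \<le> \<tau>" "\<tau> \<le> 1 / 9" using \<beta>' False b3 by (auto simp: \<tau>_def \<open>lam = 2 / 3\<close>)
        show ?thesis
        proof (cases "k = k'")
          case True
          have "b * b \<le> b * \<beta>" using b \<beta>' by (intro mult_left_mono) auto
          then have "\<beta> - 1 / 3 \<le> \<delta>" using \<delta>b \<tau> by (simp add: b3 \<tau>_def)
          then show ?thesis
            using splittable_equal[OF k'a True g0(1,2) n] \<beta>(1) \<tau> \<delta>(2) by (simp add: b3 \<tau>_def)
        next
          case kk': False
          \<comment> \<open>Since \<open>\<tau> \<le> 1/9\<close> is below
            \<open>b * (1 - b)^2 = 4/27\<close>, all words of B with high first letter can be low at
            k, so the correlation is \<open>\<tau>\<close> itself.\<close>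
          obtain B where B: "event a B" "avg q a B = \<beta>" "\<And>w. lo g (w 0) \<le> B w"
            "\<And>w. B w = 1 \<Longrightarrow> \<not> w 0 < g \<Longrightarrow> \<not> w k' < g"
            "g / q * (\<beta> - g / q) \<le> E (\<lambda>w. (B w - lo g (w 0)) * lo g (w (k + k')))"
            "E (\<lambda>w. (B w - lo g (w 0)) * lo g (w k)) = \<tau>"
            using ex_sparse[OF k'a kk' g0(2) n \<beta>(1)] ka \<tau> by (auto simp: b3 \<tau>_def power2_eq_square)
          have "\<delta> - b * \<beta> \<le> \<tau>" using \<delta>(2) \<tau> by (simp add: b3 \<tau>_def)
          then obtain s where s: "0 \<le> s" "s \<le> 1" "s * \<tau> = \<delta> - b * \<beta>"
            using scale_exists[of "\<delta> - b * \<beta>" \<tau>] \<delta>b by auto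
          show ?thesis
          proof (rule splittable_sparse[where B = B and g = g and s = s and \<mu> = \<tau>])
            show "event a B" "avg q a B = \<beta>" "g \<le> q" "k' < a" "k \<noteq> k'" "0 \<le> s" "s \<le> 1"
              "g / q * (\<beta> - g / q) \<le> E (\<lambda>w. (B w - lo g (w 0)) * lo g (w (k + k')))"
              "E (\<lambda>w. (B w - lo g (w 0)) * lo g (w k)) = \<tau>"
              by (fact B g0 k'a kk' s)+
            show "lo g (w 0) \<le> B w" "B w = 1 \<Longrightarrow> \<not> w 0 < g \<Longrightarrow> \<not> w k' < g" for w
              by (fact B(3), fact B(4))
            show \<delta>': "\<delta> = g / q * \<beta> + s * \<tau>" using s(3) by (simp add: b_def)
            show "\<beta> - \<delta> - 1 / 4 \<le> (1 - s) * (g / q * (\<beta> - g / q) + (g / q)\<^sup>2 * (1 - g / q)\<^sup>2)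
              - s * (1 - s) * ((1 - g / q) * \<tau>)"
              using ternary_estimate[OF s(1,2) \<tau>] unfolding \<delta>' b3 by (simp add: \<tau>_def)
          qed
        qed
      qed
    qed
  qed
qed

lemma splittable:
  assumes n: "n \<le> q ^ a" "real n / q ^ a = \<beta>" and \<delta>: "0 \<le> \<delta>" "\<delta> \<le> \<beta> - 1 / 4"
  shows "splittable q a k k' \<beta> \<delta>"
proof -
  define h where "h = q div 2"
  have \<beta>1: "\<beta> \<le> 1"
    using n q0 by (auto simp: divide_le_eq_1 simp flip: n(2))
  have h: "q = 2 * h \<or> q = 2 * h + 1" by (auto simp: h_def)
  show ?thesis
  proof (cases "k' < a")
    case False
    then show ?thesis using splittable_disjoint n \<delta> by simp
  next
    case k'a: True
    show ?thesis
    proof (cases "\<beta> \<le> h / q")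
      case True
      then show ?thesis using splittable_balanced[OF k'a _ n(2) True \<delta>] h by linarith
    next
      case high: False
      show ?thesis
        using h
      proof
        assume "q = 2 * h"
        then show ?thesis
          using splittable_top[OF k'a _ _ n(2) _ \<beta>1 \<delta>, of h] high q0 by simp
      next
        assume q2: "q = 2 * h + 1"
        show ?thesis
        proof (cases "\<beta> \<le> (h + 1) / q")
          case True
          then show ?thesis using splittable_mid[OF k'a q2 n(2) _ _ \<delta>] high by (simp add: add.commute)
        next
          case False
          have "h + 1 \<le> q" "1 / 2 \<le> real (h + 1) / q" using q2 q by (auto simp: field_simps)
          then show ?thesis
            using splittable_top[OF k'a _ _ n(2) _ \<beta>1 \<delta>, of "h + 1"] False by (simp add: add.commute)
        qed
      qed
    qed
  qed
qed

end

section \<open>Rounding\<close>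

text \<open>C stands for the long words, p and s for their prefix and suffix of the middle length, u
  and v for membership of their ends in B.\<close>

definition bilin :: "'c set \<Rightarrow> ('c \<Rightarrow> 'x) \<Rightarrow> ('c \<Rightarrow> 'x) \<Rightarrow> ('c \<Rightarrow> real) \<Rightarrow> ('c \<Rightarrow> real) \<Rightarrow> ('x \<Rightarrow> real) \<Rightarrow> real" where
  "bilin C p s u v \<alpha> = (\<Sum>w\<in>C. (u w - \<alpha> (p w)) * (v w - \<alpha> (s w)))"

text \<open>The coefficient of \<open>\<epsilon>^2\<close> in \<open>bilin\<close> when weight
  \<open>\<epsilon>\<close> is moved from y to x.\<close>

definition curvature :: "'c set \<Rightarrow> ('c \<Rightarrow> 'x) \<Rightarrow> ('c \<Rightarrow> 'x) \<Rightarrow> 'x \<Rightarrow> 'x \<Rightarrow> real" where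
  "curvature C p s x y = (\<Sum>w\<in>C. (of_bool (p w = x) - of_bool (p w = y)) * (of_bool (s w = x) - of_bool (s w = y)))"

definition fractional :: "'x set \<Rightarrow> ('x \<Rightarrow> real) \<Rightarrow> 'x set" where
  "fractional X \<alpha> = {x \<in> X. 0 < \<alpha> x \<and> \<alpha> x < 1}"

lemma bilin_move:
  assumes "x \<noteq> y"
  shows "\<exists>L. \<forall>\<epsilon>. bilin C p s u v (\<alpha>(x := \<alpha> x + \<epsilon>, y := \<alpha> y - \<epsilon>))
    = bilin C p s u v \<alpha> + \<epsilon> * L + \<epsilon>\<^sup>2 * curvature C p s x y"
proof -
  let ?e = "\<lambda>z. of_bool (z = x) - of_bool (z = y) :: real"
  let ?L = "\<Sum>w\<in>C. - ?e (p w) * (v w - \<alpha> (s w)) - (u w - \<alpha> (p w)) * ?e (s w)"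
  have move: "(\<alpha>(x := \<alpha> x + \<epsilon>, y := \<alpha> y - \<epsilon>)) z = \<alpha> z + \<epsilon> * ?e z" for \<epsilon> z
    using assms by simp
  have "bilin C p s u v (\<alpha>(x := \<alpha> x + \<epsilon>, y := \<alpha> y - \<epsilon>))
    = bilin C p s u v \<alpha> + \<epsilon> * ?L + \<epsilon>\<^sup>2 * curvature C p s x y" for \<epsilon>
    unfolding bilin_def move curvature_def sum_distrib_left sum.distrib[symmetric]
    by (intro sum.cong refl) (simp add: power2_eq_square algebra_simps)
  then show ?thesis by blast
qed

text \<open>Along the segment between the two extreme positions \<^term>\<open>- l\<close> and \<^term>\<open>h\<close> of the move, the
  average of the end values with weights \<^term>\<open>h\<close> and \<^term>\<open>l\<close> exceeds the value at 0 by \<^term>\<open>l * h\<close> times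
  the curvature.\<close>

lemma pipage_step:
  assumes X: "finite X" and \<alpha>: "\<And>z. z \<in> X \<Longrightarrow> 0 \<le> \<alpha> z \<and> \<alpha> z \<le> 1"
    and xy: "x \<in> fractional X \<alpha>" "y \<in> fractional X \<alpha>" "x \<noteq> y" and Q: "-2 \<le> curvature C p s x y"
  shows "\<exists>\<alpha>'. (\<forall>z\<in>X. 0 \<le> \<alpha>' z \<and> \<alpha>' z \<le> 1) \<and> sum \<alpha>' X = sum \<alpha> X \<and>
    (\<forall>z\<in>X. \<alpha> z = 0 \<longrightarrow> \<alpha>' z = 0) \<and> fractional X \<alpha>' \<subset> fractional X \<alpha> \<and>
    (0 \<le> curvature C p s x y \<longrightarrow> bilin C p s u v \<alpha> \<le> bilin C p s u v \<alpha>') \<and>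
    bilin C p s u v \<alpha> - 1 / 2 \<le> bilin C p s u v \<alpha>' \<and>
    (\<alpha> x + \<alpha> y \<noteq> 1 \<longrightarrow> bilin C p s u v \<alpha> - 1 / 2 < bilin C p s u v \<alpha>')"
proof -
  define l where "l = min (\<alpha> x) (1 - \<alpha> y)"
  define h where "h = min (1 - \<alpha> x) (\<alpha> y)"
  have fx: "0 < \<alpha> x" "\<alpha> x < 1" "0 < \<alpha> y" "\<alpha> y < 1" "x \<in> X" "y \<in> X" using xy by (auto simp: fractional_def)
  have lh: "0 < l" "0 < h" using fx by (auto simp: l_def h_def)
  define F where "F \<epsilon> = bilin C p s u v (\<alpha>(x := \<alpha> x + \<epsilon>, y := \<alpha> y - \<epsilon>))" for \<epsilon>
  define Q where "Q = curvature C p s x y"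
  obtain L where L: "\<And>\<epsilon>. F \<epsilon> = F 0 + \<epsilon> * L + \<epsilon>\<^sup>2 * Q"
    using bilin_move[OF xy(3), of C p s u v \<alpha>] by (auto simp: F_def Q_def)
  have F0: "F 0 = bilin C p s u v \<alpha>" by (simp add: F_def)
  have "h * F (- l) + l * F h = (l + h) * (F 0 + l * h * Q)"
    unfolding L[of "- l"] L[of h] by (simp add: power2_eq_square algebra_simps)
  moreover have "h * F (- l) + l * F h \<le> h * max (F (- l)) (F h) + l * max (F (- l)) (F h)"
    using lh by (intro add_mono mult_left_mono) auto
  then have "h * F (- l) + l * F h \<le> (l + h) * max (F (- l)) (F h)"
    by (simp only: distrib_right add.commute)
  ultimately have "F 0 + l * h * Q \<le> max (F (- l)) (F h)"
    using lh by (metis add_pos_pos mult_le_cancel_left_pos)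
  then obtain \<epsilon> where \<epsilon>: "\<epsilon> = - l \<or> \<epsilon> = h" "F 0 + l * h * Q \<le> F \<epsilon>"
    by (metis max_def)
  \<comment> \<open>The product l * h is at most z(1 - z) for both values z, so it reaches 1/4 only
    if both are 1/2. With curvature at least -2 a step loses at most 1/2, and less if the two values
    do not add up to 1.\<close>
  have lhx: "l * h \<le> \<alpha> x * (1 - \<alpha> x)" "l * h \<le> \<alpha> y * (1 - \<alpha> y)"
    using fx lh mult_mono[of l "\<alpha> x" h "1 - \<alpha> x"] mult_mono[of h "\<alpha> y" l "1 - \<alpha> y"]
    by (auto simp: l_def h_def mult.commute)
  then have lh4: "l * h \<le> 1 / 4" using prod_complement_le[of "\<alpha> x"] by linarith
  have lh4': "l * h < 1 / 4" if "\<alpha> x + \<alpha> y \<noteq> 1"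
  proof -
    have strict: "z * (1 - z) < 1 / 4" if "z \<noteq> 1 / 2" for z :: real
      using zero_less_power2[of "z - 1 / 2"] that by (simp add: power2_eq_square algebra_simps)
    have "\<alpha> x \<noteq> 1 / 2 \<or> \<alpha> y \<noteq> 1 / 2" using that by auto
    then show ?thesis using lhx strict by (meson le_less_trans)
  qed
  have lhQ: "l * h * (-2) \<le> l * h * Q" using assms(6) lh by (intro mult_left_mono) (auto simp: Q_def)
  define \<alpha>' where "\<alpha>' = \<alpha>(x := \<alpha> x + \<epsilon>, y := \<alpha> y - \<epsilon>)"
  have F\<epsilon>: "F \<epsilon> = bilin C p s u v \<alpha>'" by (simp add: F_def \<alpha>'_def)
  have z: "\<alpha>' x = \<alpha> x + \<epsilon>" "\<alpha>' y = \<alpha> y - \<epsilon>" "\<And>z. z \<noteq> x \<Longrightarrow> z \<noteq> y \<Longrightarrow> \<alpha>' z = \<alpha> z"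
    using xy(3) by (auto simp: \<alpha>'_def)
  have b: "0 \<le> \<alpha>' x" "\<alpha>' x \<le> 1" "0 \<le> \<alpha>' y" "\<alpha>' y \<le> 1"
    using \<epsilon>(1) fx unfolding z l_def h_def by (auto simp: min_def)
  have e: "\<alpha>' x = 0 \<or> \<alpha>' x = 1 \<or> \<alpha>' y = 0 \<or> \<alpha>' y = 1"
  proof -
    have "l = \<alpha> x \<and> h = \<alpha> y \<or> l = 1 - \<alpha> y \<and> h = 1 - \<alpha> x" by (auto simp: l_def h_def min_def)
    then show ?thesis using \<epsilon>(1) unfolding z by auto
  qed
  show ?thesis
  proof (intro exI[of _ \<alpha>'] conjI ballI impI)
    fix t assume "t \<in> X"
    then show "0 \<le> \<alpha>' t" "\<alpha>' t \<le> 1"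
      using b z(3)[of t] \<alpha>[of t] by (cases "t = x \<or> t = y"; auto)+
  next
    have "sum \<alpha>' X = (\<Sum>z\<in>X. \<alpha> z + (if z = x then \<epsilon> else 0) - (if z = y then \<epsilon> else 0))"
      using z xy(3) by (intro sum.cong refl) auto
    then show "sum \<alpha>' X = sum \<alpha> X"
      using X fx by (simp add: sum.distrib sum_subtractf)
  next
    fix t assume "t \<in> X" "\<alpha> t = 0"
    then show "\<alpha>' t = 0" using fx z(3)[of t] by force
  next
    have "fractional X \<alpha>' \<subseteq> fractional X \<alpha>"
    proof
      fix t assume "t \<in> fractional X \<alpha>'"
      then show "t \<in> fractional X \<alpha>" using fx z(3)[of t] by (cases "t = x \<or> t = y") (auto simp: fractional_def)
    qed
    moreover have "x \<notin> fractional X \<alpha>' \<or> y \<notin> fractional X \<alpha>'" using e by (auto simp: fractional_def)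
    ultimately show "fractional X \<alpha>' \<subset> fractional X \<alpha>" using xy by blast
  next
    assume "0 \<le> curvature C p s x y"
    then have "0 \<le> l * h * Q" using lh by (simp add: Q_def)
    then show "bilin C p s u v \<alpha> \<le> bilin C p s u v \<alpha>'" using \<epsilon>(2) F0 F\<epsilon> by linarith
  next
    show "bilin C p s u v \<alpha> - 1 / 2 \<le> bilin C p s u v \<alpha>'"
      using \<epsilon>(2) F0 F\<epsilon> lhQ lh4 by linarith
  next
    assume "\<alpha> x + \<alpha> y \<noteq> 1"
    then show "bilin C p s u v \<alpha> - 1 / 2 < bilin C p s u v \<alpha>'"
      using \<epsilon>(2) F0 F\<epsilon> lhQ lh4' by linarith
  qed
qed

lemma not_int_between: "x = real_of_int i \<Longrightarrow> 0 < x \<Longrightarrow> x < 1 \<Longrightarrow> False"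
  by simp

lemma sum_fractional:
  assumes X: "finite X" and \<alpha>: "\<And>z. z \<in> X \<Longrightarrow> 0 \<le> \<alpha> z \<and> \<alpha> z \<le> 1" and m: "sum \<alpha> X = real m"
  shows "sum \<alpha> (fractional X \<alpha>) = real m - real (card {x \<in> X. \<alpha> x = 1})"
proof -
  let ?O = "{x \<in> X. \<alpha> x = 1}"
  have "sum \<alpha> X = sum \<alpha> (fractional X \<alpha> \<union> ?O)"
    using X \<alpha> by (intro sum.mono_neutral_right) (force simp: fractional_def)+
  also have "\<dots> = sum \<alpha> (fractional X \<alpha>) + sum \<alpha> ?O"
    using X by (intro sum.union_disjoint) (auto simp: fractional_def)
  finally show ?thesis using m by simp
qed

text \<open>Pipage rounding. While four values are fractional, some pair has nonnegative curvature
  and the step loses nothing. With three left, two of them cannot add up to 1, since the total is an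
  integer and the third is not; so this step loses less than 1/2. With two left at most 1/2 is lost,
  and a single fractional value is impossible.\<close>

lemma pipage:
  assumes X: "finite X" and \<alpha>: "\<And>z. z \<in> X \<Longrightarrow> 0 \<le> \<alpha> z \<and> \<alpha> z \<le> 1" and m: "sum \<alpha> X = real m"
    and ps: "\<And>w. w \<in> C \<Longrightarrow> p w \<in> X \<and> s w \<in> X"
    and Q2: "\<And>x y. x \<noteq> y \<Longrightarrow> -2 \<le> curvature C p s x y"
    and Q4: "\<And>S. S \<subseteq> X \<Longrightarrow> card S = 4 \<Longrightarrow> \<exists>x\<in>S. \<exists>y\<in>S. x \<noteq> y \<and> 0 \<le> curvature C p s x y"
  shows "\<exists>A\<subseteq>{x \<in> X. \<alpha> x \<noteq> 0}. card A = m \<and>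
    bilin C p s u v \<alpha> - 1 < bilin C p s u v (\<lambda>x. of_bool (x \<in> A) :: real)"
proof -
  have fin: "finite (fractional X \<alpha>)" for \<alpha> using X by (simp add: fractional_def)
  let ?F = "bilin C p s u v"
  \<comment> \<open>The claim is graded by the number of fractional values, because the total of
    less than 1 is shared by the last two lossy steps. \<open>\<beta>\<close> agrees with the
    indicator of A on X only.\<close>
  have "\<exists>A\<subseteq>{x \<in> X. \<alpha> x \<noteq> 0}. card A = m \<and> (\<exists>\<beta>. (\<forall>x\<in>X. \<beta> x = of_bool (x \<in> A)) \<and> ?F \<alpha> - 1 < ?F \<beta> \<and>
    (card (fractional X \<alpha>) \<le> 2 \<longrightarrow> ?F \<alpha> - 1 / 2 \<le> ?F \<beta>) \<and> (card (fractional X \<alpha>) \<le> 1 \<longrightarrow> ?F \<alpha> \<le> ?F \<beta>))"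
    using \<alpha> m
  proof (induction "card (fractional X \<alpha>)" arbitrary: \<alpha> rule: less_induct)
    case less
    note frac = sum_fractional[OF X less.prems]
    have step: "\<exists>A\<subseteq>{x \<in> X. \<alpha> x \<noteq> 0}. card A = m \<and> (\<exists>\<beta>. (\<forall>x\<in>X. \<beta> x = of_bool (x \<in> A)) \<and> ?F \<alpha>' - 1 < ?F \<beta> \<and>
        (card (fractional X \<alpha>') \<le> 2 \<longrightarrow> ?F \<alpha>' - 1 / 2 \<le> ?F \<beta>) \<and> (card (fractional X \<alpha>') \<le> 1 \<longrightarrow> ?F \<alpha>' \<le> ?F \<beta>))"
      if "\<And>z. z \<in> X \<Longrightarrow> 0 \<le> \<alpha>' z \<and> \<alpha>' z \<le> 1" "sum \<alpha>' X = sum \<alpha> X" "\<And>z. z \<in> X \<Longrightarrow> \<alpha> z = 0 \<Longrightarrow> \<alpha>' z = 0"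
        "fractional X \<alpha>' \<subset> fractional X \<alpha>" for \<alpha>'
    proof -
      have "card (fractional X \<alpha>') < card (fractional X \<alpha>)" by (rule psubset_card_mono[OF fin that(4)])
      from less.hyps[OF this that(1)] that(2) less.prems(2)
      obtain A \<beta> where A: "A \<subseteq> {x \<in> X. \<alpha>' x \<noteq> 0}" "card A = m" "\<forall>x\<in>X. \<beta> x = of_bool (x \<in> A)" "?F \<alpha>' - 1 < ?F \<beta>"
        "card (fractional X \<alpha>') \<le> 2 \<longrightarrow> ?F \<alpha>' - 1 / 2 \<le> ?F \<beta>" "card (fractional X \<alpha>') \<le> 1 \<longrightarrow> ?F \<alpha>' \<le> ?F \<beta>"
        by auto
      have "A \<subseteq> {x \<in> X. \<alpha> x \<noteq> 0}" using A(1) that(3) by auto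
      then show ?thesis using A by blast
    qed
    have lt: "card (fractional X \<alpha>') < card (fractional X \<alpha>)" if "fractional X \<alpha>' \<subset> fractional X \<alpha>" for \<alpha>'
      by (rule psubset_card_mono[OF fin that])
    consider "card (fractional X \<alpha>) = 0" | "card (fractional X \<alpha>) = 1" | "card (fractional X \<alpha>) = 2"
      | "card (fractional X \<alpha>) = 3" | "4 \<le> card (fractional X \<alpha>)" by linarith
    then show ?case
    proof cases
      case 1
      then have f0: "fractional X \<alpha> = {}" using fin by auto
      let ?A = "{x \<in> X. \<alpha> x = 1}"
      have "card ?A = m" using frac f0 by simp
      moreover have "\<forall>x\<in>X. \<alpha> x = of_bool (x \<in> ?A)"
        using f0 less.prems(1) by (force simp: fractional_def)
      ultimately show ?thesis by (intro exI[of _ ?A]) (auto intro!: exI[of _ \<alpha>])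
    next
      case 2
      then obtain x where x: "fractional X \<alpha> = {x}" by (auto simp: card_1_singleton_iff)
      then have "\<alpha> x = real m - real (card {x \<in> X. \<alpha> x = 1})" using frac by simp
      also have "\<dots> = real_of_int (int m - int (card {x \<in> X. \<alpha> x = 1}))" by simp
      finally have "\<alpha> x = real_of_int (int m - int (card {x \<in> X. \<alpha> x = 1}))" .
      moreover have "0 < \<alpha> x" "\<alpha> x < 1" using x by (auto simp: fractional_def)
      ultimately show ?thesis using not_int_between by blast
    next
      case 3
      then obtain x y where xy: "fractional X \<alpha> = {x, y}" "x \<noteq> y" by (auto simp: card_2_iff)
      have frac_xy: "x \<in> fractional X \<alpha>" "y \<in> fractional X \<alpha>" by (simp_all add: xy(1))
      obtain \<alpha>' where \<alpha>': "\<And>z. z \<in> X \<Longrightarrow> 0 \<le> \<alpha>' z \<and> \<alpha>' z \<le> 1" "sum \<alpha>' X = sum \<alpha> X" "\<And>z. z \<in> X \<Longrightarrow> \<alpha> z = 0 \<Longrightarrow> \<alpha>' z = 0"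
        "fractional X \<alpha>' \<subset> fractional X \<alpha>" "?F \<alpha> - 1 / 2 \<le> ?F \<alpha>'"
        using pipage_step[where \<alpha> = \<alpha> and x = x and y = y and C = C and p = p and s = s and u = u and v = v,
            OF X less.prems(1) frac_xy xy(2) Q2[OF xy(2)]]  by blast
      have "card (fractional X \<alpha>') \<le> 1" using lt[OF \<alpha>'(4)] 3 by simp
      with step[OF \<alpha>'(1-4)] obtain A \<beta> where "A \<subseteq> {x \<in> X. \<alpha> x \<noteq> 0}" "card A = m" "\<forall>x\<in>X. \<beta> x = of_bool (x \<in> A)" "?F \<alpha>' \<le> ?F \<beta>"
        by blast
      then show ?thesis using 3 \<alpha>'(5) by (intro exI[of _ A]) (auto intro!: exI[of _ \<beta>])
    next
      case 4
      then obtain x y z where xyz: "fractional X \<alpha> = {x, y, z}" "x \<noteq> y" "x \<noteq> z" "y \<noteq> z"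
        by (auto simp: card_3_iff)
      have "\<alpha> x + \<alpha> y \<noteq> 1"
      proof
        assume "\<alpha> x + \<alpha> y = 1"
        then have "\<alpha> z = real_of_int (int m - int (card {x \<in> X. \<alpha> x = 1}) - 1)"
          using frac xyz by simp
        moreover have "0 < \<alpha> z" "\<alpha> z < 1" using xyz(1) by (auto simp: fractional_def)
        ultimately show False using not_int_between by blast
      qed
      note ne = this
      have frac_xy: "x \<in> fractional X \<alpha>" "y \<in> fractional X \<alpha>" by (simp_all add: xyz(1))
      obtain \<alpha>' where \<alpha>': "\<And>z. z \<in> X \<Longrightarrow> 0 \<le> \<alpha>' z \<and> \<alpha>' z \<le> 1" "sum \<alpha>' X = sum \<alpha> X" "\<And>z. z \<in> X \<Longrightarrow> \<alpha> z = 0 \<Longrightarrow> \<alpha>' z = 0"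
        "fractional X \<alpha>' \<subset> fractional X \<alpha>" "?F \<alpha> - 1 / 2 < ?F \<alpha>'"
        using pipage_step[where \<alpha> = \<alpha> and x = x and y = y and C = C and p = p and s = s and u = u and v = v,
            OF X less.prems(1) frac_xy xyz(2) Q2[OF xyz(2)]] ne by blast
      have "card (fractional X \<alpha>') \<le> 2" using lt[OF \<alpha>'(4)] 4 by simp
      with step[OF \<alpha>'(1-4)] obtain A \<beta> where "A \<subseteq> {x \<in> X. \<alpha> x \<noteq> 0}" "card A = m" "\<forall>x\<in>X. \<beta> x = of_bool (x \<in> A)" "?F \<alpha>' - 1 / 2 \<le> ?F \<beta>"
        by blast
      then show ?thesis using 4 \<alpha>'(5) by (intro exI[of _ A]) (auto intro!: exI[of _ \<beta>])
    next
      case 5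
      then obtain S where S: "S \<subseteq> fractional X \<alpha>" "card S = 4" by (metis obtain_subset_with_card_n)
      then obtain x y where xy: "x \<in> S" "y \<in> S" "x \<noteq> y" "0 \<le> curvature C p s x y"
        using Q4[of S] by (auto simp: fractional_def)
      have frac_xy: "x \<in> fractional X \<alpha>" "y \<in> fractional X \<alpha>" using xy S(1) by auto
      obtain \<alpha>' where \<alpha>': "\<And>z. z \<in> X \<Longrightarrow> 0 \<le> \<alpha>' z \<and> \<alpha>' z \<le> 1" "sum \<alpha>' X = sum \<alpha> X" "\<And>z. z \<in> X \<Longrightarrow> \<alpha> z = 0 \<Longrightarrow> \<alpha>' z = 0"
        "fractional X \<alpha>' \<subset> fractional X \<alpha>" "?F \<alpha> \<le> ?F \<alpha>'"
        using pipage_step[where \<alpha> = \<alpha> and x = x and y = y and C = C and p = p and s = s and u = u and v = v,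
            OF X less.prems(1) frac_xy xy(3) Q2[OF xy(3)]] xy(4) by blast
      with step[OF \<alpha>'(1-4)] obtain A \<beta> where "A \<subseteq> {x \<in> X. \<alpha> x \<noteq> 0}" "card A = m" "\<forall>x\<in>X. \<beta> x = of_bool (x \<in> A)" "?F \<alpha>' - 1 < ?F \<beta>"
        by blast
      then show ?thesis using 5 \<alpha>'(5) by (intro exI[of _ A]) (auto intro!: exI[of _ \<beta>])
    qed
  qed
  then obtain A \<beta> where A: "A \<subseteq> {x \<in> X. \<alpha> x \<noteq> 0}" "card A = m" "\<forall>x\<in>X. \<beta> x = of_bool (x \<in> A)" "?F \<alpha> - 1 < ?F \<beta>"
    by blast
  have "?F \<beta> = ?F (\<lambda>x. of_bool (x \<in> A))"
    unfolding bilin_def using A(3) ps by (intro sum.cong refl) auto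
  then show ?thesis using A by metis
qed

section \<open>Overlaps of words\<close>

text \<open>Draw an arrow from x to y if T x = H y. Two arrows from x to y and z would give H y = H
  z, and the arrow between y and z would then yield T y = H y or T z = H z. So every vertex has at
  most one outgoing arrow, while four vertices need at least six arrows.\<close>

lemma no_four_consecutive:
  assumes "H x \<noteq> T x" "H y \<noteq> T y" "H z \<noteq> T z" "H t \<noteq> T t"
    and "T x = H y \<or> T y = H x" "T x = H z \<or> T z = H x" "T x = H t \<or> T t = H x"
    and "T y = H z \<or> T z = H y" "T y = H t \<or> T t = H y" "T z = H t \<or> T t = H z"
  shows False
  using assms by metis

definition overlaps :: "nat \<Rightarrow> nat \<Rightarrow> nat \<Rightarrow> (nat \<Rightarrow> nat) \<Rightarrow> (nat \<Rightarrow> nat) \<Rightarrow> real" where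
  "overlaps q b d x y = (\<Sum>w\<in>words q (b + d). of_bool (restr b w = x \<and> shift d w = y))"

lemma curvature_overlaps:
  "curvature (words q (b + d)) (restr b) (shift d) x y
    = overlaps q b d x x + overlaps q b d y y - overlaps q b d x y - overlaps q b d y x"
  unfolding curvature_def overlaps_def
  by (simp add: left_diff_distrib right_diff_distrib sum_subtractf sum.distrib flip: of_bool_conj)

text \<open>For d <= b a prefix and a suffix of length b cover the whole word, so they determine it,
  and it exists exactly if they agree on the common part.\<close>

lemma overlaps_eq:
  assumes "d \<le> b" "x \<in> words q b" "y \<in> words q b"
  shows "overlaps q b d x y = of_bool (shift d x = restr (b - d) y)"
proof -
  define w where "w = (\<lambda>i. if i < b then x i else y (i - d))"
  have w: "w \<in> words q (b + d)" using assms by (auto simp: words_def w_def)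
  have uniq: "v = w" if "restr b v = x" "shift d v = y" for v
  proof
    fix i show "v i = w i"
      using fun_cong[OF that(1), of i] fun_cong[OF that(2), of "i - d"] assms(1)
      by (auto simp: w_def restr_def shift_def split: if_splits)
  qed
  have ex: "restr b w = x \<and> shift d w = y" if "shift d x = restr (b - d) y"
  proof (intro conjI ext)
    fix i
    show "restr b w i = x i" using assms(2) by (simp add: w_def restr_def words_def)
    show "shift d w i = y i"
      using fun_cong[OF that, of i] assms by (auto simp: w_def shift_def restr_def words_def)
  qed
  have ex': "shift d x = restr (b - d) y" if "restr b v = x" "shift d v = y" for v
    unfolding that[symmetric] by (auto simp: restr_def shift_def fun_eq_iff)
  show ?thesis
  proof (cases "shift d x = restr (b - d) y")
    case True
    have "overlaps q b d x y = (\<Sum>v\<in>words q (b + d). of_bool (v = w))"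
      unfolding overlaps_def by (intro sum.cong refl arg_cong[where f = of_bool]) (use ex[OF True] uniq in auto)
    also have "\<dots> = 1" using w by (simp add: of_bool_def)
    finally show ?thesis using True by simp
  next
    case False
    then have "overlaps q b d x y = 0"
      unfolding overlaps_def using ex' by (intro sum.neutral) auto
    then show ?thesis using False by simp
  qed
qed

lemma overlaps_outside:
  assumes "x \<notin> words q b \<or> y \<notin> words q b"
  shows "overlaps q b d x y = 0"
  unfolding overlaps_def
proof (rule sum.neutral, rule ballI)
  fix w assume "w \<in> words q (b + d)"
  then have "restr b w \<in> words q b" "shift d w \<in> words q b" by (auto simp: words_def restr_def shift_def)
  then show "of_bool (restr b w = x \<and> shift d w = y) = (0 :: real)" using assms by auto
qed

lemma overlaps_bounds:
  assumes "d \<le> b"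
  shows "0 \<le> overlaps q b d x y" "overlaps q b d x y \<le> 1"
  using overlaps_eq[OF assms, of x q y] overlaps_outside[of x q b y d]
  by (cases "x \<in> words q b \<and> y \<in> words q b"; auto)+

context three_lengths
begin

lemma ex_sets:
  assumes n: "n \<le> q ^ a" "real n / q ^ a = \<beta>"
    and m: "real m / q ^ (a + k) = \<delta>" "\<delta> \<le> \<beta> - 1 / 4"
  shows "\<exists>B A. event a B \<and> avg q a B = \<beta> \<and> A \<subseteq> {x \<in> words q (a + k). B x = 1 \<and> B (shift k x) = 1} \<and> card A = m \<and>
    (\<beta> - \<delta> - 1 / 4) * q ^ (a + k + k') - 1 <
      card {w \<in> words q (a + k + k'). B w = 1 \<and> B (shift (k + k') w) = 1 \<and> restr (a + k) w \<notin> A \<and> shift k' w \<notin> A}"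
proof -
  let ?b = "a + k" and ?C = "words q (a + k + k')"
  have qpos: "0 < real q ^ j" for j using q0 by simp
  have \<delta>0: "0 \<le> \<delta>" using m(1) by (auto simp flip: m(1))
  obtain B \<alpha> where B: "event a B" "avg q a B = \<beta>" and \<alpha>: "dep {..<?b} \<alpha>"
    "\<And>w. 0 \<le> \<alpha> w \<and> \<alpha> w \<le> B w * B (shift k w)" "avg q ?b \<alpha> = \<delta>"
    "\<beta> - \<delta> - 1 / 4 \<le> E (\<lambda>w. (B w - \<alpha> w) * (B (shift (k + k') w) - \<alpha> (shift k' w)))"
    using splittable[OF n \<delta>0 m(2)] unfolding splittable_def by blast
  note B01 = event_01[OF B(1)]
  note dB = event_dep[OF B(1)]
  have sum\<alpha>: "sum \<alpha> (words q ?b) = real m"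
    using \<alpha>(3) m(1) qpos[of ?b] by (auto simp: avg_def field_simps simp flip: m(1))
  have supp: "B w = 1 \<and> B (shift k w) = 1" if "\<alpha> w \<noteq> 0" for w
    using \<alpha>(2)[of w] that B01[of w] B01[of "shift k w"] by auto
  have \<alpha>1: "\<alpha> w \<le> 1" for w
    using \<alpha>(2)[of w] B01[of w] B01[of "shift k w"] by auto
  have in_words: "restr ?b w \<in> words q ?b" "shift k' w \<in> words q ?b" if "w \<in> ?C" for w
    using that by (auto simp: words_def restr_def shift_def)
  have Brestr: "B (restr ?b w) = B w" for w
    by (rule depD[OF dB]) (simp add: restr_def)
  let ?F = "bilin ?C (restr ?b) (shift k') B (\<lambda>w. B (shift (k + k') w))"
  have F\<alpha>: "(\<beta> - \<delta> - 1 / 4) * q ^ (a + k + k') \<le> ?F \<alpha>"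
  proof -
    have "?F \<alpha> = E (\<lambda>w. (B w - \<alpha> w) * (B (shift (k + k') w) - \<alpha> (shift k' w))) * q ^ (a + k + k')"
      using q0 dep_restr[OF \<alpha>(1)] by (simp add: bilin_def avg_def)
    then show ?thesis using \<alpha>(4) by (simp add: mult_right_mono)
  qed
  have FA: "?F (\<lambda>x. of_bool (x \<in> A)) =
      card {w \<in> ?C. B w = 1 \<and> B (shift (k + k') w) = 1 \<and> restr ?b w \<notin> A \<and> shift k' w \<notin> A}"
    if A: "A \<subseteq> {x \<in> words q ?b. B x = 1 \<and> B (shift k x) = 1}" for A
  proof -
    have "?F (\<lambda>x. of_bool (x \<in> A)) = (\<Sum>w\<in>?C. of_bool (B w = 1 \<and> B (shift (k + k') w) = 1 \<and> restr ?b w \<notin> A \<and> shift k' w \<notin> A))"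
      unfolding bilin_def
    proof (intro sum.cong refl)
      fix w
      have "B w = 1" if "restr ?b w \<in> A" using that A Brestr by auto
      moreover have "B (shift (k + k') w) = 1" if "shift k' w \<in> A"
        using that A by (auto simp: shift_shift add.commute)
      ultimately show "(B w - of_bool (restr ?b w \<in> A)) * (B (shift (k + k') w) - of_bool (shift k' w \<in> A))
        = of_bool (B w = 1 \<and> B (shift (k + k') w) = 1 \<and> restr ?b w \<notin> A \<and> shift k' w \<notin> A)"
        using B01[of w] B01[of "shift (k + k') w"] by auto
    qed
    also have "\<dots> = card {w \<in> ?C. B w = 1 \<and> B (shift (k + k') w) = 1 \<and> restr ?b w \<notin> A \<and> shift k' w \<notin> A}"
      by (simp add: of_bool_def sum.If_cases Int_def)
    finally show ?thesis .
  qed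
  have "\<exists>A. A \<subseteq> {x \<in> words q ?b. B x = 1 \<and> B (shift k x) = 1} \<and> card A = m \<and>
    (\<beta> - \<delta> - 1 / 4) * q ^ (a + k + k') - 1 < ?F (\<lambda>x. of_bool (x \<in> A))"
  proof (cases "k' \<le> ?b")
    case True
    have "\<exists>A\<subseteq>{x \<in> words q ?b. \<alpha> x \<noteq> 0}. card A = m \<and> ?F \<alpha> - 1 < ?F (\<lambda>x. of_bool (x \<in> A))"
    proof (rule pipage)
      show "finite (words q ?b)" by simp
      show "0 \<le> \<alpha> z \<and> \<alpha> z \<le> 1" for z using \<alpha>(2)[of z] \<alpha>1[of z] by simp
      show "sum \<alpha> (words q ?b) = real m" by (rule sum\<alpha>)
      show "restr ?b w \<in> words q ?b \<and> shift k' w \<in> words q ?b" if "w \<in> ?C" for w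
        using in_words[OF that] by simp
      show "- 2 \<le> curvature ?C (restr ?b) (shift k') x y" for x y
        unfolding curvature_overlaps
        using overlaps_bounds[OF True, of q x x] overlaps_bounds[OF True, of q y y]
          overlaps_bounds[OF True, of q x y] overlaps_bounds[OF True, of q y x] by linarith
      fix S assume S: "S \<subseteq> words q ?b" "card S = 4"
      show "\<exists>x\<in>S. \<exists>y\<in>S. x \<noteq> y \<and> 0 \<le> curvature ?C (restr ?b) (shift k') x y"
      proof (rule ccontr)
        assume *: "\<not> ?thesis"
        have neg: "restr (?b - k') x \<noteq> shift k' x" "shift k' x = restr (?b - k') y \<or> shift k' y = restr (?b - k') x"
          if "x \<in> S" "y \<in> S" "x \<noteq> y" for x y
        proof -
          have "curvature ?C (restr ?b) (shift k') x y < 0" using * that by (meson not_le)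
          then have c: "of_bool (shift k' x = restr (?b - k') x) + of_bool (shift k' y = restr (?b - k') y)
            < of_bool (shift k' x = restr (?b - k') y) + (of_bool (shift k' y = restr (?b - k') x) :: real)"
            using that S(1) True by (auto simp: curvature_overlaps overlaps_eq subset_iff)
          \<comment> \<open>If x overlapped itself, negative curvature would require x and y to
            overlap in both orders; then the tail of y equals the head of x, hence the tail of x,
            hence the head of y, and y overlaps itself as well, which makes the curvature 0.\<close>
          show "restr (?b - k') x \<noteq> shift k' x"
            using c by (auto simp: of_bool_def split: if_splits)
          show "shift k' x = restr (?b - k') y \<or> shift k' y = restr (?b - k') x"
            using c by (auto simp: of_bool_def split: if_splits)
        qed
        obtain x S3 where 1: "S = insert x S3" "x \<notin> S3" "card S3 = 3"
          using S(2) by (metis card_Suc_eq numeral_3_eq_3 numeral_eq_Suc pred_numeral_simps(2) semiring_norm(26) semiring_norm(27))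
        then obtain y z t where 2: "S3 = {y, z, t}" "y \<noteq> z" "y \<noteq> t" "z \<noteq> t" by (auto simp: card_3_iff)
        have d: "x \<noteq> y" "x \<noteq> z" "x \<noteq> t" using 1 2 by auto
        have in': "x \<in> S" "y \<in> S" "z \<in> S" "t \<in> S" using 1 2 by auto
        show False
          by (rule no_four_consecutive[of "restr (?b - k')" x "shift k'" y z t])
            (use neg in' d 2(2-4) in blast)+
      qed
    qed
    then obtain A where A: "A \<subseteq> {x \<in> words q ?b. \<alpha> x \<noteq> 0}" "card A = m" "?F \<alpha> - 1 < ?F (\<lambda>x. of_bool (x \<in> A))"
      by blast
    have "A \<subseteq> {x \<in> words q ?b. B x = 1 \<and> B (shift k x) = 1}" using A(1) supp by blast
    moreover have "(\<beta> - \<delta> - 1 / 4) * q ^ (a + k + k') - 1 < ?F (\<lambda>x. of_bool (x \<in> A))"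
      using A(3) F\<alpha> by linarith
    ultimately show ?thesis using A(2) by blast
  next
    case False
    \<comment> \<open>Prefix and suffix of length a + k are now disjoint, hence independent, and
      every set A of the right size leaves exactly \<open>(\<beta> - \<delta>)^2\<close>.\<close>
    let ?W = "{x \<in> words q ?b. B x = 1 \<and> B (shift k x) = 1}"
    have "real m = sum \<alpha> ?W"
      unfolding sum\<alpha>[symmetric] by (rule sum.mono_neutral_right) (use supp in auto)
    also have "\<dots> \<le> (\<Sum>x\<in>?W. 1)" by (intro sum_mono \<alpha>1)
    finally have "m \<le> card ?W" by simp
    then obtain A where A: "A \<subseteq> ?W" "card A = m" by (rule obtain_subset_with_card_n)
    define \<alpha>' where "\<alpha>' = (\<lambda>w. of_bool (restr ?b w \<in> A) :: real)"
    have d\<alpha>': "dep {..<?b} \<alpha>'"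
    proof (rule depI)
      fix w w' :: "nat \<Rightarrow> nat" assume eq: "\<And>i. i \<in> {..<?b} \<Longrightarrow> w i = w' i"
      then have "restr ?b w = restr ?b w'" by (auto simp: restr_def)
      then show "\<alpha>' w = \<alpha>' w'" by (simp add: \<alpha>'_def)
    qed
    have "avg q ?b \<alpha>' = card A / q ^ ?b"
    proof -
      have "(\<Sum>w\<in>words q ?b. \<alpha>' w) = (\<Sum>w\<in>words q ?b. of_bool (w \<in> A))"
        unfolding \<alpha>'_def by (intro sum.cong refl) simp
      also have "\<dots> = card (words q ?b \<inter> A)" by (simp add: of_bool_def sum.If_cases)
      also have "words q ?b \<inter> A = A" using A(1) by auto
      finally show ?thesis by (simp add: avg_def)
    qed
    then have E\<alpha>': "E \<alpha>' = \<delta>" using avg_extend[OF d\<alpha>', of "a + k + k'" q] q0 A(2) m(1) by simp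
    have dB': "dep {..<?b} B" by (rule dep_event_word[OF B(1)])
    let ?g = "\<lambda>w. B (shift k w) - \<alpha>' w"
    have dg: "dep {..<?b} ?g" by (intro dep_diff dep_event_shift B(1) d\<alpha>') simp
    have "E (\<lambda>w. (B w - \<alpha>' w) * (B (shift k (shift k' w)) - \<alpha>' (shift k' w))) = E (\<lambda>w. B w - \<alpha>' w) * E (\<lambda>w. ?g (shift k' w))"
      by (rule E_indep[OF dep_diff[OF dB' d\<alpha>'] dep_shift[OF dg]]) (use False in auto)
    also have "E (\<lambda>w. B w - \<alpha>' w) = \<beta> - \<delta>"
      using E_word[OF dB] B(2) E\<alpha>' by (simp add: avg_diff)
    also have "E (\<lambda>w. ?g (shift k' w)) = \<beta> - \<delta>"
      using E_shift_word[OF dg] E_window[OF dB, of k] B(2) E\<alpha>' by (simp add: avg_diff)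
    finally have "E (\<lambda>w. (B w - \<alpha>' w) * (B (shift (k + k') w) - \<alpha>' (shift k' w))) \<ge> \<beta> - \<delta> - 1 / 4"
      using square_bound[of "\<beta> - \<delta>"] by (simp add: shift_shift power2_eq_square add.commute[of k' k])
    moreover have "?F (\<lambda>x. of_bool (x \<in> A)) = E (\<lambda>w. (B w - \<alpha>' w) * (B (shift (k + k') w) - \<alpha>' (shift k' w))) * q ^ (a + k + k')"
    proof -
      have "\<alpha>' (shift k' w) = of_bool (shift k' w \<in> A)" if "w \<in> ?C" for w
        using restr_words[OF in_words(2)[OF that]] by (simp add: \<alpha>'_def)
      then have "?F (\<lambda>x. of_bool (x \<in> A)) = (\<Sum>w\<in>?C. (B w - \<alpha>' w) * (B (shift (k + k') w) - \<alpha>' (shift k' w)))"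
        unfolding bilin_def by (intro sum.cong refl) (simp add: \<alpha>'_def)
      then show ?thesis using q0 by (simp add: avg_def)
    qed
    ultimately have "(\<beta> - \<delta> - 1 / 4) * q ^ (a + k + k') \<le> ?F (\<lambda>x. of_bool (x \<in> A))"
      by (simp add: mult_right_mono)
    then have "(\<beta> - \<delta> - 1 / 4) * q ^ (a + k + k') - 1 < ?F (\<lambda>x. of_bool (x \<in> A))"
      by linarith
    then show ?thesis using A by blast
  qed
  then obtain A where A: "A \<subseteq> {x \<in> words q ?b. B x = 1 \<and> B (shift k x) = 1}" "card A = m"
    "(\<beta> - \<delta> - 1 / 4) * q ^ (a + k + k') - 1 < ?F (\<lambda>x. of_bool (x \<in> A))"
    by blast
  from A(3) have "(\<beta> - \<delta> - 1 / 4) * q ^ (a + k + k') - 1 <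
      card {w \<in> ?C. B w = 1 \<and> B (shift (k + k') w) = 1 \<and> restr ?b w \<notin> A \<and> shift k' w \<notin> A}"
    unfolding FA[OF A(1)] .
  then show ?thesis using B A(1,2) by blast
qed

end

section \<open>Codes from sets of words\<close>

definition lst :: "nat \<Rightarrow> (nat \<Rightarrow> nat) \<Rightarrow> nat list" where
  "lst N w = map w [0..<N]"

lemma length_lst [simp]: "length (lst N w) = N"
  by (simp add: lst_def)

lemma lst_in_lists: "w \<in> words q N \<Longrightarrow> lst N w \<in> lists {0..<q}"
  by (auto simp: lst_def words_def)

lemma inj_lst: "inj_on (lst N) (words q N)"
proof (rule inj_onI, rule ext)
  fix w w' i assume w: "w \<in> words q N" "w' \<in> words q N" and eq: "lst N w = lst N w'"
  show "w i = w' i"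
  proof (cases "i < N")
    case True
    then show ?thesis using arg_cong[OF eq, of "\<lambda>v. v ! i"] by (simp add: lst_def)
  qed (use w in \<open>simp add: words_def\<close>)
qed

lemma take_lst: "a \<le> N \<Longrightarrow> take a (lst N w) = lst a (restr a w)"
  by (rule nth_equalityI) (auto simp: lst_def restr_def)

lemma drop_lst: "d \<le> N \<Longrightarrow> drop d (lst N w) = lst (N - d) (shift d w)"
  by (rule nth_equalityI) (auto simp: lst_def shift_def)

lemma code_of_sets:
  assumes lam: "strict_mono_on {1..s} lam"
    and A: "\<And>i. i \<in> {1..s} \<Longrightarrow> A i \<subseteq> words q (lam i)" "\<And>i. i \<in> {1..s} \<Longrightarrow> card (A i) = mu i"
    and avoid: "\<And>i i' w. i \<in> {1..s} \<Longrightarrow> i' \<in> {1..s} \<Longrightarrow> i < i' \<Longrightarrow> w \<in> A i' \<Longrightarrow>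
      restr (lam i) w \<notin> A i \<and> shift (lam i' - lam i) w \<notin> A i"
  shows "\<exists>C. q_ary_code q C \<and> fix_free C \<and> has_length_distribution s lam mu C"
proof -
  define C where "C = (\<Union>i\<in>{1..s}. lst (lam i) ` A i)"
  have fin: "finite (A i)" if "i \<in> {1..s}" for i using finite_subset[OF A(1)[OF that]] by simp
  have "q_ary_code q C"
    unfolding q_ary_code_def
  proof
    show "finite C" using fin by (auto simp: C_def)
    show "C \<subseteq> lists {0..<q}"
    proof
      fix v assume "v \<in> C"
      then obtain i w where "i \<in> {1..s}" "w \<in> A i" "v = lst (lam i) w" by (auto simp: C_def)
      then show "v \<in> lists {0..<q}" using lst_in_lists A(1) by blast
    qed
  qed
  moreover have "fix_free C"
    unfolding fix_free_def
  proof (intro ballI)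
    fix u v assume "u \<in> C" "v \<in> C"
    then obtain i i' x w where i: "i \<in> {1..s}" "x \<in> A i" "u = lst (lam i) x"
      and i': "i' \<in> {1..s}" "w \<in> A i'" "v = lst (lam i') w"
      unfolding C_def by blast
    have *: "take (length u) v \<noteq> u \<and> drop (length v - length u) v \<noteq> u" if less: "length u < length v"
    proof -
      have lt: "lam i < lam i'" using less i i' by simp
      then have "i < i'" using strict_mono_onD[OF lam i'(1) i(1)] by (metis i(3) i'(3) less_asym linorder_neqE_nat)
      note av = avoid[OF i(1) i'(1) this i'(2)]
      have w: "w \<in> words q (lam i')" "x \<in> words q (lam i)" using A(1) i i' by auto
      have "restr (lam i) w \<in> words q (lam i)" "shift (lam i' - lam i) w \<in> words q (lam i)"
        using w(1) lt by (auto simp: words_def restr_def shift_def)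
      then have "lst (lam i) (restr (lam i) w) \<noteq> lst (lam i) x" "lst (lam i) (shift (lam i' - lam i) w) \<noteq> lst (lam i) x"
        using inj_onD[OF inj_lst _ _ w(2)] av i(2) by metis+
      then show ?thesis using lt by (simp add: i(3) i'(3) take_lst drop_lst)
    qed
    show "\<not> strict_prefix u v \<and> \<not> strict_suffix u v"
    proof
      show "\<not> strict_prefix u v"
      proof
        assume sp: "strict_prefix u v"
        then obtain z where "v = u @ z" by (auto elim: strict_prefixE')
        then show False using *[OF prefix_length_less[OF sp]] by simp
      qed
      show "\<not> strict_suffix u v"
      proof
        assume ss: "strict_suffix u v"
        then obtain z where "v = z @ u" by (auto simp: strict_suffix_def suffix_def)
        then show False using *[OF suffix_length_less[OF ss]] by simp
      qed
    qed
  qed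
  moreover have "has_length_distribution s lam mu C"
    unfolding has_length_distribution_def
  proof
    show "\<forall>i\<in>{1..s}. card {w \<in> C. length w = lam i} = mu i"
    proof
      fix i assume i: "i \<in> {1..s}"
      have "{w \<in> C. length w = lam i} = lst (lam i) ` A i"
      proof -
        have "i' = i" if "i' \<in> {1..s}" "lam i' = lam i" for i'
          using inj_onD[OF strict_mono_on_imp_inj_on[OF lam] that(2,1) i] .
        note inj = this
        show ?thesis
        proof (intro equalityI subsetI)
          fix v assume "v \<in> {w \<in> C. length w = lam i}"
          then obtain i' w where w: "i' \<in> {1..s}" "w \<in> A i'" "v = lst (lam i') w" "lam i' = lam i"
            unfolding C_def by (auto simp del: atLeastAtMost_iff)
          then show "v \<in> lst (lam i) ` A i" using inj[OF w(1,4)] by simp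
        qed (use i in \<open>auto simp: C_def\<close>)
      qed
      then show "card {w \<in> C. length w = lam i} = mu i"
        using card_image[OF inj_on_subset[OF inj_lst A(1)[OF i]]] A(2)[OF i] by simp
    qed
  qed (auto simp: C_def)
  ultimately show ?thesis by blast
qed

lemma code_exists:
  assumes s: "1 \<le> s" "s \<le> 3" and adm: "admissible s q lam mu"
  shows "\<exists>C. q_ary_code q C \<and> fix_free C \<and> has_length_distribution s lam mu C"
proof -
  have q: "2 \<le> q" and pos: "\<And>i. i \<in> {1..s} \<Longrightarrow> 0 < lam i \<and> 0 < mu i" and mono: "strict_mono_on {1..s} lam"
    and kraft: "(\<Sum>i=1..s. real (mu i) / real q ^ lam i) \<le> 3 / 4"
    using adm by (auto simp: admissible_def)
  have qpos: "0 < real q ^ j" for j using q by simp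
  define a where "a = lam 1"
  have a0: "0 < a" using pos[of 1] s by (simp add: a_def)
  have term_le: "real (mu 1) / real q ^ a \<le> (\<Sum>i=1..s. real (mu i) / real q ^ lam i)"
    unfolding a_def by (rule member_le_sum) (use s in auto)
  have mu1: "mu 1 \<le> q ^ a"
  proof -
    have "real (mu 1) / real q ^ a \<le> 1" using term_le kraft by linarith
    then have "real (mu 1) \<le> real (q ^ a)" using qpos[of a] by simp
    then show ?thesis by linarith
  qed
  consider "s = 1" | "s = 2" | "s = 3" using s by linarith
  then show ?thesis
  proof cases
    case 1
    have "mu 1 \<le> card (words q a)" using mu1 by (simp add: card_words)
    then obtain A where "A \<subseteq> words q a" "card A = mu 1" by (rule obtain_subset_with_card_n)
    then show ?thesis
      by (intro code_of_sets[OF mono, of "\<lambda>_. A"]) (auto simp: 1 a_def)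
  next
    case 2
    define k where "k = lam 2 - lam 1"
    have "lam 1 < lam 2" using strict_mono_onD[OF mono, of 1 2] 2 by simp
    then have kk: "0 < k" "lam 2 = a + k" by (auto simp: k_def a_def)
    \<comment> \<open>Two lengths are completed by a fictitious third one, of which no codewords are
      taken.\<close>
    interpret three_lengths q a k 1 using q a0 kk by unfold_locales auto
    define n where "n = q ^ a - mu 1"
    have n: "n \<le> q ^ a" "real n / q ^ a = 1 - mu 1 / q ^ a"
      using mu1 qpos[of a] by (auto simp: n_def of_nat_diff diff_divide_distrib)
    have sum2: "real (mu 1) / q ^ a + real (mu 2) / q ^ (a + k) \<le> 3 / 4"
    proof -
      have "{1..s} = {1, 2}" using 2 by auto
      then show ?thesis using kraft unfolding kk(2)[symmetric] by (simp add: a_def)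
    qed
    have "real (mu 2) / q ^ (a + k) \<le> 1 - mu 1 / q ^ a - 1 / 4" using sum2 by linarith
    from ex_sets[OF n refl this]
    obtain B A where B: "event a B" "avg q a B = 1 - mu 1 / q ^ a"
      and A: "A \<subseteq> {x \<in> words q (a + k). B x = 1 \<and> B (shift k x) = 1}" "card A = mu 2"
      by blast
    define A1 where "A1 = words q a - {w \<in> words q a. B w = 1}"
    have "card {w \<in> words q a. B w = 1} = n"
      using avg_event[OF B(1) q0] B(2) n(2) q0 by simp
    then have cardA1: "card A1 = mu 1"
      unfolding A1_def using mu1 by (subst card_Diff_subset) (auto simp: card_words n_def)
    have A1: "B w = 0 \<or> B w \<noteq> 1" if "w \<in> A1" for w using that by (auto simp: A1_def)
    have Brestr: "B (restr a w) = B w" for w by (rule dep_restr[OF event_dep[OF B(1)]])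
    show ?thesis
    proof (rule code_of_sets[OF mono, of "\<lambda>i. if i = 1 then A1 else A"])
      fix i assume "i \<in> {1..s}"
      then have "i = 1 \<or> i = 2" using 2 by auto
      then show "(if i = 1 then A1 else A) \<subseteq> words q (lam i)" "card (if i = 1 then A1 else A) = mu i"
        using A cardA1 kk by (auto simp: A1_def a_def)
    next
      fix i i' w assume *: "i \<in> {1..s}" "i' \<in> {1..s}" "i < i'" "w \<in> (if i' = 1 then A1 else A)"
      then have i: "i = 1" "i' = 2" using 2 by auto
      then have w: "w \<in> A" "lam i = a" "lam i' - lam i = k" using * kk by (auto simp: a_def)
      have "B w = 1" "B (shift k w) = 1" using w(1) A(1) by auto
      then have "restr a w \<notin> A1" "shift k w \<notin> A1" using A1[of "restr a w"] A1[of "shift k w"] Brestr[of w] by auto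
      then show "restr (lam i) w \<notin> (if i = 1 then A1 else A) \<and> shift (lam i' - lam i) w \<notin> (if i = 1 then A1 else A)"
        using i w by simp
    qed
  next
    case 3
    define k where "k = lam 2 - lam 1"
    define k' where "k' = lam 3 - lam 2"
    have "lam 1 < lam 2" "lam 2 < lam 3"
      using strict_mono_onD[OF mono, of 1 2] strict_mono_onD[OF mono, of 2 3] 3 by auto
    then have kk: "0 < k" "lam 2 = a + k" "0 < k'" "lam 3 = a + k + k'" by (auto simp: k_def k'_def a_def)
    interpret three_lengths q a k k' using q a0 kk by unfold_locales auto
    define n where "n = q ^ a - mu 1"
    have n: "n \<le> q ^ a" "real n / q ^ a = 1 - mu 1 / q ^ a"
      using mu1 qpos[of a] by (auto simp: n_def of_nat_diff diff_divide_distrib)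
    have sum3: "real (mu 1) / q ^ a + real (mu 2) / q ^ (a + k) + real (mu 3) / q ^ (a + k + k') \<le> 3 / 4"
    proof -
      have "{1..s} = {1, 2, 3}" using 3 by auto
      then show ?thesis using kraft unfolding kk(4)[symmetric] unfolding kk(2)[symmetric] by (simp add: a_def add.assoc)
    qed
    have "0 \<le> real (mu 3) / q ^ (a + k + k')" by simp
    then have "real (mu 2) / q ^ (a + k) \<le> 1 - mu 1 / q ^ a - 1 / 4" using sum3 by linarith
    from ex_sets[OF n refl this]
    obtain B A where B: "event a B" "avg q a B = 1 - mu 1 / q ^ a"
      and A: "A \<subseteq> {x \<in> words q (a + k). B x = 1 \<and> B (shift k x) = 1}" "card A = mu 2"
      and F: "(1 - mu 1 / q ^ a - mu 2 / q ^ (a + k) - 1 / 4) * q ^ (a + k + k') - 1 <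
        card {w \<in> words q (a + k + k'). B w = 1 \<and> B (shift (k + k') w) = 1 \<and> restr (a + k) w \<notin> A \<and> shift k' w \<notin> A}"
      by blast
    let ?F = "{w \<in> words q (a + k + k'). B w = 1 \<and> B (shift (k + k') w) = 1 \<and> restr (a + k) w \<notin> A \<and> shift k' w \<notin> A}"
    have "real (mu 3) / q ^ (a + k + k') \<le> 1 - mu 1 / q ^ a - mu 2 / q ^ (a + k) - 1 / 4"
      using sum3 by linarith
    then have "real (mu 3) \<le> (1 - mu 1 / q ^ a - mu 2 / q ^ (a + k) - 1 / 4) * q ^ (a + k + k')"
      using q0 by (subst (asm) pos_divide_le_eq) auto
    \<comment> \<open>\<open>mu 3\<close> and the cardinality are integers, so a loss of less than
      one word is harmless.\<close>
    then have "mu 3 \<le> card ?F" using F by linarith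
    then obtain A3 where A3: "A3 \<subseteq> ?F" "card A3 = mu 3" by (rule obtain_subset_with_card_n)
    define A1 where "A1 = words q a - {w \<in> words q a. B w = 1}"
    have "card {w \<in> words q a. B w = 1} = n"
      using avg_event[OF B(1) q0] B(2) n(2) q0 by simp
    then have cardA1: "card A1 = mu 1"
      unfolding A1_def using mu1 by (subst card_Diff_subset) (auto simp: card_words n_def)
    have A1: "B w \<noteq> 1" if "w \<in> A1" for w using that by (auto simp: A1_def)
    have Brestr: "B (restr a w) = B w" for w by (rule dep_restr[OF event_dep[OF B(1)]])
    define S where "S i = (if i = 1 then A1 else if i = 2 then A else A3)" for i :: nat
    show ?thesis
    proof (rule code_of_sets[OF mono, of S])
      fix i assume "i \<in> {1..s}"
      then have "i = 1 \<or> i = 2 \<or> i = 3" using 3 by auto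
      then show "S i \<subseteq> words q (lam i)" "card (S i) = mu i"
        using A A3 cardA1 kk by (auto simp: A1_def a_def S_def)
    next
      fix i i' w assume *: "i \<in> {1..s}" "i' \<in> {1..s}" "i < i'" "w \<in> S i'"
      then consider "i = 1" "i' = 2" | "i = 1" "i' = 3" | "i = 2" "i' = 3" using 3 by fastforce
      then show "restr (lam i) w \<notin> S i \<and> shift (lam i' - lam i) w \<notin> S i"
      proof cases
        case 1
        then have "w \<in> A" "lam i = a" "lam i' - lam i = k" using * kk by (auto simp: S_def a_def)
        then show ?thesis using A(1) A1 Brestr[of w] 1 by (auto simp: S_def)
      next
        case 2
        then have "w \<in> A3" "lam i = a" "lam i' - lam i = k + k'" using * kk by (auto simp: S_def a_def)
        then show ?thesis using A3(1) A1 Brestr[of w] 2 by (auto simp: S_def)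
      next
        case 3
        then have "w \<in> A3" "lam i = a + k" "lam i' - lam i = k'" using * kk by (auto simp: S_def)
        then show ?thesis using A3(1) 3 by (auto simp: S_def)
      qed
    qed
  qed
qed

section \<open>Recursive functions\<close>

text \<open>Equality is required only on lists of length n: the values of a recursive function on
  other lists depend on how it was built and carry no meaning.\<close>

definition recf :: "nat \<Rightarrow> (nat list \<Rightarrow> nat) \<Rightarrow> bool" where
  "recf n f \<longleftrightarrow> (\<exists>g. total_recursive n g \<and> (\<forall>xs. length xs = n \<longrightarrow> g xs = f xs))"

abbreviation recp :: "nat \<Rightarrow> (nat list \<Rightarrow> bool) \<Rightarrow> bool" where
  "recp n P \<equiv> recf n (\<lambda>xs. of_bool (P xs))"

lemma recfI: "total_recursive n g \<Longrightarrow> (\<And>xs. length xs = n \<Longrightarrow> g xs = f xs) \<Longrightarrow> recf n f"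
  unfolding recf_def by blast

lemma recf_cong: "recf n f \<Longrightarrow> (\<And>xs. length xs = n \<Longrightarrow> f xs = g xs) \<Longrightarrow> recf n g"
  unfolding recf_def by auto

lemma recf_comp:
  assumes f: "recf (length gs) f" and gs: "\<And>g. g \<in> set gs \<Longrightarrow> recf n g"
  shows "recf n (\<lambda>xs. f (map (\<lambda>g. g xs) gs))"
proof -
  obtain f' where f': "total_recursive (length gs) f'" "\<And>xs. length xs = length gs \<Longrightarrow> f' xs = f xs"
    using f unfolding recf_def by blast
  obtain r where r: "\<And>g. g \<in> set gs \<Longrightarrow> total_recursive n (r g) \<and> (\<forall>xs. length xs = n \<longrightarrow> r g xs = g xs)"
    using gs unfolding recf_def by metis
  have "total_recursive n (\<lambda>xs. f' (map (\<lambda>g. g xs) (map r gs)))"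
    using f'(1) r by (intro total_recursive.comp) auto
  then show ?thesis
  proof (rule recfI)
    fix xs :: "nat list" assume xs: "length xs = n"
    have e: "map (\<lambda>g. g xs) (map r gs) = map (\<lambda>g. g xs) gs" using r xs by simp
    show "f' (map (\<lambda>g. g xs) (map r gs)) = f (map (\<lambda>g. g xs) gs)"
      unfolding e by (rule f'(2)) simp
  qed
qed

lemma recf_nth: "i < n \<Longrightarrow> recf n (\<lambda>xs. xs ! i)"
  by (rule recfI[OF total_recursive.proj]) auto

lemma recf_Suc: "recf n f \<Longrightarrow> recf n (\<lambda>xs. Suc (f xs))"
  using recf_comp[of "[f]" "\<lambda>xs. Suc (xs ! 0)" n] recfI[OF total_recursive.succ] by simp

lemma recf_const: "recf n (\<lambda>xs. c)"
proof (induction c)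
  case 0
  show ?case by (rule recfI[OF total_recursive.zero]) simp
next
  case (Suc c)
  then show ?case by (rule recf_Suc)
qed

lemma recf_binary:
  assumes "recf 2 (\<lambda>xs. h (xs ! 0) (xs ! 1))" "recf n f" "recf n g"
  shows "recf n (\<lambda>xs. h (f xs) (g xs))"
proof -
  have "recf n (\<lambda>xs. (\<lambda>xs. h (xs ! 0) (xs ! 1)) (map (\<lambda>g. g xs) [f, g]))"
    by (rule recf_comp) (use assms in \<open>auto simp: numeral_2_eq_2\<close>)
  then show ?thesis by simp
qed

lemma recf_subst_hd:
  assumes "recf (Suc n) F" "recf n b"
  shows "recf n (\<lambda>xs. F (b xs # xs))"
proof -
  have "recf n (\<lambda>xs. F (map (\<lambda>g. g xs) (b # map (\<lambda>i xs. xs ! i) [0..<n])))"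
    using assms by (intro recf_comp) (auto intro: recf_nth)
  then show ?thesis
  proof (rule recf_cong)
    fix xs :: "nat list" assume "length xs = n"
    then have "map (\<lambda>g. g xs) (map (\<lambda>i xs. xs ! i) [0..<n]) = xs"
      by (intro nth_equalityI) auto
    then show "F (map (\<lambda>g. g xs) (b # map (\<lambda>i xs. xs ! i) [0..<n])) = F (b xs # xs)" by simp
  qed
qed

lemma recf_rec:
  assumes "recf n f" "recf (Suc (Suc n)) g"
  shows "recf (Suc n) (\<lambda>xs. rec_nat (f (tl xs)) (\<lambda>k r. g (k # r # tl xs)) (hd xs))"
proof -
  obtain f' g' where f': "total_recursive n f'" "\<And>xs. length xs = n \<Longrightarrow> f' xs = f xs"
    and g': "total_recursive (n + 2) g'" "\<And>xs. length xs = n + 2 \<Longrightarrow> g' xs = g xs"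
    using assms unfolding recf_def by auto
  have "rec_nat (f' (tl xs)) (\<lambda>k r. g' (k # r # tl xs)) m = rec_nat (f (tl xs)) (\<lambda>k r. g (k # r # tl xs)) m"
    if "length xs = Suc n" for xs m
    using that by (induction m) (auto simp: f'(2) g'(2))
  note eq = this
  have "total_recursive (Suc n) (\<lambda>xs. rec_nat (f' (tl xs)) (\<lambda>k r. g' (k # r # tl xs)) (hd xs))"
    using total_recursive.prec[OF f'(1) g'(1)] by simp
  then show ?thesis by (rule recfI) (rule eq)
qed

lemma recf_unary_rec:
  assumes f: "recf 1 (\<lambda>xs. f (xs ! 0))" and g: "recf 3 (\<lambda>xs. g (xs ! 0) (xs ! 1) (xs ! 2))"
    and eq: "\<And>x y. rec_nat (f y) (\<lambda>k r. g k r y) x = h x y"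
  shows "recf 2 (\<lambda>xs. h (xs ! 0) (xs ! 1))"
proof -
  have "recf 2 (\<lambda>xs. rec_nat (f (tl xs ! 0)) (\<lambda>k r. g ((k # r # tl xs) ! 0) ((k # r # tl xs) ! 1) ((k # r # tl xs) ! 2)) (hd xs))"
    using recf_rec[of 1 "\<lambda>xs. f (xs ! 0)" "\<lambda>xs. g (xs ! 0) (xs ! 1) (xs ! 2)"] f g
    by (simp add: numeral_2_eq_2 numeral_3_eq_3)
  then show ?thesis
  proof (rule recf_cong)
    fix xs :: "nat list" assume "length xs = 2"
    then obtain x y where "xs = [x, y]" by (auto simp: numeral_2_eq_2 length_Suc_conv)
    then show "rec_nat (f (tl xs ! 0)) (\<lambda>k r. g ((k # r # tl xs) ! 0) ((k # r # tl xs) ! 1) ((k # r # tl xs) ! 2)) (hd xs)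
      = h (xs ! 0) (xs ! 1)" using eq[of y x] by simp
  qed
qed

lemma recf_add: "recf n f \<Longrightarrow> recf n g \<Longrightarrow> recf n (\<lambda>xs. f xs + g xs)"
proof (rule recf_binary[of "(+)"])
  have "rec_nat y (\<lambda>k r. Suc r) x = x + y" for x y :: nat by (induction x) auto
  then show "recf 2 (\<lambda>xs. xs ! 0 + xs ! 1)"
    by (intro recf_unary_rec[of "\<lambda>y. y" "\<lambda>k r y. Suc r"] recf_Suc recf_nth) auto
qed

lemma recf_mult: "recf n f \<Longrightarrow> recf n g \<Longrightarrow> recf n (\<lambda>xs. f xs * g xs)"
proof (rule recf_binary[of "(*)"])
  have "rec_nat 0 (\<lambda>k r. r + y) x = x * y" for x y :: nat by (induction x) auto
  then show "recf 2 (\<lambda>xs. xs ! 0 * xs ! 1)"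
    by (intro recf_unary_rec[of "\<lambda>y. 0" "\<lambda>k r y. r + y"] recf_add recf_nth recf_const) auto
qed

lemma recf_pred: "recf n f \<Longrightarrow> recf n (\<lambda>xs. f xs - 1)"
proof -
  have "recf 2 (\<lambda>xs. (\<lambda>x y. x - 1) (xs ! 0) (xs ! 1))"
  proof (rule recf_unary_rec[of "\<lambda>y. 0" "\<lambda>k r y. k"])
    show "rec_nat 0 (\<lambda>k r. k) x = x - 1" for x by (cases x) auto
    show "recf 1 (\<lambda>xs. 0)" "recf 3 (\<lambda>xs. xs ! 0)" by (intro recf_const recf_nth; simp)+
  qed
  then show "recf n f \<Longrightarrow> recf n (\<lambda>xs. f xs - 1)"
    using recf_binary[of "\<lambda>x y. x - 1" n f f] by simp
qed

lemma recf_diff: "recf n f \<Longrightarrow> recf n g \<Longrightarrow> recf n (\<lambda>xs. f xs - g xs)"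
proof -
  \<comment> \<open>Primitive recursion runs over the first argument, so the subtrahend is put
    first.\<close>
  have "recf 2 (\<lambda>xs. (\<lambda>x y. y - x) (xs ! 0) (xs ! 1))"
  proof (rule recf_unary_rec[of "\<lambda>y. y" "\<lambda>k r y. r - 1"])
    show "rec_nat y (\<lambda>k r. r - 1) x = y - x" for x y :: nat by (induction x) auto
    show "recf 1 (\<lambda>xs. xs ! 0)" by (intro recf_nth) simp
    show "recf 3 (\<lambda>xs. xs ! 1 - 1)" by (intro recf_pred recf_nth) simp
  qed
  then show "recf n f \<Longrightarrow> recf n g \<Longrightarrow> recf n (\<lambda>xs. f xs - g xs)"
    using recf_binary[of "\<lambda>x y. y - x" n g f] by simp
qed

lemma recf_power: "recf n f \<Longrightarrow> recf n g \<Longrightarrow> recf n (\<lambda>xs. f xs ^ g xs)"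
proof -
  have "recf 2 (\<lambda>xs. (\<lambda>x y. y ^ x) (xs ! 0) (xs ! 1))"
  proof (rule recf_unary_rec[of "\<lambda>y. 1" "\<lambda>k r y. r * y"])
    show "rec_nat 1 (\<lambda>k r. r * y) x = y ^ x" for x y :: nat by (induction x) auto
    show "recf 1 (\<lambda>xs. 1)" by (rule recf_const)
    show "recf 3 (\<lambda>xs. xs ! 1 * xs ! 2)" by (intro recf_mult recf_nth) simp_all
  qed
  then show "recf n f \<Longrightarrow> recf n g \<Longrightarrow> recf n (\<lambda>xs. f xs ^ g xs)"
    using recf_binary[of "\<lambda>x y. y ^ x" n g f] by simp
qed

lemma recp_not: "recp n P \<Longrightarrow> recp n (\<lambda>xs. \<not> P xs)"
  by (rule recf_cong[OF recf_diff[OF recf_const[of n 1]]]) auto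

lemma recp_conj: "recp n P \<Longrightarrow> recp n Q \<Longrightarrow> recp n (\<lambda>xs. P xs \<and> Q xs)"
  by (rule recf_cong[OF recf_mult[of n "\<lambda>xs. of_bool (P xs)" "\<lambda>xs. of_bool (Q xs)"]]) auto

lemma recp_disj: "recp n P \<Longrightarrow> recp n Q \<Longrightarrow> recp n (\<lambda>xs. P xs \<or> Q xs)"
  using recp_not[OF recp_conj[OF recp_not recp_not], of n P Q] by simp

lemma recp_le: "recf n f \<Longrightarrow> recf n g \<Longrightarrow> recp n (\<lambda>xs. f xs \<le> g xs)"
  by (rule recf_cong[OF recf_diff[OF recf_const[of n 1] recf_diff[of n f g]]]) auto

lemma recp_less: "recf n f \<Longrightarrow> recf n g \<Longrightarrow> recp n (\<lambda>xs. f xs < g xs)"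
  using recp_not[OF recp_le[of n g f]] by (simp add: not_le)

lemma recp_eq: "recf n f \<Longrightarrow> recf n g \<Longrightarrow> recp n (\<lambda>xs. f xs = g xs)"
  by (rule recf_cong[OF recp_conj[OF recp_le[of n f g] recp_le[of n g f]]]) auto

text \<open>The truth values are multiplied up by primitive recursion on the bound. In the recursion
  step \<open>gs\<close> drops the accumulator from the argument list before Q is evaluated.\<close>

lemma recp_all_less:
  assumes "recp (Suc n) Q" "recf n b"
  shows "recp n (\<lambda>xs. \<forall>k<b xs. Q (k # xs))"
proof -
  have g: "recf (Suc (Suc n)) (\<lambda>zs. zs ! 1 * of_bool (Q (zs ! 0 # tl (tl zs))))"
  proof -
    define gs :: "(nat list \<Rightarrow> nat) list" where "gs = map (\<lambda>i zs. zs ! i) (0 # [2..<Suc (Suc n)])"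
    have len: "length gs = Suc n" by (simp add: gs_def del: upt_Suc)
    have gs: "recf (Suc (Suc n)) g" if mem: "g \<in> set gs" for g
    proof -
      obtain i where i: "i \<in> set (0 # [2..<Suc (Suc n)])" "g = (\<lambda>zs. zs ! i)"
        using mem unfolding gs_def set_map by blast
      then have "i < Suc (Suc n)" by (auto simp del: upt_Suc)
      then show ?thesis unfolding i(2) by (rule recf_nth)
    qed
    have 1: "recf (Suc (Suc n)) (\<lambda>zs. (\<lambda>ys. of_bool (Q ys)) (map (\<lambda>g. g zs) gs))"
      by (rule recf_comp[OF _ gs]) (use assms(1) len in simp)
    have 2: "map (\<lambda>g. g zs) gs = zs ! 0 # tl (tl zs)" if "length zs = Suc (Suc n)" for zs :: "nat list"
      using that by (intro nth_equalityI) (auto simp: gs_def nth_Cons nth_tl simp del: upt_Suc split: nat.split)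
    have "recp (Suc (Suc n)) (\<lambda>zs. Q (zs ! 0 # tl (tl zs)))"
      by (rule recf_cong[OF 1]) (simp only: 2)
    then show ?thesis by (intro recf_mult recf_nth) auto
  qed
  have "recf (Suc n) (\<lambda>ys. rec_nat 1 (\<lambda>k r. (k # r # tl ys) ! 1 * of_bool (Q ((k # r # tl ys) ! 0 # tl (tl (k # r # tl ys))))) (hd ys))"
    by (rule recf_rec[OF recf_const g])
  then have "recp (Suc n) (\<lambda>ys. \<forall>k<hd ys. Q (k # tl ys))"
  proof (rule recf_cong)
    fix ys :: "nat list"
    have "rec_nat 1 (\<lambda>k r. r * of_bool (Q (k # tl ys))) m = (of_bool (\<forall>k<m. Q (k # tl ys)) :: nat)" for m :: nat
      by (induction m) (auto simp: less_Suc_eq)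
    then show "rec_nat 1 (\<lambda>k r. (k # r # tl ys) ! 1 * of_bool (Q ((k # r # tl ys) ! 0 # tl (tl (k # r # tl ys))))) (hd ys)
      = of_bool (\<forall>k<hd ys. Q (k # tl ys))" by simp
  qed
  from recf_subst_hd[OF this assms(2)] show ?thesis by simp
qed

lemma recf_least:
  assumes "recp (Suc n) Q" "\<And>xs. length xs = n \<Longrightarrow> \<exists>k. Q (k # xs)"
  shows "recf n (\<lambda>xs. LEAST k. Q (k # xs))"
proof -
  obtain g where g: "total_recursive (n + 1) g" "\<And>ys. length ys = Suc n \<Longrightarrow> g ys = of_bool (\<not> Q ys)"
    using recp_not[OF assms(1)] unfolding recf_def by auto
  have "total_recursive n (\<lambda>xs. LEAST k. g (k # xs) = 0)"
    using assms(2) by (intro total_recursive.minim g(1)) (auto simp: g(2))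
  then show ?thesis by (rule recfI) (auto simp: g(2))
qed

lemma recf_div: "recf n f \<Longrightarrow> recf n g \<Longrightarrow> recf n (\<lambda>xs. f xs div g xs)"
proof (rule recf_binary[of "(div)"])
  \<comment> \<open>The first alternative makes the search end for divisor 0 as well, and at k = 0,
    in agreement with division by 0.\<close>
  have "recf 2 (\<lambda>xs. LEAST k. (\<lambda>ys. ys ! 2 = 0 \<or> ys ! 1 < ys ! 2 * Suc (ys ! 0)) (k # xs))"
  proof (rule recf_least)
    show "recp (Suc 2) (\<lambda>ys. ys ! 2 = 0 \<or> ys ! 1 < ys ! 2 * Suc (ys ! 0))"
      by (intro recp_disj recp_eq recp_less recf_mult recf_Suc recf_nth recf_const) auto
    fix xs :: "nat list"
    show "\<exists>k. (k # xs) ! 2 = 0 \<or> (k # xs) ! 1 < (k # xs) ! 2 * Suc ((k # xs) ! 0)"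
      by (rule exI[of _ "xs ! 0"]) (cases "(xs ! 0 # xs) ! 2", auto)
  qed
  then show "recf 2 (\<lambda>xs. xs ! 0 div xs ! 1)"
  proof (rule recf_cong)
    fix xs :: "nat list"
    show "(LEAST k. (k # xs) ! 2 = 0 \<or> (k # xs) ! 1 < (k # xs) ! 2 * Suc ((k # xs) ! 0)) = xs ! 0 div xs ! 1"
    proof (rule Least_equality)
      show "((xs ! 0 div xs ! 1) # xs) ! 2 = 0 \<or> ((xs ! 0 div xs ! 1) # xs) ! 1 < ((xs ! 0 div xs ! 1) # xs) ! 2 * Suc (((xs ! 0 div xs ! 1) # xs) ! 0)"
        using dividend_less_times_div[of "xs ! 1" "xs ! 0"] by (auto simp: numeral_2_eq_2)
      fix k assume "(k # xs) ! 2 = 0 \<or> (k # xs) ! 1 < (k # xs) ! 2 * Suc ((k # xs) ! 0)"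
      then show "xs ! 0 div xs ! 1 \<le> k"
        by (auto simp: numeral_2_eq_2 less_mult_imp_div_less mult.commute less_Suc_eq_le[symmetric] simp del: mult_Suc mult_Suc_right)
    qed
  qed
qed

lemma recf_mod: "recf n f \<Longrightarrow> recf n g \<Longrightarrow> recf n (\<lambda>xs. f xs mod g xs)"
proof -
  assume "recf n f" "recf n g"
  then have "recf n (\<lambda>xs. f xs - f xs div g xs * g xs)" by (intro recf_diff recf_mult recf_div)
  then show ?thesis by (simp add: minus_div_mult_eq_mod)
qed

lemma recp_ball: "finite S \<Longrightarrow> (\<And>i. i \<in> S \<Longrightarrow> recp n (P i)) \<Longrightarrow> recp n (\<lambda>xs. \<forall>i\<in>S. P i xs)"
proof (induction S rule: finite_induct)
  case empty
  show ?case by (rule recf_cong[OF recf_const[of n 1]]) simp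
next
  case (insert i S)
  then show ?case using recp_conj[of n "P i" "\<lambda>xs. \<forall>i\<in>S. P i xs"] by simp
qed

lemma recf_sum: "finite S \<Longrightarrow> (\<And>i. i \<in> S \<Longrightarrow> recf n (f i)) \<Longrightarrow> recf n (\<lambda>xs. \<Sum>i\<in>S. f i xs)"
proof (induction S rule: finite_induct)
  case empty
  show ?case using recf_const[of n 0] by simp
next
  case (insert i S)
  then show ?case using recf_add[of n "f i" "\<lambda>xs. \<Sum>i\<in>S. f i xs"] by simp
qed

lemma recp_const: "recp n (\<lambda>xs. P)"
  using recf_const[of n "of_bool P"] .

lemma recp_imp: "(P \<Longrightarrow> recp n Q) \<Longrightarrow> recp n (\<lambda>xs. P \<longrightarrow> Q xs)"
  using recp_const[of n True] by (cases P) auto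

lemmas rec_intros = recp_imp recp_ball recp_not recp_conj recp_disj recp_le recp_less recp_eq
  recf_add recf_mult recf_diff recf_power recf_div recf_mod recf_sum recf_Suc recf_nth recf_const

section \<open>Indices of codewords\<close>

lemma word_index_append: "word_index q (u @ v) = word_index q u * q ^ length v + word_index q v"
  by (simp add: word_index_def horner_sum_append)

lemma word_index_less:
  assumes "v \<in> lists {0..<q}"
  shows "word_index q v < q ^ length v"
  using assms
proof (induction v)
  case Nil
  then show ?case by (simp add: word_index_def)
next
  case (Cons x v)
  then have "word_index q v < q ^ length v" "Suc x \<le> q" by auto
  moreover have "word_index q (x # v) = x * q ^ length v + word_index q v"
    using word_index_append[of q "[x]" v] by (simp add: word_index_def)
  moreover have "Suc x * q ^ length v \<le> q * q ^ length v"
    using \<open>Suc x \<le> q\<close> by (rule mult_le_mono1)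
  ultimately show ?case by simp
qed

lemma word_index_split:
  assumes "u \<in> lists {0..<q}" "v \<in> lists {0..<q}" "0 < q"
  shows "word_index q (u @ v) div q ^ length v = word_index q u"
    and "word_index q (u @ v) mod q ^ length v = word_index q v"
  using word_index_less[OF assms(2)] assms(3) by (simp_all add: word_index_append)

lemma word_index_inj:
  assumes "u \<in> lists {0..<q}" "v \<in> lists {0..<q}" "length u = length v" "word_index q u = word_index q v" "0 < q"
  shows "u = v"
  using assms(3,1,2,4)
proof (induction u v rule: list_induct2)
  case (Cons x xs y ys)
  have l: "xs \<in> lists {0..<q}" "ys \<in> lists {0..<q}" "[x] \<in> lists {0..<q}" "[y] \<in> lists {0..<q}"
    using Cons.prems by auto
  have "word_index q xs = word_index q ys" "word_index q [x] = word_index q [y]"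
    using word_index_split[OF l(3,1) assms(5)] word_index_split[OF l(4,2) assms(5)] Cons.prems(3) Cons.hyps by auto
  then show ?case using Cons.IH[OF l(1,2)] by (simp add: word_index_def)
qed simp

text \<open>By counting: the index is injective on the \<open>q ^ n\<close> words of length n and
  takes values below \<open>q ^ n\<close>.\<close>

lemma ex_word_index:
  assumes "0 < q" "x < q ^ n"
  shows "\<exists>v\<in>lists {0..<q}. length v = n \<and> word_index q v = x"
proof -
  let ?S = "{v. set v \<subseteq> {0..<q} \<and> length v = n}"
  have S: "finite ?S" "card ?S = q ^ n" using finite_lists_length_eq[of "{0..<q}" n] card_lists_length_eq[of "{0..<q}" n] by auto
  have inj: "inj_on (word_index q) ?S"
    using assms(1) by (intro inj_onI word_index_inj) (auto simp: in_lists_conv_set)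
  have "word_index q ` ?S \<subseteq> {..<q ^ n}"
    using word_index_less[of _ q] by (fastforce simp: in_lists_conv_set)
  then have "word_index q ` ?S = {..<q ^ n}"
    using card_image[OF inj] S by (intro card_subset_eq) auto
  then show ?thesis using assms(2) by (force simp: in_lists_conv_set subset_iff)
qed

text \<open>Fix-freeness in arithmetic form: division of an index by a power of q gives the index of
  a prefix, and the remainder that of a suffix. The second clause makes the number of words right,
  the first keeps the indices in range.\<close>

definition valid_indices :: "nat \<Rightarrow> nat \<Rightarrow> (nat \<Rightarrow> nat) \<Rightarrow> (nat \<Rightarrow> nat) \<Rightarrow> (nat \<Rightarrow> nat \<Rightarrow> nat) \<Rightarrow> bool" where
  "valid_indices s q lam mu e \<longleftrightarrow>
     (\<forall>i\<in>{1..s}. \<forall>j<mu i. e i j < q ^ lam i) \<and>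
     (\<forall>i\<in>{1..s}. \<forall>j<mu i. \<forall>j'<mu i. j \<noteq> j' \<longrightarrow> e i j \<noteq> e i j') \<and>
     (\<forall>i\<in>{1..s}. \<forall>i'\<in>{1..s}. i < i' \<longrightarrow> (\<forall>j<mu i. \<forall>j'<mu i'.
       e i' j' div q ^ (lam i' - lam i) \<noteq> e i j \<and> e i' j' mod q ^ lam i \<noteq> e i j))"

lemma valid_indices_code:
  assumes q: "0 < q" and lam: "strict_mono_on {1..s} lam" and e: "valid_indices s q lam mu e"
  defines "C \<equiv> {w \<in> lists {0..<q}. \<exists>i\<in>{1..s}. \<exists>j<mu i. length w = lam i \<and> word_index q w = e i j}"
  shows "q_ary_code q C" and "fix_free C" and "has_length_distribution s lam mu C"
proof -
  have less: "e i j < q ^ lam i" if "i \<in> {1..s}" "j < mu i" for i j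
    using e that unfolding valid_indices_def by blast
  have dist: "j = j'" if "i \<in> {1..s}" "j < mu i" "j' < mu i" "e i j = e i j'" for i j j'
    using e that unfolding valid_indices_def by blast
  have avoid: "e i' j' div q ^ (lam i' - lam i) \<noteq> e i j" "e i' j' mod q ^ lam i \<noteq> e i j"
    if "i \<in> {1..s}" "i' \<in> {1..s}" "i < i'" "j < mu i" "j' < mu i'" for i i' j j'
    using e that unfolding valid_indices_def by blast+
  have inj: "i = i'" if "i \<in> {1..s}" "i' \<in> {1..s}" "lam i = lam i'" for i i'
    using inj_onD[OF strict_mono_on_imp_inj_on[OF lam] that(3,1,2)] .
  have lt: "i < i'" if "i \<in> {1..s}" "i' \<in> {1..s}" "lam i < lam i'" for i i'
    using strict_mono_onD[OF lam that(2,1)] that(3) inj by (metis less_asym linorder_neqE_nat less_irrefl)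
  have Ci: "{w \<in> C. length w = lam i} = {w \<in> lists {0..<q}. length w = lam i \<and> (\<exists>j<mu i. word_index q w = e i j)}"
    if i: "i \<in> {1..s}" for i
  proof (intro equalityI subsetI)
    fix w assume "w \<in> {w \<in> C. length w = lam i}"
    then obtain i' j where w: "w \<in> lists {0..<q}" "i' \<in> {1..s}" "j < mu i'" "length w = lam i'" "word_index q w = e i' j" "length w = lam i"
      unfolding C_def by blast
    then have "i' = i" using inj[OF w(2) i] by simp
    then show "w \<in> {w \<in> lists {0..<q}. length w = lam i \<and> (\<exists>j<mu i. word_index q w = e i j)}" using w by blast
  qed (use i in \<open>auto simp: C_def\<close>)
  have cardCi: "card {w \<in> C. length w = lam i} = mu i \<and> finite {w \<in> C. length w = lam i}" if i: "i \<in> {1..s}" for i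
  proof -
    have "word_index q ` {w \<in> C. length w = lam i} = e i ` {..<mu i}"
      (is "_ ` ?S = _")
    proof (intro equalityI subsetI)
      fix x assume "x \<in> e i ` {..<mu i}"
      then obtain j where j: "j < mu i" "x = e i j" by blast
      obtain w where "w \<in> lists {0..<q}" "length w = lam i" "word_index q w = x"
        using ex_word_index[OF q less[OF i j(1)]] j(2) by blast
      then show "x \<in> word_index q ` ?S" unfolding Ci[OF i] using j by blast
    qed (auto simp: Ci[OF i])
    note img = this
    have inj1: "inj_on (word_index q) ?S"
      by (intro inj_onI word_index_inj[OF _ _ _ _ q]) (auto simp: C_def)
    have inj2: "inj_on (e i) {..<mu i}"
    proof (rule inj_onI)
      fix j j' assume "j \<in> {..<mu i}" "j' \<in> {..<mu i}" "e i j = e i j'"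
      then show "j = j'" using dist[OF i, of j j'] by simp
    qed
    have "card ?S = card (e i ` {..<mu i})"
      unfolding img[symmetric] by (rule card_image[OF inj1, symmetric])
    also have "\<dots> = mu i" using card_image[OF inj2] by simp
    finally have "card ?S = mu i" .
    moreover have "finite (word_index q ` ?S)" unfolding img by simp
    then have "finite ?S" by (rule finite_imageD[OF _ inj1])
    ultimately show ?thesis ..
  qed
  have len: "length ` C \<subseteq> lam ` {1..s}" by (auto simp: C_def)
  then have "C = (\<Union>i\<in>{1..s}. {w \<in> C. length w = lam i})" by auto
  moreover have "finite (\<Union>i\<in>{1..s}. {w \<in> C. length w = lam i})" using cardCi by blast
  ultimately have "finite C" by simp
  then show "q_ary_code q C" by (auto simp: q_ary_code_def C_def)
  show "has_length_distribution s lam mu C"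
    unfolding has_length_distribution_def using cardCi len by blast
  show "fix_free C"
    unfolding fix_free_def
  proof (intro ballI conjI)
    fix u v assume "u \<in> C" "v \<in> C"
    then obtain i j i' j' where u: "u \<in> lists {0..<q}" "i \<in> {1..s}" "j < mu i" "length u = lam i" "word_index q u = e i j"
      and v: "v \<in> lists {0..<q}" "i' \<in> {1..s}" "j' < mu i'" "length v = lam i'" "word_index q v = e i' j'"
      unfolding C_def by blast
    show "\<not> strict_prefix u v"
    proof
      assume sp: "strict_prefix u v"
      then obtain z where z: "v = u @ z" by (auto elim: strict_prefixE')
      have "i < i'" using lt[OF u(2) v(2)] prefix_length_less[OF sp] u(4) v(4) by simp
      moreover have "z \<in> lists {0..<q}" using v(1) z by simp
      then have "word_index q v div q ^ length z = word_index q u"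
        unfolding z using word_index_split(1)[OF u(1) _ q] by simp
      moreover have "length z = lam i' - lam i" using z u(4) v(4) by simp
      ultimately show False using avoid(1)[OF u(2) v(2) _ u(3) v(3)] u(5) v(5) by simp
    qed
    show "\<not> strict_suffix u v"
    proof
      assume ss: "strict_suffix u v"
      then obtain z where z: "v = z @ u" by (auto simp: strict_suffix_def suffix_def)
      have "i < i'" using lt[OF u(2) v(2)] suffix_length_less[OF ss] u(4) v(4) by simp
      moreover have "z \<in> lists {0..<q}" using v(1) z by simp
      then have "word_index q v mod q ^ length u = word_index q u"
        unfolding z using word_index_split(2)[OF _ u(1) q] by simp
      ultimately show False using avoid(2)[OF u(2) v(2) _ u(3) v(3)] u(4,5) v(5) by simp
    qed
  qed
qed

lemma code_valid_indices:
  assumes q: "0 < q" and lam: "strict_mono_on {1..s} lam"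
    and C: "q_ary_code q C" "fix_free C" "has_length_distribution s lam mu C"
  shows "\<exists>e. valid_indices s q lam mu e"
proof -
  have CQ: "C \<subseteq> lists {0..<q}" and fin: "finite C" using C(1) by (auto simp: q_ary_code_def)
  have "\<exists>h. bij_betw h {0..<mu i} {w \<in> C. length w = lam i}" if "i \<in> {1..s}" for i
    using ex_bij_betw_nat_finite[of "{w \<in> C. length w = lam i}"] fin C(3) that
    by (auto simp: has_length_distribution_def)
  then obtain h where h: "\<And>i. i \<in> {1..s} \<Longrightarrow> bij_betw (h i) {0..<mu i} {w \<in> C. length w = lam i}" by metis
  have hC: "h i j \<in> C" "length (h i j) = lam i" "h i j \<in> lists {0..<q}" if "i \<in> {1..s}" "j < mu i" for i j
  proof -
    have "h i j \<in> {w \<in> C. length w = lam i}" using bij_betwE[OF h[OF that(1)]] that(2) by simp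
    then show "h i j \<in> C" "length (h i j) = lam i" "h i j \<in> lists {0..<q}" using CQ by blast+
  qed
  have "valid_indices s q lam mu (\<lambda>i j. word_index q (h i j))"
    unfolding valid_indices_def
  proof (intro conjI ballI allI impI)
    fix i j assume "i \<in> {1..s}" "j < mu i"
    then show "word_index q (h i j) < q ^ lam i" using word_index_less[OF hC(3)] hC(2) by metis
  next
    fix i j j' assume *: "i \<in> {1..s}" "j < mu i" "j' < mu i" "j \<noteq> j'"
    then have "h i j \<noteq> h i j'" using bij_betw_imp_inj_on[OF h[OF *(1)]] by (auto simp: inj_on_def)
    then show "word_index q (h i j) \<noteq> word_index q (h i j')"
      using word_index_inj[OF hC(3) hC(3) _ _ q] hC(2) * by metis
  next
    fix i i' j j' assume *: "i \<in> {1..s}" "i' \<in> {1..s}" "i < i'" "j < mu i" "j' < mu i'"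
    let ?u = "h i j" and ?v = "h i' j'"
    have lt: "lam i < lam i'" using strict_mono_onD[OF lam *(1,2,3)] .
    note u = hC[OF *(1,4)] and v = hC[OF *(2,5)]
    have n: "\<not> strict_prefix ?u ?v" "\<not> strict_suffix ?u ?v" using C(2) u(1) v(1) by (auto simp: fix_free_def)
    have tl: "take n ?v \<in> lists {0..<q}" "drop n ?v \<in> lists {0..<q}" for n
      using v(3) by (auto simp: in_lists_conv_set dest: in_set_takeD in_set_dropD)
    show "word_index q ?v div q ^ (lam i' - lam i) \<noteq> word_index q ?u"
    proof
      assume eq: "word_index q ?v div q ^ (lam i' - lam i) = word_index q ?u"
      have "word_index q (take (lam i) ?v) = word_index q ?u"
        using word_index_split(1)[OF tl(1)[of "lam i"] tl(2)[of "lam i"] q] eq v(2) lt by simp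
      then have "take (lam i) ?v = ?u"
        using word_index_inj[OF tl(1) u(3) _ _ q] u(2) v(2) lt by simp
      then have "prefix ?u ?v" by (metis take_is_prefix)
      then show False using n(1) u(2) v(2) lt by (auto simp: strict_prefix_def)
    qed
    show "word_index q ?v mod q ^ lam i \<noteq> word_index q ?u"
    proof
      assume eq: "word_index q ?v mod q ^ lam i = word_index q ?u"
      let ?d = "lam i' - lam i"
      have "word_index q (drop ?d ?v) = word_index q ?u"
        using word_index_split(2)[OF tl(1)[of ?d] tl(2)[of ?d] q] eq v(2) lt by simp
      then have "drop ?d ?v = ?u"
        using word_index_inj[OF tl(2) u(3) _ _ q] u(2) v(2) lt by simp
      then have "suffix ?u ?v" by (metis suffix_drop)
      then show False using n(2) u(2) v(2) lt by (auto simp: strict_suffix_def)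
    qed
  qed
  then show ?thesis by blast
qed

section \<open>Coding a code by one number\<close>

definition digit :: "nat \<Rightarrow> nat \<Rightarrow> nat \<Rightarrow> nat" where
  "digit b k p = k div b ^ p mod b"

lemma ex_digits:
  assumes "\<And>p. p < N \<Longrightarrow> f p < b" "0 < b"
  shows "\<exists>k. \<forall>p<N. digit b k p = f p"
  using assms(1)
proof (induction N arbitrary: f)
  case 0
  then show ?case by simp
next
  case (Suc N)
  have "\<exists>k. \<forall>p<N. digit b k p = f (Suc p)"
    by (rule Suc.IH) (use Suc.prems in simp)
  then obtain k where k: "\<forall>p<N. digit b k p = f (Suc p)" by blast
  have "digit b (f 0 + b * k) p = f p" if "p < Suc N" for p
  proof (cases p)
    case 0
    then show ?thesis using Suc.prems[of 0] by (simp add: digit_def)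
  next
    case (Suc p')
    then show ?thesis
      using k that Suc.prems[of 0] assms(2) by (simp add: digit_def div_mult2_eq)
  qed
  then show ?case by blast
qed

text \<open>A code is coded by a single number whose base \<^term>\<open>q ^ lam s\<close> digit at position
  \<^term>\<open>j * Suc s + i\<close> is the index of the codeword number \<^term>\<open>j\<close> of length \<^term>\<open>lam i\<close>.\<close>

definition coded_index :: "nat \<Rightarrow> nat \<Rightarrow> (nat \<Rightarrow> nat) \<Rightarrow> nat \<Rightarrow> nat \<Rightarrow> nat \<Rightarrow> nat" where
  "coded_index s q lam k i j = digit (q ^ lam s) k (j * Suc s + i)"

lemma ex_coded_index:
  assumes q: "0 < q" and lam: "strict_mono_on {1..s} lam" and e: "valid_indices s q lam mu e"
  shows "\<exists>k. valid_indices s q lam mu (coded_index s q lam k)"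
proof -
  \<comment> \<open>The stride \<open>Suc s\<close> keeps i = s apart from the next j, as i runs
    from 1 to s; positions that belong to no codeword receive the digit 0.\<close>
  define f where "f p = (let i = p mod Suc s; j = p div Suc s in if i \<in> {1..s} \<and> j < mu i then e i j else 0)" for p
  define M where "M = (\<Sum>i\<in>{1..s}. mu i)"
  have bound: "f p < q ^ lam s" for p
  proof -
    have "e i j < q ^ lam s" if "i \<in> {1..s}" "j < mu i" for i j
    proof -
      have "e i j < q ^ lam i" using e that unfolding valid_indices_def by blast
      also have "lam i \<le> lam s"
        using strict_mono_onD[OF lam that(1), of s] that(1) by (cases "i = s") auto
      then have "q ^ lam i \<le> q ^ lam s" using q by (intro power_increasing) auto
      finally show ?thesis .
    qed
    then show ?thesis using q by (auto simp: f_def Let_def)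
  qed
  obtain k where k: "\<And>p. p < Suc M * Suc s \<Longrightarrow> digit (q ^ lam s) k p = f p"
    using ex_digits[of "Suc M * Suc s" f "q ^ lam s"] bound q by auto
  have eq: "coded_index s q lam k i j = e i j" if "i \<in> {1..s}" "j < mu i" for i j
  proof -
    have "mu i \<le> M" unfolding M_def using that(1) by (intro member_le_sum) auto
    then have "j * Suc s + i < Suc M * Suc s"
    proof -
      have "j * Suc s + i < Suc j * Suc s" using that(1) by simp
      also have "\<dots> \<le> Suc M * Suc s" using that(2) \<open>mu i \<le> M\<close> by (intro mult_le_mono1) simp
      finally show ?thesis .
    qed
    moreover have "(j * Suc s + i) mod Suc s = i" "(j * Suc s + i) div Suc s = j"
      using that(1) by (simp_all add: mod_mult_self3 div_mult_self3 del: mult_Suc_right)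
    ultimately show ?thesis using k that by (simp add: coded_index_def f_def del: mult_Suc_right mult_Suc)
  qed
  have "valid_indices s q lam mu (coded_index s q lam k)"
    using e unfolding valid_indices_def by (simp add: eq)
  then show ?thesis by blast
qed

section \<open>Recursiveness of the search for a code\<close>

lemma recp_all_less':
  assumes "recp (Suc n) Q" "recf n b" "\<And>k xs. length xs = n \<Longrightarrow> Q (k # xs) \<longleftrightarrow> P k xs"
  shows "recp n (\<lambda>xs. \<forall>k<b xs. P k xs)"
  by (rule recf_cong[OF recp_all_less[OF assms(1,2)]]) (simp add: assms(3))

text \<open>Entry 0 is the candidate number, followed by q, the lengths and the multiplicities. Each
  bounded quantifier puts its variable in front, so all positions move up by one \<open>Suc\<close>.
  As s is fixed, quantifiers over i are finite conjunctions.\<close>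

lemma recp_valid:
  assumes n: "2 * s < n" and s: "0 < s"
  shows "recp (Suc n) (\<lambda>ys. valid_indices s (ys ! Suc 0) (\<lambda>i. ys ! Suc i) (\<lambda>i. ys ! Suc (s + i))
    (coded_index s (ys ! Suc 0) (\<lambda>i. ys ! Suc i) (ys ! 0)))"
  unfolding valid_indices_def coded_index_def
proof (intro recp_conj recp_ball recp_imp)
  fix i assume i: "i \<in> {1..s}"
  show "recp (Suc n) (\<lambda>ys. \<forall>j<ys ! Suc (s + i).
    digit (ys ! Suc 0 ^ ys ! Suc s) (ys ! 0) (j * Suc s + i) < ys ! Suc 0 ^ ys ! Suc i)"
  proof (rule recp_all_less')
    show "recp (Suc (Suc n)) (\<lambda>zs.
      digit (zs ! Suc (Suc 0) ^ zs ! Suc (Suc s)) (zs ! Suc 0) (zs ! 0 * Suc s + i) < zs ! Suc (Suc 0) ^ zs ! Suc (Suc i))"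
      unfolding digit_def using i n by (intro rec_intros) auto
    show "recf (Suc n) (\<lambda>ys. ys ! Suc (s + i))" using i n by (intro recf_nth) auto
  qed simp
next
  fix i assume i: "i \<in> {1..s}"
  show "recp (Suc n) (\<lambda>ys. \<forall>j<ys ! Suc (s + i). \<forall>j'<ys ! Suc (s + i). j \<noteq> j' \<longrightarrow>
    digit (ys ! Suc 0 ^ ys ! Suc s) (ys ! 0) (j * Suc s + i) \<noteq> digit (ys ! Suc 0 ^ ys ! Suc s) (ys ! 0) (j' * Suc s + i))"
  proof (rule recp_all_less')
    show "recf (Suc n) (\<lambda>ys. ys ! Suc (s + i))" using i n by (intro recf_nth) auto
    show "recp (Suc (Suc n)) (\<lambda>zs. \<forall>j'<zs ! Suc (Suc (s + i)). zs ! 0 = j' \<or>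
      \<not> digit (zs ! Suc (Suc 0) ^ zs ! Suc (Suc s)) (zs ! Suc 0) (zs ! 0 * Suc s + i)
        = digit (zs ! Suc (Suc 0) ^ zs ! Suc (Suc s)) (zs ! Suc 0) (j' * Suc s + i))"
    proof (rule recp_all_less')
      show "recf (Suc (Suc n)) (\<lambda>zs. zs ! Suc (Suc (s + i)))" using i n by (intro recf_nth) auto
      show "recp (Suc (Suc (Suc n))) (\<lambda>vs. vs ! Suc 0 = vs ! 0 \<or>
        \<not> digit (vs ! Suc (Suc (Suc 0)) ^ vs ! Suc (Suc (Suc s))) (vs ! Suc (Suc 0)) (vs ! Suc 0 * Suc s + i)
        = digit (vs ! Suc (Suc (Suc 0)) ^ vs ! Suc (Suc (Suc s))) (vs ! Suc (Suc 0)) (vs ! 0 * Suc s + i))"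
        unfolding digit_def using i n by (intro rec_intros) auto
    qed simp
  qed auto
next
  fix i i' assume i: "i \<in> {1..s}" "i' \<in> {1..s}"
  show "recp (Suc n) (\<lambda>ys. \<forall>j<ys ! Suc (s + i). \<forall>j'<ys ! Suc (s + i').
    digit (ys ! Suc 0 ^ ys ! Suc s) (ys ! 0) (j' * Suc s + i') div ys ! Suc 0 ^ (ys ! Suc i' - ys ! Suc i)
      \<noteq> digit (ys ! Suc 0 ^ ys ! Suc s) (ys ! 0) (j * Suc s + i) \<and>
    digit (ys ! Suc 0 ^ ys ! Suc s) (ys ! 0) (j' * Suc s + i') mod ys ! Suc 0 ^ ys ! Suc i
      \<noteq> digit (ys ! Suc 0 ^ ys ! Suc s) (ys ! 0) (j * Suc s + i))"
  proof (rule recp_all_less')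
    show "recf (Suc n) (\<lambda>ys. ys ! Suc (s + i))" using i n by (intro recf_nth) auto
    show "recp (Suc (Suc n)) (\<lambda>zs. \<forall>j'<zs ! Suc (Suc (s + i')).
      \<not> digit (zs ! Suc (Suc 0) ^ zs ! Suc (Suc s)) (zs ! Suc 0) (j' * Suc s + i') div zs ! Suc (Suc 0) ^ (zs ! Suc (Suc i') - zs ! Suc (Suc i))
        = digit (zs ! Suc (Suc 0) ^ zs ! Suc (Suc s)) (zs ! Suc 0) (zs ! 0 * Suc s + i) \<and>
      \<not> digit (zs ! Suc (Suc 0) ^ zs ! Suc (Suc s)) (zs ! Suc 0) (j' * Suc s + i') mod zs ! Suc (Suc 0) ^ zs ! Suc (Suc i)
        = digit (zs ! Suc (Suc 0) ^ zs ! Suc (Suc s)) (zs ! Suc 0) (zs ! 0 * Suc s + i))"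
    proof (rule recp_all_less')
      show "recf (Suc (Suc n)) (\<lambda>zs. zs ! Suc (Suc (s + i')))" using i n by (intro recf_nth) auto
      let ?b = "\<lambda>vs::nat list. vs ! Suc (Suc (Suc 0)) ^ vs ! Suc (Suc (Suc s))"
      show "recp (Suc (Suc (Suc n))) (\<lambda>vs.
        \<not> digit (?b vs) (vs ! Suc (Suc 0)) (vs ! 0 * Suc s + i') div vs ! Suc (Suc (Suc 0)) ^ (vs ! Suc (Suc (Suc i')) - vs ! Suc (Suc (Suc i)))
          = digit (?b vs) (vs ! Suc (Suc 0)) (vs ! Suc 0 * Suc s + i) \<and>
        \<not> digit (?b vs) (vs ! Suc (Suc 0)) (vs ! 0 * Suc s + i') mod vs ! Suc (Suc (Suc 0)) ^ vs ! Suc (Suc (Suc i))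
          = digit (?b vs) (vs ! Suc (Suc 0)) (vs ! Suc 0 * Suc s + i))"
        unfolding digit_def using i n by (intro rec_intros) auto
    qed simp
  qed simp
qed auto

text \<open>The Kraft inequality is multiplied by 4 and by q to the sum of all lengths, which clears
  the denominators and turns it into a decidable statement about natural numbers.\<close>

lemma admissible_iff:
  "admissible s q lam mu \<longleftrightarrow> 2 \<le> q \<and> (\<forall>i\<in>{1..s}. 0 < lam i \<and> 0 < mu i) \<and>
    (\<forall>i\<in>{1..s}. \<forall>i'\<in>{1..s}. i < i' \<longrightarrow> lam i < lam i') \<and>
    4 * (\<Sum>i\<in>{1..s}. mu i * q ^ ((\<Sum>i\<in>{1..s}. lam i) - lam i)) \<le> 3 * q ^ (\<Sum>i\<in>{1..s}. lam i)"
proof -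
  define L where "L = (\<Sum>i\<in>{1..s}. lam i)"
  have "(\<Sum>i=1..s. real (mu i) / real q ^ lam i) \<le> 3 / 4 \<longleftrightarrow> 4 * (\<Sum>i\<in>{1..s}. mu i * q ^ (L - lam i)) \<le> 3 * q ^ L"
    if q: "2 \<le> q"
  proof -
    have "real (\<Sum>i\<in>{1..s}. mu i * q ^ (L - lam i)) = (\<Sum>i\<in>{1..s}. real (mu i) / real q ^ lam i * q ^ L)"
      unfolding of_nat_sum
    proof (intro sum.cong refl)
      fix i assume "i \<in> {1..s}"
      then have "lam i \<le> L" unfolding L_def by (intro member_le_sum) auto
      then have "real q ^ L = real q ^ (L - lam i) * real q ^ lam i" by (simp flip: power_add)
      then show "real (mu i * q ^ (L - lam i)) = real (mu i) / real q ^ lam i * q ^ L"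
        using q by simp
    qed
    also have "\<dots> = (\<Sum>i\<in>{1..s}. real (mu i) / real q ^ lam i) * q ^ L"
      by (simp add: sum_distrib_right)
    finally have *: "real (\<Sum>i\<in>{1..s}. mu i * q ^ (L - lam i)) = (\<Sum>i\<in>{1..s}. real (mu i) / real q ^ lam i) * q ^ L" .
    have "4 * (\<Sum>i\<in>{1..s}. mu i * q ^ (L - lam i)) \<le> 3 * q ^ L \<longleftrightarrow>
      real (4 * (\<Sum>i\<in>{1..s}. mu i * q ^ (L - lam i))) \<le> real (3 * q ^ L)" by (rule of_nat_le_iff[symmetric])
    also have "\<dots> \<longleftrightarrow> (\<Sum>i\<in>{1..s}. real (mu i) / real q ^ lam i) * q ^ L \<le> 3 / 4 * q ^ L"
      unfolding of_nat_mult * by auto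
    also have "\<dots> \<longleftrightarrow> (\<Sum>i\<in>{1..s}. real (mu i) / real q ^ lam i) \<le> 3 / 4"
      using q by (intro mult_le_cancel_right_pos) simp
    finally show ?thesis ..
  qed
  then show ?thesis
    unfolding admissible_def strict_mono_on_def L_def by blast
qed

lemma admissible_cong:
  "(\<And>i. i \<in> {1..s} \<Longrightarrow> lam i = lam' i) \<Longrightarrow> (\<And>i. i \<in> {1..s} \<Longrightarrow> mu i = mu' i) \<Longrightarrow>
    admissible s q lam mu = admissible s q lam' mu'"
  unfolding admissible_iff by simp

lemma valid_indices_cong:
  "(\<And>i. i \<in> {1..s} \<Longrightarrow> lam i = lam' i) \<Longrightarrow> (\<And>i. i \<in> {1..s} \<Longrightarrow> mu i = mu' i) \<Longrightarrow>
    valid_indices s q lam mu e = valid_indices s q lam' mu' e"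
  unfolding valid_indices_def by simp

lemma ex_valid_number:
  assumes s: "1 \<le> s" "s \<le> 3" and adm: "admissible s q lam mu"
  shows "\<exists>k. valid_indices s q lam mu (coded_index s q lam k)"
proof -
  have q: "0 < q" and lam: "strict_mono_on {1..s} lam" using adm by (auto simp: admissible_def)
  show ?thesis
    using code_exists[OF s adm] code_valid_indices[OF q lam] ex_coded_index[OF q lam] by blast
qed

text \<open>The second alternative makes the search stop, at 0, for parameters that are not
  admissible, so that the minimisation is over a regular function.\<close>

definition code_number :: "nat \<Rightarrow> nat list \<Rightarrow> nat" where
  "code_number s xs = (LEAST k.
     valid_indices s (xs ! 0) (\<lambda>i. xs ! i) (\<lambda>i. xs ! (s + i)) (coded_index s (xs ! 0) (\<lambda>i. xs ! i) k) \<or>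
     \<not> admissible s (xs ! 0) (\<lambda>i. xs ! i) (\<lambda>i. xs ! (s + i)))"

lemma recf_code_number:
  assumes s: "1 \<le> s" "s \<le> 3" and n: "2 * s < n"
  shows "recf n (code_number s)"
proof -
  let ?Q = "\<lambda>ys. valid_indices s (ys ! Suc 0) (\<lambda>i. ys ! Suc i) (\<lambda>i. ys ! Suc (s + i))
      (coded_index s (ys ! Suc 0) (\<lambda>i. ys ! Suc i) (ys ! 0)) \<or>
    \<not> admissible s (ys ! Suc 0) (\<lambda>i. ys ! Suc i) (\<lambda>i. ys ! Suc (s + i))"
  have "recp (Suc n) (\<lambda>ys. admissible s (ys ! Suc 0) (\<lambda>i. ys ! Suc i) (\<lambda>i. ys ! Suc (s + i)))"
    unfolding admissible_iff using n by (intro rec_intros) auto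
  then have "recp (Suc n) ?Q"
    using s n by (intro recp_disj recp_not recp_valid) auto
  then have "recf n (\<lambda>xs. LEAST k. ?Q (k # xs))"
    by (rule recf_least) (use ex_valid_number[OF s] in auto)
  then show ?thesis by (rule recf_cong) (simp add: code_number_def)
qed

lemma code_number_valid:
  assumes s: "1 \<le> s" "s \<le> 3" and adm: "admissible s q lam mu"
    and xs: "xs ! 0 = q" "\<And>i. i \<in> {1..s} \<Longrightarrow> xs ! i = lam i" "\<And>i. i \<in> {1..s} \<Longrightarrow> xs ! (s + i) = mu i"
  shows "valid_indices s q lam mu (coded_index s q lam (code_number s xs))"
proof -
  have A: "admissible s (xs ! 0) (\<lambda>i. xs ! i) (\<lambda>i. xs ! (s + i))"
    using adm admissible_cong[of s "\<lambda>i. xs ! i" lam "\<lambda>i. xs ! (s + i)" mu] xs by simp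
  let ?P = "\<lambda>k. valid_indices s (xs ! 0) (\<lambda>i. xs ! i) (\<lambda>i. xs ! (s + i)) (coded_index s (xs ! 0) (\<lambda>i. xs ! i) k) \<or>
     \<not> admissible s (xs ! 0) (\<lambda>i. xs ! i) (\<lambda>i. xs ! (s + i))"
  obtain k where "?P k" using ex_valid_number[OF s A] by blast
  then have "?P (code_number s xs)" unfolding code_number_def by (rule LeastI)
  then have "valid_indices s (xs ! 0) (\<lambda>i. xs ! i) (\<lambda>i. xs ! (s + i)) (coded_index s (xs ! 0) (\<lambda>i. xs ! i) (code_number s xs))"
    using A by blast
  moreover have "coded_index s (xs ! 0) (\<lambda>i. xs ! i) = coded_index s q lam"
    using xs(1) xs(2)[of s] s by (simp add: coded_index_def fun_eq_iff)
  ultimately show ?thesis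
    using valid_indices_cong[of s "\<lambda>i. xs ! i" lam "\<lambda>i. xs ! (s + i)" mu] xs by simp
qed

lemma recf_codeword_index:
  assumes s: "1 \<le> s" "s \<le> 3"
  shows "recf (2 * s + 3) (\<lambda>xs. coded_index s (xs ! 0) (\<lambda>i. xs ! i) (code_number s xs) (xs ! (2 * s + 1)) (xs ! (2 * s + 2)))"
  unfolding coded_index_def digit_def using s by (intro rec_intros recf_code_number) auto

theorem theorem1:
  fixes s :: nat
  assumes "1 \<le> s" and "s \<le> 3"
  shows "(\<forall>q lam mu. admissible s q lam mu \<longrightarrow>
            (\<exists>C. q_ary_code q C \<and> fix_free C \<and> has_length_distribution s lam mu C)) \<and>
         (\<exists>F. total_recursive (2 * s + 3) F \<and>
            (\<forall>q lam mu. admissible s q lam mu \<longrightarrow>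
               q_ary_code q (code_of_indices F s q lam mu) \<and>
               fix_free (code_of_indices F s q lam mu) \<and>
               has_length_distribution s lam mu (code_of_indices F s q lam mu)))"
proof
  show "\<forall>q lam mu. admissible s q lam mu \<longrightarrow>
      (\<exists>C. q_ary_code q C \<and> fix_free C \<and> has_length_distribution s lam mu C)"
    using code_exists[OF assms] by blast
  obtain F where F: "total_recursive (2 * s + 3) F" "\<And>xs. length xs = 2 * s + 3 \<Longrightarrow>
      F xs = coded_index s (xs ! 0) (\<lambda>i. xs ! i) (code_number s xs) (xs ! (2 * s + 1)) (xs ! (2 * s + 2))"
    using recf_codeword_index[OF assms] unfolding recf_def by blast
  have "q_ary_code q (code_of_indices F s q lam mu) \<and> fix_free (code_of_indices F s q lam mu) \<and>
      has_length_distribution s lam mu (code_of_indices F s q lam mu)" if adm: "admissible s q lam mu" for q lam mu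
  proof -
    have q: "0 < q" and lam: "strict_mono_on {1..s} lam" using adm by (auto simp: admissible_def)
    define xs where "xs i j = q # map lam [1..<s+1] @ map mu [1..<s+1] @ [i, j]" for i j
    have xs: "length (xs i j) = 2 * s + 3" "xs i j ! 0 = q" "xs i j ! (2 * s + 1) = i" "xs i j ! (2 * s + 2) = j" for i j
      by (simp_all add: xs_def nth_append del: upt_Suc)
    have xs_lam: "xs i j ! l = lam l" "xs i j ! (s + l) = mu l" if "l \<in> {1..s}" for i j l
      using that by (auto simp: xs_def nth_append nth_Cons' simp del: upt_Suc)
    have xs_coded: "coded_index s q (\<lambda>l. xs i j ! l) = coded_index s q lam" for i j
      using xs_lam(1)[of s i j] assms(1) by (simp add: coded_index_def fun_eq_iff)
    \<comment> \<open>The search reads only q, the lengths and the multiplicities. All queries (i,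
      j) therefore decode the same number, and the codewords obtained belong to one and the same
      code.\<close>
    define k where "k = code_number s (xs 0 0)"
    have k: "code_number s (xs i j) = k" for i j
      unfolding k_def code_number_def
      using admissible_cong[of s "\<lambda>l. xs i j ! l" "\<lambda>l. xs 0 0 ! l" "\<lambda>l. xs i j ! (s + l)" "\<lambda>l. xs 0 0 ! (s + l)" q]
        valid_indices_cong[of s "\<lambda>l. xs i j ! l" "\<lambda>l. xs 0 0 ! l" "\<lambda>l. xs i j ! (s + l)" "\<lambda>l. xs 0 0 ! (s + l)" q]
        xs_coded[of i j] xs_coded[of 0 0]
      by (simp add: xs(2) xs_lam)
    have "F (q # map lam [1..<s+1] @ map mu [1..<s+1] @ [i, j]) = coded_index s q lam k i j" for i j
      using F(2)[OF xs(1)[of i j], unfolded xs(2-4) k xs_coded] unfolding xs_def .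
    then have "code_of_indices F s q lam mu = {w \<in> lists {0..<q}. \<exists>i\<in>{1..s}. \<exists>j<mu i. length w = lam i \<and>
        word_index q w = coded_index s q lam k i j}"
      unfolding code_of_indices_def by (simp only:)
    moreover have "valid_indices s q lam mu (coded_index s q lam k)"
      unfolding k_def by (rule code_number_valid[OF assms adm]) (simp_all add: xs(2) xs_lam)
    ultimately show ?thesis using valid_indices_code[OF q lam] by simp
  qed
  then show "\<exists>F. total_recursive (2 * s + 3) F \<and> (\<forall>q lam mu. admissible s q lam mu \<longrightarrow>
      q_ary_code q (code_of_indices F s q lam mu) \<and> fix_free (code_of_indices F s q lam mu) \<and>
      has_length_distribution s lam mu (code_of_indices F s q lam mu))"
    using F(1) by blast
qed


end
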